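(* Let $w>0$ and let $n\ge 3$ be an odd integer. Let $R\subset H^2$ be an ordinary reduced $n$-gon of thickness $w$, and let $\widetilde R\subset H^2$ be a regular $n$-gon of thickness $w$. Then $$\operatorname{area}(R)\le \operatorname{area}(\widetilde R),$$ with equality if and only if $R$ and $\widetilde R$ are congruent.
   Context: $H^2$ is the hyperbolic plane (constant curvature $-1$) with geodesic distance $d$. A set is convex if it contains the geodesic segment joining any two of its points; a convex body is a compact convex set with non-empty interior. A polygon is a convex body that is the convex hull of a finite set; an $n$-gon is a polygon with exactly $n$ vertices (extreme points). Width: a line $\ell$ is a supporting line of a convex body $K$ if $K\cap \ell\ne\emptyset$ and $K$ lies in one of the closed half-planes bounded by $\ell$. The width of $K$ with respect to the supporting line $\ell$ is the distance between $\ell$ and $\ell'$, where $\ell'$ is a (not necessarily unique) supporting line of $K$ most distant from $\ell$. The minimal width (also called thickness) $w(K)$ is the minimum of the width over all supporting lines of $K$. Ordinary reduced polygon: an $n$-gon with $n$ odd and vertices $v_1,\dots,v_n$ in cyclic order (indices mod $n$), of thickness $w$, such that for every $i$ the distance from $v_i$ to the opposite side $[v_{i+\frac{n-1}{2}},v_{i+\frac{n+1}{2}}]$ equals $w$, and the orthogonal projection of $v_i$ onto the line through $v_{i+\frac{n-1}{2}}$ and $v_{i+\frac{n+1}{2}}$ lies in the relative interior of that side. A regular polygon is one with all sides of equal length and all angles equal. Two sets are congruent if some isometry of $H^2$ maps one onto the other. *)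

theory Defs
  imports "HOL-Analysis.Analysis"
begin

text \<open>
  The hyperbolic plane of curvature -1 in the Beltrami--Klein model: the points are those of the
  open Euclidean unit disc, and the point \<open>x\<close> stands for the point
  \<open>(x, 1) / sqrt (1 - x \<bullet> x)\<close> of the hyperboloid.  Geodesics are exactly the Euclidean chords of
  the disc.  Hence, for subsets of the disc, geodesic segments, convexity, convex hulls, extreme
  points, edges and relative interiors of segments coincide with the Euclidean ones, for which the
  library notions are used; the model also carries the usual topology.
  Distances, angles, orthogonality and area are not the Euclidean ones.
\<close>

definition hplane :: "(real^2) set" where
  "hplane = ball 0 1"

definition hdist :: "real^2 \<Rightarrow> real^2 \<Rightarrow> real" where
  "hdist x y = arcosh ((1 - x \<bullet> y) / sqrt ((1 - x \<bullet> x) * (1 - y \<bullet> y)))"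

text \<open>The Riemannian metric tensor of the model, at the point \<open>p\<close>.\<close>

definition hmetric :: "real^2 \<Rightarrow> real^2 \<Rightarrow> real^2 \<Rightarrow> real" where
  "hmetric p u v = (u \<bullet> v) / (1 - p \<bullet> p) + (p \<bullet> u) * (p \<bullet> v) / (1 - p \<bullet> p)\<^sup>2"

text \<open>
  The angle at \<open>p\<close> between the geodesics from \<open>p\<close> to \<open>a\<close> and to \<open>b\<close>; as geodesics are chords,
  their directions at \<open>p\<close> are \<open>a - p\<close> and \<open>b - p\<close>.
\<close>

definition hangle :: "real^2 \<Rightarrow> real^2 \<Rightarrow> real^2 \<Rightarrow> real" where
  "hangle a p b =
     arccos (hmetric p (a - p) (b - p) /
       sqrt (hmetric p (a - p) (a - p) * hmetric p (b - p) (b - p)))"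

text \<open>The density is the square root of the determinant of the metric tensor.\<close>

definition harea :: "(real^2) set \<Rightarrow> real" where
  "harea K = (LINT x:K|lborel. 1 / sqrt (1 - x \<bullet> x) ^ 3)"

definition hisometry :: "(real^2 \<Rightarrow> real^2) \<Rightarrow> bool" where
  "hisometry f \<longleftrightarrow> bij_betw f hplane hplane \<and>
     (\<forall>x\<in>hplane. \<forall>y\<in>hplane. hdist (f x) (f y) = hdist x y)"

definition hcongruent :: "(real^2) set \<Rightarrow> (real^2) set \<Rightarrow> bool" where
  "hcongruent A B \<longleftrightarrow> (\<exists>f. hisometry f \<and> f ` A = B)"

definition hsetdist :: "(real^2) set \<Rightarrow> (real^2) set \<Rightarrow> real" where
  "hsetdist A B = (INF (x, y)\<in>A \<times> B. hdist x y)"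

definition hline_through :: "real^2 \<Rightarrow> real^2 \<Rightarrow> (real^2) set" where
  "hline_through a b = affine hull {a, b} \<inter> hplane"

text \<open>
  \<open>p\<close> is the foot of the perpendicular from \<open>x\<close> to \<open>l\<close> (if \<open>x\<close> lies on \<open>l\<close>, this forces \<open>p = x\<close>).
\<close>

definition is_hprojection :: "(real^2) set \<Rightarrow> real^2 \<Rightarrow> real^2 \<Rightarrow> bool" where
  "is_hprojection l x p \<longleftrightarrow> p \<in> l \<and> (\<forall>q\<in>l. hmetric p (x - p) (q - p) = 0)"

text \<open>
  Every line is \<open>{x \<in> hplane. a \<bullet> x = b}\<close> with \<open>a \<noteq> 0\<close>; its closed half-planes are given by \<open>\<le>\<close>
  and \<open>\<ge>\<close>, which are exchanged on replacing \<open>(a, b)\<close> by \<open>(- a, - b)\<close>.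
\<close>

definition supporting_line :: "(real^2) set \<Rightarrow> (real^2) set \<Rightarrow> bool" where
  "supporting_line K l \<longleftrightarrow>
     (\<exists>a b. a \<noteq> 0 \<and> l = {x \<in> hplane. a \<bullet> x = b} \<and> K \<inter> l \<noteq> {} \<and>
        K \<subseteq> {x \<in> hplane. a \<bullet> x \<le> b})"

text \<open>
  For a convex body the supremum and the infimum below are attained, by compactness of the set of
  its supporting lines.
\<close>

definition hwidth :: "(real^2) set \<Rightarrow> (real^2) set \<Rightarrow> real" where
  "hwidth K l = (SUP l'\<in>{l'. supporting_line K l'}. hsetdist l l')"

definition thickness :: "(real^2) set \<Rightarrow> real" where
  "thickness K = (INF l\<in>{l. supporting_line K l}. hwidth K l)"

definition hconvex_body :: "(real^2) set \<Rightarrow> bool" where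
  "hconvex_body K \<longleftrightarrow> K \<subseteq> hplane \<and> compact K \<and> convex K \<and> interior K \<noteq> {}"

definition hpolygon :: "(real^2) set \<Rightarrow> bool" where
  "hpolygon P \<longleftrightarrow> hconvex_body P \<and> (\<exists>V. finite V \<and> P = convex hull V)"

definition hngon :: "nat \<Rightarrow> (real^2) set \<Rightarrow> bool" where
  "hngon n P \<longleftrightarrow> hpolygon P \<and> card {x. x extreme_point_of P} = n"

text \<open>
  \<open>v 0, \<dots>, v (n - 1)\<close> are the vertices of the \<open>n\<close>-gon \<open>P\<close> in cyclic order (in either orientation):
  vertices that are consecutive modulo \<open>n\<close> are the endpoints of a side.
\<close>

definition cyclic_vertices :: "nat \<Rightarrow> (nat \<Rightarrow> real^2) \<Rightarrow> (real^2) set \<Rightarrow> bool" where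
  "cyclic_vertices n v P \<longleftrightarrow>
     bij_betw v {..<n} {x. x extreme_point_of P} \<and>
     (\<forall>i<n. closed_segment (v i) (v ((i + 1) mod n)) edge_of P)"

definition ordinary_reduced :: "nat \<Rightarrow> real \<Rightarrow> (real^2) set \<Rightarrow> bool" where
  "ordinary_reduced n w P \<longleftrightarrow> odd n \<and> hngon n P \<and> thickness P = w \<and>
     (\<exists>v. cyclic_vertices n v P \<and>
        (\<forall>i<n. let a = v ((i + (n - 1) div 2) mod n); b = v ((i + (n + 1) div 2) mod n) in
           hsetdist {v i} (closed_segment a b) = w \<and>
           (\<exists>p. is_hprojection (hline_through a b) (v i) p \<and>
                p \<in> rel_interior (closed_segment a b))))"

definition regular_ngon :: "nat \<Rightarrow> (real^2) set \<Rightarrow> bool" where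
  "regular_ngon n P \<longleftrightarrow> hngon n P \<and>
     (\<exists>v. cyclic_vertices n v P \<and>
        (\<exists>s. \<forall>i<n. hdist (v i) (v ((i + 1) mod n)) = s) \<and>
        (\<exists>\<alpha>. \<forall>i<n. hangle (v ((i + n - 1) mod n)) (v i) (v ((i + 1) mod n)) = \<alpha>))"

end

theory Submission
  imports Defs
begin

text \<open>
  Write \<open>n = 2 m + 1\<close>.  The heights from the vertices \<open>v i\<close> and \<open>v (i + m)\<close> of an ordinary reduced
  polygon have the same length \<open>w\<close>, so with the two sides they stand on they bound two congruent
  right triangles, a butterfly, with the angle \<open>\<phi> i\<close> at the common point of the heights and \<open>\<psi> i\<close> at
  the vertices; with \<open>C = cosh w\<close> and \<open>S = sin (\<psi> i)\<close> one has \<open>cos (\<phi> i) = S (C + S) / (1 + C S)\<close>.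
  Every angle of the polygon is a sum of two of the \<open>\<psi> i\<close>, hence the area is
  \<open>(n - 2) \<pi> - 2 \<Sum>i. \<psi> i\<close> by the theorem of Gauss and Bonnet.  The heights, taken in the order
  \<open>0, m, 2 m, \<dots>\<close>, turn by the angles \<open>\<phi> i\<close> and complete a half-turn; since the angle sum of a
  triangle is less than \<open>\<pi>\<close>, this gives \<open>\<Sum>i. \<phi> i \<le> \<pi>\<close>.  Finally \<open>\<phi>\<close> is a strictly decreasing and
  strictly convex function of \<open>\<psi>\<close>, so \<open>\<Sum>i. \<psi> i\<close> is smallest exactly when every \<open>\<phi> i\<close> is \<open>\<pi> / n\<close>,
  which is the case for the regular polygon.  In the equality case all butterflies are congruent,
  and the reflection symmetry of four consecutive vertices, taken with step \<open>m\<close>, places the vertices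
  on a circle.
\<close>

subsection \<open>The hyperboloid model\<close>

text \<open>The heights need not pass through one common point, so their angles can only be bounded
  by \<pi>. The error has the favourable sign: smaller \<phi> i mean larger \<psi> i and hence less
  area. The delicate point is that the lines of the heights turn monotonically through a half-turn.
  This is expressed by signs: up to one common factor, the cross products of their alternately
  signed normals all lie in the future cone, that is, any two heights meet and do so with the right
  orientation. The formula for cos \<phi> comes from a linear dependence: two vertices and two side
  normals are four vectors in a space of dimension three, so their Gram determinant vanishes. The
  regular polygon is not treated as a reduced polygon. It is moved to a position centred at the
  origin of the disc, where area and thickness are explicit functions of the Euclidean circumradius;
  these functions satisfy the butterfly relation with the angle \<pi> / n, which is what links the
  two areas. The convexity is strict because of a factor \<open>C\<^sup>2 - 1\<close>, so it
  degenerates as w tends to 0, where \<phi> + \<psi> becomes constant as in the Euclidean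
  plane.\<close>

definition lor :: "real^3 \<Rightarrow> real^3 \<Rightarrow> real" where
  "lor x y = x$1 * y$1 + x$2 * y$2 - x$3 * y$3"

text \<open>On points of the hyperboloid or of the cone over the disc, the sign is the orientation
  of the triangle; all statements about convex position are phrased by it.\<close>

definition ldet :: "real^3 \<Rightarrow> real^3 \<Rightarrow> real^3 \<Rightarrow> real" where
  "ldet x y z = (x$2*y$3 - x$3*y$2) * z$1 + (x$3*y$1 - x$1*y$3) * z$2 + (x$1*y$2 - x$2*y$1) * z$3"

text \<open>The cross product with respect to \<open>lor\<close>, hence the sign of the last component.\<close>

definition lcross :: "real^3 \<Rightarrow> real^3 \<Rightarrow> real^3" where
  "lcross x y = vector [x$2*y$3 - x$3*y$2, x$3*y$1 - x$1*y$3, - (x$1*y$2 - x$2*y$1)]"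

lemma lcross_nth [simp]:
  "lcross x y $ 1 = x$2*y$3 - x$3*y$2" "lcross x y $ 2 = x$3*y$1 - x$1*y$3"
  "lcross x y $ 3 = - (x$1*y$2 - x$2*y$1)"
  by (simp_all add: lcross_def)

lemma lor_commute: "lor x y = lor y x"
  by (simp add: lor_def mult.commute)

lemma lor_simps [simp]:
  "lor (x + y) z = lor x z + lor y z" "lor z (x + y) = lor z x + lor z y"
  "lor (x - y) z = lor x z - lor y z" "lor z (x - y) = lor z x - lor z y"
  "lor (c *\<^sub>R x) z = c * lor x z" "lor z (c *\<^sub>R x) = c * lor z x"
  "lor (- x) z = - lor x z" "lor z (- x) = - lor z x"
  "lor 0 z = 0" "lor z 0 = 0"
  by (simp_all add: lor_def algebra_simps)

lemma lor_sum_right: "lor z (sum f A) = (\<Sum>i\<in>A. lor z (f i))"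
  by (induction A rule: infinite_finite_induct) auto

lemma lor_lcross [simp]: "lor (lcross x y) z = ldet x y z"
  by (simp add: lor_def ldet_def algebra_simps)

lemma ldet_simps [simp]:
  "ldet (x + y) z w = ldet x z w + ldet y z w" "ldet z (x + y) w = ldet z x w + ldet z y w"
  "ldet z w (x + y) = ldet z w x + ldet z w y"
  "ldet (x - y) z w = ldet x z w - ldet y z w" "ldet z (x - y) w = ldet z x w - ldet z y w"
  "ldet z w (x - y) = ldet z w x - ldet z w y"
  "ldet (c *\<^sub>R x) z w = c * ldet x z w" "ldet z (c *\<^sub>R x) w = c * ldet z x w"
  "ldet z w (c *\<^sub>R x) = c * ldet z w x"
  "ldet x x z = 0" "ldet x z x = 0" "ldet z x x = 0"
  by (simp_all add: ldet_def algebra_simps)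

lemma ldet_rotate: "ldet x y z = ldet y z x" 
  by (simp add: ldet_def algebra_simps)

lemma ldet_swap: "ldet y x z = - ldet x y z" "ldet x z y = - ldet x y z"
  by (simp_all add: ldet_def algebra_simps)

lemma lor_lcross_lcross: "lor (lcross a b) (lcross c d) = lor a d * lor b c - lor a c * lor b d"
  by (simp add: lor_def algebra_simps)

lemma lcross_lcross: "lcross (lcross a b) c = lor b c *\<^sub>R a - lor a c *\<^sub>R b"
  by (simp add: vec_eq_iff forall_3 lor_def algebra_simps)

text \<open>The right-hand side is the negative Gram determinant of \<open>x\<close>,
  \<open>y\<close>, \<open>z\<close>, because the matrix of \<open>lor\<close> has determinant
  -1.\<close>

lemma ldet_square:
  "(ldet x y z)\<^sup>2 = - (lor x x * (lor y y * lor z z - (lor y z)\<^sup>2)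
      - lor x y * (lor x y * lor z z - lor y z * lor x z)
      + lor x z * (lor x y * lor y z - lor y y * lor x z))"
  by (simp add: lor_def ldet_def power2_eq_square algebra_simps)

lemma ldet_cramer:
  "ldet a b c *\<^sub>R x = ldet x b c *\<^sub>R a + ldet a x c *\<^sub>R b + ldet a b x *\<^sub>R c"
  by (simp add: vec_eq_iff forall_3 ldet_def algebra_simps)

lemma lor_nondegenerate:
  assumes "ldet a b c \<noteq> 0" "lor x a = lor y a" "lor x b = lor y b" "lor x c = lor y c"
  shows "x = y"
proof -
  have 0: "lor (x - y) a = 0" "lor (x - y) b = 0" "lor (x - y) c = 0" using assms by auto
  have *: "lor (x - y) z = 0" for z
  proof -
    have "lor (x - y) (ldet a b c *\<^sub>R z) = 0"
      by (subst ldet_cramer) (simp only: lor_simps(2,6) 0 mult_zero_right add_0_right)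
    then show ?thesis using assms(1) by (simp only: lor_simps(6) mult_eq_0_iff) simp
  qed
  show ?thesis
    using *[of "axis 1 1"] *[of "axis 2 1"] *[of "axis 3 1"]
    by (simp add: lor_def axis_def vec_eq_iff forall_3 del: lor_simps)
qed

definition H2 :: "(real^3) set" where
  "H2 = {X. lor X X = -1 \<and> X$3 > 0}"

definition future :: "(real^3) set" where
  "future = {X. lor X X < 0 \<and> X$3 > 0}"

lemma H2_future: "X \<in> H2 \<Longrightarrow> X \<in> future"
  by (auto simp: H2_def future_def)

lemma H2_self: "X \<in> H2 \<Longrightarrow> lor X X = -1"
  by (auto simp: H2_def)

lemma future_iff: "X \<in> future \<longleftrightarrow> (X$1)\<^sup>2 + (X$2)\<^sup>2 < (X$3)\<^sup>2 \<and> X$3 > 0"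
  by (auto simp: future_def lor_def power2_eq_square)

lemma future_lor_neg:
  assumes "X \<in> future" "Y \<in> future"
  shows "lor X Y < 0"
proof -
  have "(X$1 * Y$1 + X$2 * Y$2)\<^sup>2 \<le> ((X$1)\<^sup>2 + (X$2)\<^sup>2) * ((Y$1)\<^sup>2 + (Y$2)\<^sup>2)"
    using zero_le_power2[of "X$1 * Y$2 - X$2 * Y$1"] by (simp add: power2_eq_square algebra_simps)
  also have "\<dots> < (X$3)\<^sup>2 * (Y$3)\<^sup>2"
    using assms unfolding future_iff by (intro mult_strict_mono') auto
  also have "\<dots> = (X$3 * Y$3)\<^sup>2" by (simp add: power_mult_distrib)
  finally have "X$1 * Y$1 + X$2 * Y$2 < X$3 * Y$3"
    using assms unfolding future_iff by (auto intro: power2_less_imp_less)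
  then show ?thesis by (simp add: lor_def)
qed

text \<open>The difference of the squares is a sum of squares. As \<open>- lor X Y\<close> is cosh
  of a distance, this bound is what puts it into the domain of \<open>arcosh\<close>.\<close>

lemma reverse_cauchy:
  assumes "X \<in> H2" "Y \<in> H2"
  shows "lor X Y \<le> -1"
proof -
  have x: "(X$3)\<^sup>2 = 1 + ((X$1)\<^sup>2 + (X$2)\<^sup>2)" and y: "(Y$3)\<^sup>2 = 1 + ((Y$1)\<^sup>2 + (Y$2)\<^sup>2)"
    using H2_self[OF assms(1)] H2_self[OF assms(2)] unfolding lor_def power2_eq_square by linarith+
  have p: "X$3 > 0" "Y$3 > 0" using assms by (auto simp: H2_def)
  have "(1 + (X$1 * Y$1 + X$2 * Y$2))\<^sup>2 \<le> (1 + ((X$1)\<^sup>2 + (X$2)\<^sup>2)) * (1 + ((Y$1)\<^sup>2 + (Y$2)\<^sup>2))"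
  proof -
    have "(1 + ((X$1)\<^sup>2 + (X$2)\<^sup>2)) * (1 + ((Y$1)\<^sup>2 + (Y$2)\<^sup>2)) - (1 + (X$1 * Y$1 + X$2 * Y$2))\<^sup>2
        = (X$1 * Y$2 - X$2 * Y$1)\<^sup>2 + ((X$1 - Y$1)\<^sup>2 + (X$2 - Y$2)\<^sup>2)"
      by (simp add: power2_eq_square algebra_simps)
    also have "\<dots> \<ge> 0" by simp
    finally show ?thesis by simp
  qed
  also have "\<dots> = (X$3 * Y$3)\<^sup>2" by (simp only: power_mult_distrib x y)
  finally have "1 + (X$1 * Y$1 + X$2 * Y$2) \<le> X$3 * Y$3"
    by (rule power2_le_imp_le) (use p in simp)
  then show ?thesis by (simp add: lor_def)
qed

lemma future_add: assumes "X \<in> future" "Y \<in> future" shows "X + Y \<in> future"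
  using future_lor_neg[OF assms] lor_commute[of Y X] assms
  unfolding future_def mem_Collect_eq lor_simps vector_add_component by linarith

lemma future_scale: "X \<in> future \<Longrightarrow> c > 0 \<Longrightarrow> c *\<^sub>R X \<in> future"
  by (auto simp: future_def mult_pos_neg)

lemma future_or_past: "lor X X < 0 \<Longrightarrow> X \<in> future \<or> - X \<in> future"
proof -
  assume a: "lor X X < 0"
  have "X$3 \<noteq> 0"
  proof
    assume "X$3 = 0"
    then have "lor X X = (X$1)\<^sup>2 + (X$2)\<^sup>2" by (simp add: lor_def power2_eq_square)
    then show False using a sum_power2_ge_zero[of "X$1" "X$2"] by linarith
  qed
  then show ?thesis using a by (auto simp: future_def)
qed

text \<open>Cauchy-Schwarz in the first two coordinates. Hence \<open>lor\<close> is positive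
  definite on tangent planes of the hyperboloid, and normals of lines that meet the disc can be
  scaled to unit length.\<close>

lemma orthogonal_timelike_spacelike:
  assumes "X \<in> future" "lor X Y = 0" "Y \<noteq> 0"
  shows "lor Y Y > 0"
proof -
  have "X$3 * Y$3 = X$1*Y$1 + X$2*Y$2" using assms(2) by (simp add: lor_def)
  then have "(X$3)\<^sup>2 * (Y$3)\<^sup>2 = (X$1*Y$1 + X$2*Y$2)\<^sup>2"
    by (simp only: power_mult_distrib[symmetric])
  also have "\<dots> \<le> ((X$1)\<^sup>2 + (X$2)\<^sup>2) * ((Y$1)\<^sup>2 + (Y$2)\<^sup>2)"
    using zero_le_power2[of "X$1 * Y$2 - X$2 * Y$1"] by (simp add: power2_eq_square algebra_simps)
  finally have le: "(X$3)\<^sup>2 * (Y$3)\<^sup>2 \<le> ((X$1)\<^sup>2 + (X$2)\<^sup>2) * ((Y$1)\<^sup>2 + (Y$2)\<^sup>2)" .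
  have lt: "(X$1)\<^sup>2 + (X$2)\<^sup>2 < (X$3)\<^sup>2" using assms(1) by (auto simp: future_def lor_def power2_eq_square)
  have pos: "(Y$1)\<^sup>2 + (Y$2)\<^sup>2 > 0"
  proof (rule ccontr)
    assume "\<not> ?thesis"
    then have z: "Y$1 = 0" "Y$2 = 0" by (auto simp: sum_power2_gt_zero_iff)
    then have "Y$3 = 0" using \<open>X$3 * Y$3 = _\<close> assms(1) by (auto simp: future_def)
    then show False using z assms(3) by (simp add: vec_eq_iff forall_3)
  qed
  have "(X$3)\<^sup>2 * (Y$3)\<^sup>2 < (X$3)\<^sup>2 * ((Y$1)\<^sup>2 + (Y$2)\<^sup>2)"
    using le mult_strict_right_mono[OF lt pos] by linarith
  moreover have "(X$3)\<^sup>2 > 0" using assms(1) by (simp add: future_def)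
  ultimately have "(Y$3)\<^sup>2 < (Y$1)\<^sup>2 + (Y$2)\<^sup>2" by (simp only: mult_less_cancel_left_pos)
  then show ?thesis by (simp add: lor_def power2_eq_square)
qed

text \<open>The representative of \<open>p\<close> at height 1. Unlike \<open>lift\<close> it is
  affine in \<open>p\<close>, so that \<open>ldet\<close> of three such points is twice a signed
  Euclidean area.\<close>

definition hl :: "real^2 \<Rightarrow> real^3" where "hl p = vector [p$1, p$2, 1]"

definition lift :: "real^2 \<Rightarrow> real^3" where "lift p = (1 / sqrt (1 - p \<bullet> p)) *\<^sub>R hl p"

definition proj :: "real^3 \<Rightarrow> real^2" where "proj X = vector [X$1 / X$3, X$2 / X$3]"

lemma hl_nth [simp]: "hl p $ 1 = p$1" "hl p $ 2 = p$2" "hl p $ 3 = 1"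
  by (simp_all add: hl_def)

lemma proj_nth [simp]: "proj X $ 1 = X$1 / X$3" "proj X $ 2 = X$2 / X$3"
  by (simp_all add: proj_def)

lemma inner2: "(x::real^2) \<bullet> y = x$1 * y$1 + x$2 * y$2"
  by (simp add: inner_vec_def sum_2)

lemma hplane_iff: "p \<in> hplane \<longleftrightarrow> p \<bullet> p < 1"
  by (simp add: hplane_def norm_eq_sqrt_inner)

lemma lor_hl: "lor (hl p) (hl q) = p \<bullet> q - 1"
  by (simp add: lor_def inner2)

lemma hl_future: "hl p \<in> future \<longleftrightarrow> p \<in> hplane"
  by (simp add: future_def lor_hl hplane_iff)

lemma lor_lift: "lor (lift p) (lift q) = (p \<bullet> q - 1) / (sqrt (1 - p \<bullet> p) * sqrt (1 - q \<bullet> q))"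
  by (simp add: lift_def lor_hl)

lemma lift_H2 [simp]: "p \<in> hplane \<Longrightarrow> lift p \<in> H2"
  unfolding H2_def mem_Collect_eq lor_lift hplane_iff
  by (auto simp: lift_def real_sqrt_mult[symmetric] field_simps)

lemma proj_scale [simp]: "c \<noteq> 0 \<Longrightarrow> proj (c *\<^sub>R X) = proj X"
  by (simp add: vec_eq_iff forall_2)

lemma proj_hl [simp]: "proj (hl p) = p"
  by (simp add: vec_eq_iff forall_2)

lemma proj_lift [simp]: "p \<in> hplane \<Longrightarrow> proj (lift p) = p"
  by (simp add: lift_def hplane_iff)

lemma hl_proj: "X \<in> future \<Longrightarrow> X = X$3 *\<^sub>R hl (proj X)"
  by (auto simp: vec_eq_iff forall_3 future_def)

lemma proj_hplane: "X \<in> future \<Longrightarrow> proj X \<in> hplane"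
proof -
  assume X: "X \<in> future"
  have "lor X X = lor (X$3 *\<^sub>R hl (proj X)) (X$3 *\<^sub>R hl (proj X))" by (intro arg_cong2[where f=lor] hl_proj X)
  then have "lor X X = (X$3 * X$3) * lor (hl (proj X)) (hl (proj X))" by simp
  then have "lor (hl (proj X)) (hl (proj X)) < 0" using X
    by (auto simp: future_def zero_less_mult_iff mult_less_0_iff)
  then show ?thesis by (simp add: lor_hl hplane_iff)
qed

lemma lift_proj: "X \<in> H2 \<Longrightarrow> lift (proj X) = X"
proof -
  assume X: "X \<in> H2"
  let ?p = "proj X"
  have f: "X \<in> future" using X by (rule H2_future)
  have p: "?p \<in> hplane" using proj_hplane[OF f] .
  have "-1 = (X$3)\<^sup>2 * (?p \<bullet> ?p - 1)"
  proof -
    have "-1 = lor X X" using X by (simp add: H2_self)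
    also have "\<dots> = lor (X$3 *\<^sub>R hl ?p) (X$3 *\<^sub>R hl ?p)" by (intro arg_cong2[where f=lor] hl_proj f)
    finally show ?thesis by (simp add: lor_hl power2_eq_square mult.assoc)
  qed
  moreover have "X$3 > 0" using f by (simp add: future_def)
  ultimately have "1 - ?p \<bullet> ?p = (1 / X$3)\<^sup>2" by (simp add: field_simps)
  then have "sqrt (1 - ?p \<bullet> ?p) = 1 / X$3" using f by (simp add: future_def)
  then show ?thesis unfolding lift_def by (simp add: hl_proj[OF f, symmetric])
qed

lemma hl_lift: "p \<in> hplane \<Longrightarrow> hl p = sqrt (1 - p \<bullet> p) *\<^sub>R lift p"
  by (simp add: lift_def hplane_iff)

lemma hdist_lift: "hdist p q = arcosh (- lor (lift p) (lift q))"
  by (simp add: hdist_def lor_lift real_sqrt_mult minus_divide_left)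

lemma cosh_hdist: "p \<in> hplane \<Longrightarrow> q \<in> hplane \<Longrightarrow> cosh (hdist p q) = - lor (lift p) (lift q)"
  using reverse_cauchy[of "lift p" "lift q"] by (simp add: hdist_lift)

lemma hdist_nonneg: "p \<in> hplane \<Longrightarrow> q \<in> hplane \<Longrightarrow> hdist p q \<ge> 0"
  using reverse_cauchy[of "lift p" "lift q"] by (simp add: hdist_lift arcosh_nonneg_real)

subsection \<open>Lorentz maps\<close>

definition lorentz :: "(real^3 \<Rightarrow> real^3) \<Rightarrow> bool" where
  "lorentz f \<longleftrightarrow> linear f \<and> (\<forall>x y. lor (f x) (f y) = lor x y) \<and> (\<forall>x\<in>future. f x \<in> future)"

lemma lorentzD:
  assumes "lorentz f"
  shows "linear f" "lor (f x) (f y) = lor x y" "X \<in> future \<Longrightarrow> f X \<in> future"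
  using assms by (auto simp: lorentz_def)

lemma lorentz_H2: "lorentz f \<Longrightarrow> X \<in> H2 \<Longrightarrow> f X \<in> H2"
  using lorentzD(2)[of f X X] lorentzD(3)[of f X] H2_future[of X] by (auto simp: H2_def future_def)

lemma lorentz_comp: "lorentz f \<Longrightarrow> lorentz g \<Longrightarrow> lorentz (f \<circ> g)"
  by (auto simp: lorentz_def linear_compose)

lemma lor_zero_imp_zero: "(\<And>z. lor x z = 0) \<Longrightarrow> x = 0"
proof -
  assume a: "\<And>z. lor x z = 0"
  show "x = 0"
    using a[of "axis 1 1"] a[of "axis 2 1"] a[of "axis 3 1"]
    by (simp add: lor_def axis_def vec_eq_iff forall_3)
qed

lemma lorentz_bij: assumes "lorentz f" shows "bij f"
proof -
  have l: "linear f" using lorentzD(1)[OF assms] .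
  have "inj f" unfolding linear_injective_0[OF l]
  proof (intro allI impI)
    fix x assume "f x = 0"
    have "lor x z = 0" for z
    proof -
      have "lor x z = lor (f x) (f z)" using lorentzD(2)[OF assms] by simp
      then show ?thesis using \<open>f x = 0\<close> by simp
    qed
    then show "x = 0" by (rule lor_zero_imp_zero)
  qed
  moreover have "surj f" by (rule linear_injective_imp_surjective[OF l \<open>inj f\<close>]) simp
  ultimately show ?thesis by (simp add: bij_def)
qed

lemma lorentz_inv: assumes "lorentz f" shows "lorentz (inv f)"
proof -
  have b: "bij f" using lorentz_bij[OF assms] .
  have i: "f (inv f x) = x" for x using b by (simp add: bij_is_surj surj_f_inv_f)
  have l: "linear f" using lorentzD(1)[OF assms] .
  have li: "linear (inv f)"
    using linear_inj_imp_surj b l inj_linear_imp_inv_linear bij_is_inj by blast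
  have p: "lor (inv f x) (inv f y) = lor x y" for x y
    using lorentzD(2)[OF assms, of "inv f x" "inv f y"] i by simp
  have "inv f x \<in> future" if x: "x \<in> future" for x
  proof (rule ccontr)
    assume n: "inv f x \<notin> future"
    have "lor (inv f x) (inv f x) < 0" using p x by (simp add: future_def)
    then have "- inv f x \<in> future" using future_or_past n by blast
    then have "f (- inv f x) \<in> future" using lorentzD(3)[OF assms] by blast
    then have "- x \<in> future" using l i by (simp add: linear_neg)
    then show False using x by (auto simp: future_def)
  qed
  then show ?thesis using li p by (auto simp: lorentz_def)
qed

text \<open>Only the square is preserved, as a reflection reverses the sign of
  \<open>ldet\<close>.\<close>

lemma lorentz_ldet_square: "lorentz f \<Longrightarrow> (ldet (f x) (f y) (f z))\<^sup>2 = (ldet x y z)\<^sup>2"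
  by (simp add: ldet_square lorentzD(2))

definition hmap :: "(real^3 \<Rightarrow> real^3) \<Rightarrow> real^2 \<Rightarrow> real^2" where
  "hmap f p = proj (f (hl p))"

lemma hl_in_future: "p \<in> hplane \<Longrightarrow> hl p \<in> future"
  by (simp add: hl_future)

lemma hmap_hplane: "lorentz f \<Longrightarrow> p \<in> hplane \<Longrightarrow> hmap f p \<in> hplane"
  using lorentzD(3)[of f "hl p"] by (simp add: hmap_def proj_hplane hl_in_future)

lemma hmap_lift: assumes "lorentz f" "p \<in> hplane" shows "hmap f p = proj (f (lift p))"
proof -
  have "f (lift p) = (1 / sqrt (1 - p \<bullet> p)) *\<^sub>R f (hl p)"
    unfolding lift_def by (rule linear_cmul[OF lorentzD(1)[OF assms(1)]])
  then show ?thesis using assms(2) unfolding hmap_def by (simp add: hplane_iff)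
qed

lemma lift_hmap: "lorentz f \<Longrightarrow> p \<in> hplane \<Longrightarrow> lift (hmap f p) = f (lift p)"
  by (simp add: hmap_lift lift_proj lorentz_H2)

lemma hmap_comp: assumes "lorentz f" "lorentz g" "p \<in> hplane" shows "hmap (f \<circ> g) p = hmap f (hmap g p)"
proof -
  have "hmap f (hmap g p) = proj (f (lift (hmap g p)))"
    using assms by (simp add: hmap_lift[OF assms(1)] hmap_hplane)
  then show ?thesis using assms by (simp add: hmap_lift[OF lorentz_comp] lift_hmap)
qed

lemma hmap_id: "hmap id p = p"
  by (simp add: hmap_def)

lemma hmap_inv:
  assumes "lorentz f" "p \<in> hplane"
  shows "hmap (inv f) (hmap f p) = p" "hmap f (hmap (inv f) p) = p"
proof -
  have b: "bij f" using lorentz_bij[OF assms(1)] .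
  have 1: "inv f \<circ> f = id" using b by (simp add: bij_is_inj)
  have 2: "f \<circ> inv f = id" using b by (simp add: bij_is_surj surj_iff[symmetric])
  show "hmap (inv f) (hmap f p) = p"
    using hmap_comp[OF lorentz_inv[OF assms(1)] assms(1,2)] by (simp add: 1 hmap_id)
  show "hmap f (hmap (inv f) p) = p"
    using hmap_comp[OF assms(1) lorentz_inv[OF assms(1)] assms(2)] by (simp add: 2 hmap_id)
qed

lemma hmap_inj_on: "lorentz f \<Longrightarrow> A \<subseteq> hplane \<Longrightarrow> inj_on (hmap f) A"
  by (metis hmap_inv(1) inj_on_inverseI subsetD)

lemma hmap_bij: assumes "lorentz f" shows "bij_betw (hmap f) hplane hplane"
  by (rule bij_betw_byWitness[where f' = "hmap (inv f)"])
     (auto simp: assms hmap_inv hmap_hplane lorentz_inv)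

lemma hdist_hmap: "lorentz f \<Longrightarrow> p \<in> hplane \<Longrightarrow> q \<in> hplane \<Longrightarrow> hdist (hmap f p) (hmap f q) = hdist p q"
  by (simp add: hdist_lift lift_hmap lorentzD(2))

lemma hisometry_hmap: "lorentz f \<Longrightarrow> hisometry (hmap f)"
  by (simp add: hisometry_def hmap_bij hdist_hmap)

lemma convex_hplane: "convex hplane" by (simp add: hplane_def)

text \<open>A linear map followed by central projection sends chords to chords; only the parameter
  on the chord changes.\<close>

lemma hmap_segment_subset:
  assumes "lorentz f" "a \<in> hplane" "b \<in> hplane" 
  shows "hmap f ` closed_segment a b \<subseteq> closed_segment (hmap f a) (hmap f b)"
proof
  fix y assume "y \<in> hmap f ` closed_segment a b"
  then obtain u where u: "0 \<le> u" "u \<le> 1" and y: "y = hmap f ((1 - u) *\<^sub>R a + u *\<^sub>R b)"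
    by (auto simp: in_segment)
  define A B where "A = f (hl a)" and "B = f (hl b)"
  have AB: "A \<in> future" "B \<in> future"
    using assms lorentzD(3)[OF assms(1)] by (simp_all add: A_def B_def hl_in_future)
  have A: "A = A$3 *\<^sub>R hl (hmap f a)" and B: "B = B$3 *\<^sub>R hl (hmap f b)"
    using AB hl_proj by (simp_all add: A_def B_def hmap_def)
  have pos: "A$3 > 0" "B$3 > 0" using AB by (auto simp: future_def)
  have "hl ((1 - u) *\<^sub>R a + u *\<^sub>R b) = (1 - u) *\<^sub>R hl a + u *\<^sub>R hl b"
    by (simp add: vec_eq_iff forall_3)
  then have f: "f (hl ((1 - u) *\<^sub>R a + u *\<^sub>R b)) = (1 - u) *\<^sub>R A + u *\<^sub>R B"
    using lorentzD(1)[OF assms(1)] by (simp add: A_def B_def linear_add linear_cmul)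
  define w where "w = (1 - u) * A$3 + u * B$3"
  have w: "w > 0"
  proof (cases "u = 0")
    case False then have "u * B$3 > 0" using u pos by simp
    moreover have "(1 - u) * A$3 \<ge> 0" using u pos by simp
    ultimately show ?thesis by (simp add: w_def)
  qed (use pos in \<open>simp add: w_def\<close>)
  \<comment> \<open>The projection weights each endpoint by the height of its image, and
    \<open>w\<close> is the total weight.\<close>
  let ?t = "u * B$3 / w"
  have t: "1 - ?t = (1 - u) * A$3 / w" using w by (simp add: field_simps w_def)
  have "y = proj ((1 - u) *\<^sub>R A + u *\<^sub>R B)" using f y by (simp add: hmap_def)
  also have "\<dots> = proj ((1 - u) *\<^sub>R (A$3 *\<^sub>R hl (hmap f a)) + u *\<^sub>R (B$3 *\<^sub>R hl (hmap f b)))"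
    using A B by simp
  also have "\<dots> = (1 - ?t) *\<^sub>R hmap f a + ?t *\<^sub>R hmap f b"
    unfolding t using w by (simp add: vec_eq_iff forall_2 w_def[symmetric] add_divide_distrib)
  finally have "y = (1 - ?t) *\<^sub>R hmap f a + ?t *\<^sub>R hmap f b" .
  moreover have "0 \<le> ?t" using u pos w by simp
  moreover have "0 \<le> 1 - ?t" unfolding t using u pos w by simp
  ultimately show "y \<in> closed_segment (hmap f a) (hmap f b)" by (auto simp: in_segment)
qed

lemma segment_hplane: "a \<in> hplane \<Longrightarrow> b \<in> hplane \<Longrightarrow> closed_segment a b \<subseteq> hplane"
  using convex_hplane by (simp add: closed_segment_subset)

lemma hmap_convex:
  assumes "lorentz f" "convex A" "A \<subseteq> hplane" shows "convex (hmap f ` A)"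
  unfolding convex_contains_segment
proof (intro ballI)
  fix p q assume "p \<in> hmap f ` A" "q \<in> hmap f ` A"
  then obtain a b where ab: "a \<in> A" "b \<in> A" "p = hmap f a" "q = hmap f b" by auto
  have h: "a \<in> hplane" "b \<in> hplane" using ab assms(3) by auto
  show "closed_segment p q \<subseteq> hmap f ` A"
  proof
    fix z assume z: "z \<in> closed_segment p q"
    have pq: "p \<in> hplane" "q \<in> hplane" using ab h hmap_hplane assms(1) by auto
    then have zh: "z \<in> hplane" using z segment_hplane by blast
    have "hmap (inv f) z \<in> closed_segment a b"
      using hmap_segment_subset[OF lorentz_inv[OF assms(1)] pq] z ab h hmap_inv(1)[OF assms(1)] by auto
    then have "hmap (inv f) z \<in> A" using assms(2) ab by (meson convex_contains_segment subsetD)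
    then show "z \<in> hmap f ` A" using hmap_inv(2)[OF assms(1) zh] by (metis imageI)
  qed
qed

lemma convex_hull_hplane: "S \<subseteq> hplane \<Longrightarrow> convex hull S \<subseteq> hplane"
  using convex_hplane by (simp add: hull_minimal)

lemma hmap_convex_hull_subset:
  assumes "lorentz f" "S \<subseteq> hplane"
  shows "convex hull (hmap f ` S) \<subseteq> hmap f ` (convex hull S)"
  by (intro hull_minimal image_mono hull_subset hmap_convex assms convex_convex_hull convex_hull_hplane)

lemma hmap_convex_hull:
  assumes "lorentz f" "S \<subseteq> hplane"
  shows "hmap f ` (convex hull S) = convex hull (hmap f ` S)"
proof
  have S': "hmap f ` S \<subseteq> hplane" using assms hmap_hplane by blast
  have "convex hull (hmap (inv f) ` (hmap f ` S)) \<subseteq> hmap (inv f) ` (convex hull (hmap f ` S))"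
    by (rule hmap_convex_hull_subset[OF lorentz_inv[OF assms(1)] S'])
  moreover have "hmap (inv f) ` (hmap f ` S) = S"
    using assms by (auto simp: image_image hmap_inv subset_iff)
  ultimately have "hmap f ` (convex hull S) \<subseteq> hmap f ` (hmap (inv f) ` (convex hull (hmap f ` S)))"
    by (simp add: image_mono)
  also have "\<dots> = convex hull (hmap f ` S)"
    using convex_hull_hplane[OF S'] hmap_inv(2)[OF assms(1)] by (force simp: image_image)
  finally show "hmap f ` (convex hull S) \<subseteq> convex hull (hmap f ` S)" .
qed (rule hmap_convex_hull_subset[OF assms])

section \<open>Boosts and rotations\<close>

definition e3 :: "real^3" where "e3 = vector [0, 0, 1]"

lemma e3_nth [simp]: "e3 $ 1 = 0" "e3 $ 2 = 0" "e3 $ 3 = 1"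
  by (simp_all add: e3_def)

lemma lift_0: "lift 0 = e3" by (simp add: lift_def vec_eq_iff forall_3)

lemma proj_e3: "proj e3 = 0" by (simp add: vec_eq_iff forall_2)

text \<open>The Lorentz boost that takes \<open>X\<close> to \<open>e3\<close>; its third component
  is \<open>- lor X Y\<close>. The factor \<open>1 / (1 + X$3)\<close> is the usual quotient of
  \<open>X$3 - 1\<close> by \<open>X$1 * X$1 + X$2 * X$2\<close>, written without the singularity at
  \<open>X = e3\<close>.\<close>

definition boost :: "real^3 \<Rightarrow> real^3 \<Rightarrow> real^3" where
  "boost X Y = vector
    [Y$1 + X$1 * (X$1 * Y$1 + X$2 * Y$2) / (1 + X$3) - X$1 * Y$3,
     Y$2 + X$2 * (X$1 * Y$1 + X$2 * Y$2) / (1 + X$3) - X$2 * Y$3,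
     X$3 * Y$3 - X$1 * Y$1 - X$2 * Y$2]"

lemma boost_nth [simp]:
  "boost X Y $ 1 = Y$1 + X$1 * (X$1 * Y$1 + X$2 * Y$2) / (1 + X$3) - X$1 * Y$3"
  "boost X Y $ 2 = Y$2 + X$2 * (X$1 * Y$1 + X$2 * Y$2) / (1 + X$3) - X$2 * Y$3"
  "boost X Y $ 3 = X$3 * Y$3 - X$1 * Y$1 - X$2 * Y$2"
  by (simp_all add: boost_def)

lemma lorentz_boost: assumes "X \<in> H2" shows "lorentz (boost X)"
proof -
  have X: "X$1 * X$1 + X$2 * X$2 = X$3 * X$3 - 1" and p: "X$3 > 0"
    using assms by (auto simp: H2_def lor_def)
  have l: "linear (boost X)"
    by (rule linearI) (simp_all add: vec_eq_iff forall_3 algebra_simps add_divide_distrib diff_divide_distrib)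
  have lor: "lor (boost X Y) (boost X Z) = lor Y Z" for Y Z
  proof -
    define k u v where "k = inverse (1 + X$3)" and "u = X$1 * Y$1 + X$2 * Y$2" and "v = X$1 * Z$1 + X$2 * Z$2"
    have k: "k * (X$3 * X$3 - 1) = X$3 - 1"
      using p by (simp add: k_def field_simps)
    have kk: "k * X$3 = 1 - k" using p by (simp add: k_def field_simps)
    have "lor (boost X Y) (boost X Z) = 
       (Y$1 + X$1 * u * k - X$1 * Y$3) * (Z$1 + X$1 * v * k - X$1 * Z$3)
     + (Y$2 + X$2 * u * k - X$2 * Y$3) * (Z$2 + X$2 * v * k - X$2 * Z$3)
     - (X$3 * Y$3 - u) * (X$3 * Z$3 - v)"
      by (simp add: lor_def u_def v_def k_def divide_inverse algebra_simps)
    also have "\<dots> = Y$1 * Z$1 + Y$2 * Z$2 + (v * k - Z$3) * u + (u * k - Y$3) * v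
        + (X$1 * X$1 + X$2 * X$2) * ((u * k - Y$3) * (v * k - Z$3)) - (X$3 * Y$3 - u) * (X$3 * Z$3 - v)"
      by (simp add: u_def v_def algebra_simps)
    also have "\<dots> = Y$1 * Z$1 + Y$2 * Z$2 - Y$3 * Z$3 + u * v * (2 * k + k * (k * (X$3 * X$3 - 1)) - 1)
       + (u * Z$3 + v * Y$3) * (X$3 - 1 - k * (X$3 * X$3 - 1))"
      unfolding X by (simp add: algebra_simps)
    also have "\<dots> = Y$1 * Z$1 + Y$2 * Z$2 - Y$3 * Z$3"
      unfolding k using kk by (simp add: algebra_simps)
    finally show ?thesis by (simp add: lor_def)
  qed
  have "boost X Y \<in> future" if "Y \<in> future" for Y
  proof -
    have "(boost X Y) $ 3 = - lor X Y" by (simp add: lor_def)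
    then show ?thesis using lor[of Y Y] that future_lor_neg[OF H2_future[OF assms] that]
      by (auto simp: future_def)
  qed
  then show ?thesis using l lor by (auto simp: lorentz_def)
qed

lemma boost_self: assumes "X \<in> H2" shows "boost X X = e3"
proof -
  have X: "X$1 * X$1 + X$2 * X$2 = X$3 * X$3 - 1" and p: "X$3 > 0"
    using assms by (auto simp: H2_def lor_def)
  have "X$3 * X$3 - 1 = (X$3 - 1) * (1 + X$3)" by (simp add: algebra_simps)
  then have "(X$1 * X$1 + X$2 * X$2) / (1 + X$3) = X$3 - 1" unfolding X using p by simp
  then have *: "x * (X$1 * X$1 + X$2 * X$2) / (1 + X$3) = x * (X$3 - 1)" for x
    by (metis times_divide_eq_right)
  show ?thesis using X unfolding vec_eq_iff forall_3 boost_nth * by (simp add: algebra_simps)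
qed

definition hrot :: "real \<Rightarrow> real \<Rightarrow> real^3 \<Rightarrow> real^3" where
  "hrot c s Y = vector [c * Y$1 - s * Y$2, s * Y$1 + c * Y$2, Y$3]"

lemma hrot_nth [simp]:
  "hrot c s Y $ 1 = c * Y$1 - s * Y$2" "hrot c s Y $ 2 = s * Y$1 + c * Y$2" "hrot c s Y $ 3 = Y$3"
  by (simp_all add: hrot_def)

lemma lorentz_hrot: assumes "c\<^sup>2 + s\<^sup>2 = 1" shows "lorentz (hrot c s)"
proof -
  have l: "linear (hrot c s)"
    by (rule linearI) (simp_all add: vec_eq_iff forall_3 algebra_simps)
  have lor: "lor (hrot c s Y) (hrot c s Z) = lor Y Z" for Y Z
  proof -
    have "lor (hrot c s Y) (hrot c s Z) = (c\<^sup>2 + s\<^sup>2) * (Y$1 * Z$1 + Y$2 * Z$2) - Y$3 * Z$3"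
      by (simp add: lor_def power2_eq_square algebra_simps)
    then show ?thesis using assms by (simp add: lor_def)
  qed
  then show ?thesis using l lor by (auto simp: lorentz_def future_def)
qed

subsection \<open>Area and the triangle formula\<close>

abbreviation hdensity :: "real^2 \<Rightarrow> real" where
  "hdensity x \<equiv> 1 / sqrt (1 - x \<bullet> x) ^ 3"

lemma continuous_on_hdensity: "K \<subseteq> hplane \<Longrightarrow> continuous_on K hdensity"
  by (intro continuous_intros) (auto simp: hplane_iff)

lemma hdensity_integrable:
  assumes "K \<subseteq> hplane" "compact K"
  shows "set_integrable lborel K hdensity"
  using borel_integrable_compact[OF assms(2) continuous_on_hdensity[OF assms(1)]]
  unfolding set_integrable_def by (simp add: indicator_scaleR_eq_if)

lemma harea_integral:
  assumes "K \<subseteq> hplane" "compact K"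
  shows "harea K = integral K hdensity"
  unfolding harea_def by (rule set_borel_integral_eq_integral(2)[OF hdensity_integrable[OF assms]])

text \<open>The quotient rule for \<open>proj\<close>; the vector with last entry 0 is the
  derivative of \<open>hl\<close> in the direction \<open>h\<close>.\<close>

definition hmap_deriv :: "(real^3 \<Rightarrow> real^3) \<Rightarrow> real^2 \<Rightarrow> real^2 \<Rightarrow> real^2" where
  "hmap_deriv f x h = vector
     [f (vector [h$1, h$2, 0]) $ 1 / f (hl x) $ 3 - f (hl x) $ 1 * f (vector [h$1, h$2, 0]) $ 3 / (f (hl x) $ 3)\<^sup>2,
      f (vector [h$1, h$2, 0]) $ 2 / f (hl x) $ 3 - f (hl x) $ 2 * f (vector [h$1, h$2, 0]) $ 3 / (f (hl x) $ 3)\<^sup>2]"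

lemma hmap_derivative:
  assumes f: "linear f" and d: "f (hl x) $ 3 \<noteq> 0"
  shows "(hmap f has_derivative hmap_deriv f x)
     (at x within S)"
proof -
  define L where "L = (\<lambda>h::real^2. f (vector [h$1, h$2, 0]))"
  have L: "linear L" unfolding L_def
  proof (rule linearI)
    have 1: "(vector [(x + y)$1, (x + y)$2, 0] :: real^3) = vector [x$1, x$2, 0] + vector [y$1, y$2, 0]" for x y :: "real^2"
      by (simp add: vec_eq_iff forall_3)
    have 2: "(vector [(c *\<^sub>R x)$1, (c *\<^sub>R x)$2, 0] :: real^3) = c *\<^sub>R vector [x$1, x$2, 0]" for c and x :: "real^2"
      by (simp add: vec_eq_iff forall_3)
    show "f (vector [(x + y)$1, (x + y)$2, 0]) = f (vector [x$1, x$2, 0]) + f (vector [y$1, y$2, 0])" for x y :: "real^2"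
      unfolding 1 using f by (rule linear_add)
    show "f (vector [(c *\<^sub>R x)$1, (c *\<^sub>R x)$2, 0]) = c *\<^sub>R f (vector [x$1, x$2, 0])" for c and x :: "real^2"
      unfolding 2 using f by (rule linear_cmul)
  qed
  have hl: "f (hl y) = f e3 + L y" for y
  proof -
    have "hl y = e3 + vector [y$1, y$2, 0]" by (simp add: vec_eq_iff forall_3)
    then show ?thesis unfolding L_def using linear_add[OF f] by metis
  qed
  have D: "((\<lambda>y. f (hl y) $ i) has_derivative (\<lambda>h. L h $ i)) (at x within S)" for i
  proof -
    have "((\<lambda>y. f e3 $ i + L y $ i) has_derivative (\<lambda>h. 0 + L h $ i)) (at x within S)"
      by (intro derivative_intros bounded_linear.has_derivative[OF bounded_linear_vec_nth]
          linear_imp_has_derivative[OF L])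
    then show ?thesis by (simp add: hl)
  qed
  have Q: "((\<lambda>y. f (hl y) $ i / f (hl y) $ 3) has_derivative
      (\<lambda>h. L h $ i / f (hl x) $ 3 - f (hl x) $ i * L h $ 3 / (f (hl x) $ 3)\<^sup>2)) (at x within S)" for i
    by (rule has_derivative_eq_rhs[OF has_derivative_divide[OF D D d]])
       (use d in \<open>simp add: fun_eq_iff field_simps power2_eq_square\<close>)
  show ?thesis
  proof (subst has_derivative_componentwise_within, intro ballI)
    fix b :: "real^2" assume "b \<in> Basis"
    then consider "b = axis 1 1" | "b = axis 2 1"
      by (auto simp: Basis_vec_def) (metis exhaust_2)
    then show "((\<lambda>y. hmap f y \<bullet> b) has_derivative (\<lambda>h. hmap_deriv f x h \<bullet> b))
     (at x within S)"
      using Q[of 1] Q[of 2] by cases (simp_all add: hmap_def hmap_deriv_def inner_axis L_def)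
  qed
qed

text \<open>Let \<open>d\<close> be the height of the image of \<open>hl x\<close>. The Jacobian
  determinant of the projective map at \<open>x\<close> is 1 / d^3 in absolute value, while
  \<open>1 - x \<bullet> x\<close> is divided by \<open>d\<^sup>2\<close>, so the density at the
  image is multiplied by d^3 and the two factors cancel.\<close>

lemma harea_hmap:
  assumes f: "lorentz f" and K: "K \<subseteq> hplane" "compact K"
  shows "harea (hmap f ` K) = harea K"
proof -
  let ?g = "hmap f"
  let ?g' = "hmap_deriv f"
  have l: "linear f" using lorentzD(1)[OF f] .
  have pos: "f (hl x) $ 3 > 0" if "x \<in> hplane" for x
    using lorentzD(3)[OF f hl_in_future[OF that]] by (simp add: future_def)
  have der: "(?g has_derivative ?g' x) (at x within K)" if "x \<in> K" for x
    using pos[of x] that K by (intro hmap_derivative[OF l]) auto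
  have gK: "?g ` K \<subseteq> hplane" using hmap_hplane[OF f] K by blast
  have cg: "compact (?g ` K)"
    by (rule compact_continuous_image[OF has_derivative_continuous_on K(2)]) (rule der)
  have dens: "\<bar>det (matrix (?g' x))\<bar> * hdensity (?g x) = hdensity x" if x: "x \<in> K" for x
  proof -
    define P Q N d where "P = f (vector [1, 0, 0])" and "Q = f (vector [0, 1, 0])" and "N = f (hl x)" and "d = N$3"
    have d: "d > 0" using pos K x by (auto simp: d_def N_def)
    have det: "det (matrix (?g' x)) = (P$1/d - N$1 * P$3/d\<^sup>2) * (Q$2/d - N$2 * Q$3/d\<^sup>2)
        - (Q$1/d - N$1 * Q$3/d\<^sup>2) * (P$2/d - N$2 * P$3/d\<^sup>2)"
      by (simp add: det_2 matrix_def hmap_deriv_def axis_def P_def Q_def N_def d_def)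
    also have "\<dots> = ldet P Q N / d ^ 3"
      using d unfolding ldet_def d_def[symmetric] by (simp add: field_simps power2_eq_square power3_eq_cube)
    finally have D: "det (matrix (?g' x)) = ldet P Q N / d ^ 3" .
    have "(ldet P Q N)\<^sup>2 = (ldet (vector [1, 0, 0]) (vector [0, 1, 0]) (hl x))\<^sup>2"
      unfolding P_def Q_def N_def by (rule lorentz_ldet_square[OF f])
    also have "\<dots> = 1" by (simp add: ldet_def)
    finally have "\<bar>ldet P Q N\<bar> = 1" by (simp add: power2_eq_1_iff abs_if) auto
    then have 1: "\<bar>det (matrix (?g' x))\<bar> = 1 / d ^ 3" using d by (simp add: D)
    have NN: "N \<in> future" using lorentzD(3)[OF f hl_in_future] K x by (auto simp: N_def)
    have "lor N N = d\<^sup>2 * (?g x \<bullet> ?g x - 1)"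
    proof -
      have "lor N N = lor (d *\<^sub>R hl (?g x)) (d *\<^sub>R hl (?g x))"
        unfolding d_def hmap_def N_def[symmetric] by (intro arg_cong2[where f=lor] hl_proj NN)
      then show ?thesis by (simp add: lor_hl power2_eq_square)
    qed
    moreover have "lor N N = x \<bullet> x - 1" by (simp add: N_def lorentzD(2)[OF f] lor_hl)
    ultimately have "1 - ?g x \<bullet> ?g x = (1 - x \<bullet> x) / d\<^sup>2" using d by (simp add: field_simps)
    then have "sqrt (1 - ?g x \<bullet> ?g x) = sqrt (1 - x \<bullet> x) / d" using d by (simp add: real_sqrt_divide)
    then show ?thesis unfolding 1 using d by (simp add: power_divide)
  qed
  \<comment> \<open>The change of variables theorem is applied to a function with values in
    \<open>real^1\<close>, whose single component is the density.\<close>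
  define F :: "real^2 \<Rightarrow> real^1" where "F x = vec (hdensity x)" for x
  have contF: "continuous_on S F" if "S \<subseteq> hplane" for S
    unfolding continuous_on_componentwise[of S F] F_def using continuous_on_hdensity[OF that]
    by (auto simp: Basis_vec_def inner_axis)
  have intF: "F absolutely_integrable_on S" if "S \<subseteq> hplane" "compact S" for S
  proof -
    have "set_integrable lborel S F" 
      using borel_integrable_compact[OF that(2) contF[OF that(1)]]
      unfolding set_integrable_def by (simp add: indicator_scaleR_eq_if)
    then show ?thesis
      unfolding set_integrable_def by (intro integrable_completion[THEN iffD2]) (auto dest: borel_measurable_integrable)
  qed
  have "integral K (\<lambda>x. \<bar>det (matrix (?g' x))\<bar> *\<^sub>R F (?g x)) = integral (?g ` K) F"
    using has_absolute_integral_change_of_variables[of K ?g ?g' F "integral (?g ` K) F"]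
      der hmap_inj_on[OF f K(1)] K(2) intF[OF gK cg] by (auto simp: lmeasurable_compact fmeasurableD)
  moreover have "integral K (\<lambda>x. \<bar>det (matrix (?g' x))\<bar> *\<^sub>R F (?g x)) = integral K F"
    by (rule integral_cong) (use dens in \<open>simp add: F_def vec_eq_iff\<close>)
  moreover have "integral S F $ 1 = harea S" if S: "S \<subseteq> hplane" "compact S" for S
  proof -
    have "F integrable_on S" using intF[OF S] set_lebesgue_integral_eq_integral(1) by blast
    then have "integral S (\<lambda>x. F x $ 1) = integral S F $ 1" by (rule integral_component_eq_cart)
    then show ?thesis using harea_integral[OF S] by (simp add: F_def)
  qed
  ultimately show ?thesis using K gK cg by metis
qed

section \<open>Iterated integration over sectors\<close>

lemma borel_measurable_vector_pair: "(\<lambda>(x, y). vector [x, y] :: real^2) \<in> lborel \<Otimes>\<^sub>M lborel \<rightarrow>\<^sub>M borel"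
  (is "?v \<in> _")
proof -
  have "continuous_on UNIV ?v"
    unfolding continuous_on_componentwise[of UNIV ?v]
    by (auto simp: Basis_vec_def inner_axis case_prod_beta forall_2 intro!: continuous_intros)
  then have "?v \<in> borel_measurable borel" by (rule borel_measurable_continuous_onI)
  then show ?thesis by (simp add: lborel_prod)
qed

text \<open>Comparing the two measures on boxes suffices; integrals over \<open>real^2\<close>
  thereby become iterated integrals in the coordinates.\<close>

lemma lborel_real2: "lborel = distr (lborel \<Otimes>\<^sub>M lborel) borel (\<lambda>(x, y). vector [x, y] :: real^2)"
  (is "_ = distr _ _ ?v")
proof (rule lborel_eqI)
  fix l u :: "real^2" assume le: "\<And>b. b \<in> Basis \<Longrightarrow> l \<bullet> b \<le> u \<bullet> b"
  have le': "l$i \<le> u$i" for i using le[of "axis i 1"] by (simp add: inner_axis axis_in_Basis_iff)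
  have "?v -` box l u \<inter> space (lborel \<Otimes>\<^sub>M lborel) = {l$1 <..< u$1} \<times> {l$2 <..< u$2}"
    by (auto simp: mem_box_cart forall_2 space_pair_measure)
  then have "emeasure (distr (lborel \<Otimes>\<^sub>M lborel) borel ?v) (box l u) = emeasure (lborel \<Otimes>\<^sub>M lborel) ({l$1 <..< u$1} \<times> {l$2 <..< u$2})"
    using borel_measurable_vector_pair by (subst emeasure_distr) auto
  also have "\<dots> = ennreal (u$1 - l$1) * ennreal (u$2 - l$2)"
    using le' by (subst lborel.emeasure_pair_measure_Times) auto
  also have "\<dots> = (\<Prod>b\<in>Basis. (u - l) \<bullet> b)"
  proof -
    have "(\<Prod>b\<in>Basis. (u - l) \<bullet> b) = (\<Prod>i\<in>UNIV. (u - l) $ i)"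
      unfolding Basis_vec_def
      by (rule prod.reindex_cong[of "\<lambda>i. axis i 1"]) (auto simp: inj_on_def axis_eq_axis inner_axis)
    also have "\<dots> = (u$1 - l$1) * (u$2 - l$2)" by (simp add: UNIV_2)
    finally show ?thesis using le' by (simp add: ennreal_mult)
  qed
  finally show "emeasure (distr (lborel \<Otimes>\<^sub>M lborel) borel ?v) (box l u) = (\<Prod>b\<in>Basis. (u - l) \<bullet> b)" .
qed simp

text \<open>The density integrated along a vertical chord, with \<open>D\<close> standing for
  \<open>1 - x\<^sup>2\<close>.\<close>

lemma inner_antiderivative:
  fixes D y :: real
  assumes "y\<^sup>2 < D"
  shows "((\<lambda>y. y / (D * sqrt (D - y\<^sup>2))) has_real_derivative 1 / sqrt (D - y\<^sup>2) ^ 3) (at y within S)"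
proof -
  define W where "W = sqrt (D - y\<^sup>2)"
  have W: "W > 0" "W\<^sup>2 = D - y\<^sup>2" using assms by (auto simp: W_def)
  have D: "D > 0" using assms zero_le_power2[of y] by linarith
  have dW: "((\<lambda>y. sqrt (D - y\<^sup>2)) has_real_derivative - y / W) (at y within S)"
    unfolding W_def using assms by (auto intro!: derivative_eq_intros simp: field_simps)
  have "((\<lambda>y. y / (D * sqrt (D - y\<^sup>2))) has_real_derivative
      (1 * (D * W) - y * (D * (- y / W))) / ((D * W) * (D * W))) (at y within S)"
    unfolding W_def using W D dW[unfolded W_def]
    by (intro DERIV_divide DERIV_cmult DERIV_ident) (auto simp: W_def)
  moreover have "(1 * (D * W) - y * (D * (- y / W))) / ((D * W) * (D * W)) = 1 / W ^ 3"
  proof -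
    have "(1 * (D * W) - y * (D * (- y / W))) = D * (W\<^sup>2 + y\<^sup>2) / W"
      using W(1) by (simp add: field_simps power2_eq_square)
    also have "W\<^sup>2 + y\<^sup>2 = D" using W by simp
    also have "D * D / W = D\<^sup>2 / W" by (simp add: power2_eq_square)
    finally show ?thesis using W D by (simp add: power2_eq_square power3_eq_cube)
  qed
  ultimately show ?thesis by (simp add: W_def)
qed

text \<open>The derivative is the inner antiderivative taken on the ray \<open>y = s * x\<close>,
  the boundary of a sector.\<close>

lemma outer_antiderivative:
  fixes s x :: real
  assumes "x\<^sup>2 * (1 + s\<^sup>2) < 1"
  shows "((\<lambda>x. arctan (s / sqrt (1 - x\<^sup>2 * (1 + s\<^sup>2)))) has_real_derivative
    s * x / ((1 - x\<^sup>2) * sqrt (1 - x\<^sup>2 - (s * x)\<^sup>2))) (at x within S)"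
proof -
  define W where "W = sqrt (1 - x\<^sup>2 * (1 + s\<^sup>2))"
  have W: "W > 0" "W\<^sup>2 = 1 - x\<^sup>2 * (1 + s\<^sup>2)" using assms by (auto simp: W_def)
  have x1: "1 - x\<^sup>2 > 0" using assms zero_le_power2[of "x * s"] unfolding power_mult_distrib distrib_left by linarith
  have dW: "((\<lambda>x. sqrt (1 - x\<^sup>2 * (1 + s\<^sup>2))) has_real_derivative - (x * (1 + s\<^sup>2)) / W) (at x within S)"
    unfolding W_def using assms by (auto intro!: derivative_eq_intros simp: field_simps)
  have ds: "((\<lambda>x. s / sqrt (1 - x\<^sup>2 * (1 + s\<^sup>2))) has_real_derivative
      (0 * W - s * (- (x * (1 + s\<^sup>2)) / W)) / (W * W)) (at x within S)"
    unfolding W_def using W dW[unfolded W_def] by (intro DERIV_divide DERIV_const) (auto simp: W_def)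
  have "((\<lambda>x. arctan (s / sqrt (1 - x\<^sup>2 * (1 + s\<^sup>2)))) has_real_derivative
     (inverse (1 + (s / W)\<^sup>2)) * ((0 * W - s * (- (x * (1 + s\<^sup>2)) / W)) / (W * W))) (at x within S)"
    using DERIV_chain2[OF DERIV_arctan ds] by (simp add: W_def)
  moreover have "(inverse (1 + (s / W)\<^sup>2)) * ((0 * W - s * (- (x * (1 + s\<^sup>2)) / W)) / (W * W))
     = s * x / ((1 - x\<^sup>2) * W)"
  proof -
    have "1 + (s / W)\<^sup>2 = (W\<^sup>2 + s\<^sup>2) / W\<^sup>2" using W(1) by (simp add: field_simps)
    also have "W\<^sup>2 + s\<^sup>2 = (1 + s\<^sup>2) * (1 - x\<^sup>2)" unfolding W(2) by (simp add: algebra_simps)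
    finally have 1: "inverse (1 + (s / W)\<^sup>2) = W\<^sup>2 / ((1 + s\<^sup>2) * (1 - x\<^sup>2))" by simp
    have "1 + s\<^sup>2 > 0" using zero_le_power2[of s] by linarith
    then show ?thesis unfolding 1 using W(1) x1 by (simp add: power2_eq_square)
  qed
  moreover have "W = sqrt (1 - x\<^sup>2 - (s * x)\<^sup>2)" unfolding W_def by (simp add: algebra_simps power_mult_distrib)
  ultimately show ?thesis by simp
qed

text \<open>The region is a triangle with a vertex at the centre and the opposite side on a vertical
  line; its other two sides have the slopes \<open>s\<close> and \<open>t\<close>. Working with
  nonnegative integrals, Tonelli and the two antiderivatives give the value without a prior proof of
  integrability.\<close>

lemma harea_sector:
  fixes p s t :: real
  assumes p: "p > 0" and s: "p\<^sup>2 * (1 + s\<^sup>2) < 1" and t: "p\<^sup>2 * (1 + t\<^sup>2) < 1" and st: "s \<le> t"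
  shows "harea {x. 0 \<le> x$1 \<and> x$1 \<le> p \<and> s * x$1 \<le> x$2 \<and> x$2 \<le> t * x$1}
    = (arctan (t / sqrt (1 - p\<^sup>2 * (1 + t\<^sup>2))) - arctan t) - (arctan (s / sqrt (1 - p\<^sup>2 * (1 + s\<^sup>2))) - arctan s)"
    (is "harea ?K = ?R")
proof -
  define G where "G u x = u * x / ((1 - x\<^sup>2) * sqrt (1 - x\<^sup>2 - (u * x)\<^sup>2))" for u x :: real
  define H where "H u x = arctan (u / sqrt (1 - x\<^sup>2 * (1 + u\<^sup>2)))" for u x :: real
  have closed: "closed ?K"
    by (intro closed_Collect_conj closed_Collect_le continuous_intros)
  have Kb: "?K \<in> sets borel" using closed by simp
  have bound: "x\<^sup>2 * (1 + u\<^sup>2) < 1" if "0 \<le> x" "x \<le> p" "p\<^sup>2 * (1 + u\<^sup>2) < 1" for x u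
  proof -
    have "x\<^sup>2 * (1 + u\<^sup>2) \<le> p\<^sup>2 * (1 + u\<^sup>2)" using that by (intro mult_right_mono power_mono) auto
    then show ?thesis using that by linarith
  qed
  have D0: "y\<^sup>2 < 1 - x\<^sup>2" if "0 \<le> x" "x \<le> p" "s * x \<le> y" "y \<le> t * x" for x y
  proof -
    have "\<bar>y\<bar> \<le> max \<bar>s * x\<bar> \<bar>t * x\<bar>" using that by linarith
    then have "y\<^sup>2 \<le> max ((s * x)\<^sup>2) ((t * x)\<^sup>2)"
      by (metis abs_le_square_iff le_max_iff_disj)
    moreover have "(s * x)\<^sup>2 < 1 - x\<^sup>2" "(t * x)\<^sup>2 < 1 - x\<^sup>2"
      using bound[OF that(1,2) s] bound[OF that(1,2) t] by (simp_all add: power_mult_distrib algebra_simps)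
    ultimately show ?thesis by linarith
  qed
  have inner: "(\<integral>\<^sup>+ y. ennreal (1 / sqrt (1 - x\<^sup>2 - y\<^sup>2) ^ 3) * indicator {s * x .. t * x} y \<partial>lborel) = ennreal (G t x - G s x)"
    if x: "0 \<le> x" "x \<le> p" for x
    unfolding G_def
  proof (rule nn_integral_FTC_Icc[where F = "\<lambda>y. y / ((1 - x\<^sup>2) * sqrt (1 - x\<^sup>2 - y\<^sup>2))"])
    show "((\<lambda>y. y / ((1 - x\<^sup>2) * sqrt (1 - x\<^sup>2 - y\<^sup>2))) has_real_derivative 1 / sqrt (1 - x\<^sup>2 - y\<^sup>2) ^ 3) (at y)"
      if "y \<in> {s * x..t * x}" for y
      using that D0[OF x] by (intro inner_antiderivative) auto
    show "0 \<le> 1 / sqrt (1 - x\<^sup>2 - y\<^sup>2) ^ 3" if "y \<in> {s * x..t * x}" for y 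
      using that D0[OF x] by (auto intro!: less_imp_le)
    show "s * x \<le> t * x" using st x by (intro mult_right_mono) auto
  qed simp
  have Gmono: "0 \<le> G t x - G s x" if x: "0 \<le> x" "x \<le> p" for x
  proof -
    show ?thesis
    proof -
      have "(\<lambda>y. y / ((1 - x\<^sup>2) * sqrt (1 - x\<^sup>2 - y\<^sup>2))) (s * x) \<le> (\<lambda>y. y / ((1 - x\<^sup>2) * sqrt (1 - x\<^sup>2 - y\<^sup>2))) (t * x)"
      proof (rule DERIV_nonneg_imp_nondecreasing[where f = "\<lambda>y. y / ((1 - x\<^sup>2) * sqrt (1 - x\<^sup>2 - y\<^sup>2))"])
        show "s * x \<le> t * x" using st x by (intro mult_right_mono) auto
        fix y assume "s * x \<le> y" "y \<le> t * x"
        then have "y\<^sup>2 < 1 - x\<^sup>2" using D0[OF x] by auto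
        then show "\<exists>d. ((\<lambda>y. y / ((1 - x\<^sup>2) * sqrt (1 - x\<^sup>2 - y\<^sup>2))) has_real_derivative d) (at y) \<and> 0 \<le> d"
          using inner_antiderivative[of y "1 - x\<^sup>2" UNIV] by (intro exI[of _ "1 / sqrt (1 - x\<^sup>2 - y\<^sup>2) ^ 3"]) auto
      qed
      then show ?thesis by (simp add: G_def)
    qed
  qed
  have outer: "(\<integral>\<^sup>+ x. ennreal (G t x - G s x) * indicator {0..p} x \<partial>lborel) = ennreal ((H t p - H s p) - (H t 0 - H s 0))"
  proof (rule nn_integral_FTC_Icc[where F = "\<lambda>x. H t x - H s x"])
    show "((\<lambda>x. H t x - H s x) has_real_derivative G t x - G s x) (at x)" if "x \<in> {0..p}" for x
      unfolding H_def G_def using that bound s t by (intro DERIV_diff outer_antiderivative) auto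
    show "(\<lambda>x. G t x - G s x) \<in> borel_measurable borel" unfolding G_def by measurable
  qed (use p Gmono in auto)
  let ?g = "\<lambda>x. indicator ?K x *\<^sub>R hdensity x"
  have gm: "?g \<in> borel_measurable borel" using Kb by measurable
  note vm = borel_measurable_vector_pair
  have g0: "0 \<le> ?g x" for x
  proof (cases "x \<in> ?K")
    case True
    then have "(x$2)\<^sup>2 < 1 - (x$1)\<^sup>2" using D0[of "x$1" "x$2"] by auto
    then show ?thesis using True by (simp add: inner2 power2_eq_square)
  qed simp
  have "(\<integral>\<^sup>+ x. ennreal (?g x) \<partial>lborel) = (\<integral>\<^sup>+ z. ennreal (?g ((\<lambda>(x, y). vector [x, y]) z)) \<partial>(lborel \<Otimes>\<^sub>M lborel))"
    using vm gm by (subst lborel_real2, subst nn_integral_distr) auto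
  also have "\<dots> = (\<integral>\<^sup>+ x. \<integral>\<^sup>+ y. ennreal (?g (vector [x, y])) \<partial>lborel \<partial>lborel)"
    using measurable_compose[OF vm gm] by (subst lborel.nn_integral_fst[symmetric]) auto
  also have "\<dots> = (\<integral>\<^sup>+ x. (\<integral>\<^sup>+ y. ennreal (1 / sqrt (1 - x\<^sup>2 - y\<^sup>2) ^ 3) * indicator {s * x .. t * x} y \<partial>lborel) * indicator {0..p} x \<partial>lborel)"
  proof (intro nn_integral_cong)
    fix x :: real
    show "(\<integral>\<^sup>+ y. ennreal (?g (vector [x, y])) \<partial>lborel) = (\<integral>\<^sup>+ y. ennreal (1 / sqrt (1 - x\<^sup>2 - y\<^sup>2) ^ 3) * indicator {s * x .. t * x} y \<partial>lborel) * indicator {0..p} x"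
    proof (cases "x \<in> {0..p}")
      case True
      have "ennreal (?g (vector [x, y])) = ennreal (1 / sqrt (1 - x\<^sup>2 - y\<^sup>2) ^ 3) * indicator {s * x .. t * x} y" for y
        using True by (auto simp: indicator_def inner2 power2_eq_square diff_diff_eq)
      then show ?thesis using True by simp
    next
      case False
      then have "ennreal (?g (vector [x, y])) = 0" for y by (auto simp: indicator_def)
      then show ?thesis using False by simp
    qed
  qed
  also have "\<dots> = (\<integral>\<^sup>+ x. ennreal (G t x - G s x) * indicator {0..p} x \<partial>lborel)"
  proof (intro nn_integral_cong)
    fix x :: real
    show "(\<integral>\<^sup>+ y. ennreal (1 / sqrt (1 - x\<^sup>2 - y\<^sup>2) ^ 3) * indicator {s * x .. t * x} y \<partial>lborel) * indicator {0..p} x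
        = ennreal (G t x - G s x) * indicator {0..p} x"
      by (cases "x \<in> {0..p}") (auto simp: inner)
  qed
  also have "\<dots> = ennreal ((H t p - H s p) - (H t 0 - H s 0))" by (rule outer)
  finally have nn: "(\<integral>\<^sup>+ x. ennreal (?g x) \<partial>lborel) = ennreal ((H t p - H s p) - (H t 0 - H s 0))" .
  have pos: "0 \<le> (H t p - H s p) - (H t 0 - H s 0)"
  proof -
    have "(\<lambda>x. H t x - H s x) 0 \<le> (\<lambda>x. H t x - H s x) p"
    proof (rule DERIV_nonneg_imp_nondecreasing[where f = "\<lambda>x. H t x - H s x"])
      fix x assume x: "0 \<le> x" "x \<le> p"
      have "((\<lambda>x. H t x - H s x) has_real_derivative G t x - G s x) (at x)"
        unfolding H_def G_def using x bound s t by (intro DERIV_diff outer_antiderivative) auto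
      then show "\<exists>d. ((\<lambda>x. H t x - H s x) has_real_derivative d) (at x) \<and> 0 \<le> d" using Gmono[OF x] by blast
    qed (use p in simp)
    then show ?thesis by simp
  qed
  have "harea ?K = enn2real (\<integral>\<^sup>+ x. ennreal (?g x) \<partial>lborel)"
    unfolding harea_def set_lebesgue_integral_def
    by (rule integral_eq_nn_integral) (use gm g0 in auto)
  also have "\<dots> = ?R" unfolding nn using pos by (simp add: H_def)
  finally show ?thesis .
qed

text \<open>The inner product of the components of \<open>X\<close> and \<open>Y\<close> that are tangent at \<open>V\<close>.\<close>

definition tform :: "real^3 \<Rightarrow> real^3 \<Rightarrow> real^3 \<Rightarrow> real" where
  "tform V X Y = lor X Y + lor V X * lor V Y"

text \<open>Only the components tangent at \<open>V\<close> count, so \<open>X\<close> and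
  \<open>Y\<close> may be arbitrary vectors: positive scaling and adding multiples of
  \<open>V\<close> leave the angle unchanged.\<close>

definition ang :: "real^3 \<Rightarrow> real^3 \<Rightarrow> real^3 \<Rightarrow> real" where
  "ang V X Y = arccos (tform V X Y / sqrt (tform V X X * tform V Y Y))"

lemma tform_commute: "tform V X Y = tform V Y X"
  by (simp add: tform_def lor_commute)

lemma tform_simps [simp]:
  "tform V (X + Y) Z = tform V X Z + tform V Y Z" "tform V Z (X + Y) = tform V Z X + tform V Z Y"
  "tform V (X - Y) Z = tform V X Z - tform V Y Z" "tform V Z (X - Y) = tform V Z X - tform V Z Y"
  "tform V (c *\<^sub>R X) Z = c * tform V X Z" "tform V Z (c *\<^sub>R X) = c * tform V Z X"
  by (simp_all add: tform_def algebra_simps)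

lemma tform_self: "V \<in> H2 \<Longrightarrow> tform V V X = 0" "V \<in> H2 \<Longrightarrow> tform V X V = 0"
  by (simp_all add: tform_def H2_self lor_commute)

lemma ang_commute: "ang V X Y = ang V Y X"
  by (simp add: ang_def tform_commute[of V X Y] mult.commute)

lemma ang_scale: "c > 0 \<Longrightarrow> ang V (c *\<^sub>R X) Y = ang V X Y" "c > 0 \<Longrightarrow> ang V Y (c *\<^sub>R X) = ang V Y X"
proof -
  show 1: "ang V (c *\<^sub>R X) Y = ang V X Y" if "c > 0" for Y
  proof -
    have "sqrt (tform V (c *\<^sub>R X) (c *\<^sub>R X) * tform V Y Y) = c * sqrt (tform V X X * tform V Y Y)"
      using that by (simp add: real_sqrt_mult)
    then show ?thesis using that by (simp add: ang_def)
  qed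
  show "ang V Y (c *\<^sub>R X) = ang V Y X" if "c > 0" using 1[OF that] by (simp add: ang_commute[of V Y])
qed

lemma ang_add_vertex:
  assumes "V \<in> H2"
  shows "ang V (X + c *\<^sub>R V) Y = ang V X Y" "ang V Y (X + c *\<^sub>R V) = ang V Y X"
  using tform_self[OF assms] by (simp_all add: ang_def)

lemma ang_lorentz: "lorentz f \<Longrightarrow> ang (f V) (f X) (f Y) = ang V X Y"
  by (simp add: ang_def tform_def lorentzD(2))

lemma tform_nonneg: assumes "V \<in> H2" shows "tform V X X \<ge> 0"
proof -
  let ?Y = "X + lor V X *\<^sub>R V"
  have "lor V ?Y = 0" using assms by (simp add: H2_self)
  moreover have "lor ?Y ?Y = tform V X X" using assms by (simp add: H2_self tform_def lor_commute[of X V] algebra_simps)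
  ultimately show ?thesis using orthogonal_timelike_spacelike[OF H2_future[OF assms], of ?Y]
    by (cases "?Y = 0") auto
qed

lemma tform_pos: assumes "V \<in> H2" "ldet V X Y \<noteq> 0" shows "tform V X X > 0"
proof -
  let ?Y = "X + lor V X *\<^sub>R V"
  have "?Y \<noteq> 0"
  proof
    assume "?Y = 0"
    then have "ldet V ?Y Y = 0" by (simp add: ldet_def)
    then show False using assms(2) by simp
  qed
  moreover have "lor V ?Y = 0" using assms by (simp add: H2_self)
  moreover have "lor ?Y ?Y = tform V X X" using assms by (simp add: H2_self tform_def lor_commute[of X V] algebra_simps)
  ultimately show ?thesis using orthogonal_timelike_spacelike[OF H2_future[OF assms(1)], of ?Y] by simp
qed

text \<open>Since \<open>V\<close> is a unit timelike vector, \<open>ldet V X Y\<close> is the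
  signed area spanned by the tangential components of \<open>X\<close> and \<open>Y\<close>. The
  identity gives Cauchy-Schwarz for \<open>tform\<close>, and its strict form when the three points
  are not on a line.\<close>

lemma tform_gram:
  assumes "V \<in> H2"
  shows "tform V X X * tform V Y Y - (tform V X Y)\<^sup>2 = (ldet V X Y)\<^sup>2"
  using ldet_square[of V X Y] by (simp add: tform_def H2_self[OF assms] power2_eq_square algebra_simps)

section \<open>Addition of angles\<close>

lemma divide_le_one_nonneg: "0 \<le> (y::real) \<Longrightarrow> x \<le> y \<Longrightarrow> x / y \<le> 1"
  by (cases "y = 0") auto

lemma tform_cos_bound:
  assumes "V \<in> H2"
  shows "\<bar>tform V X Y / sqrt (tform V X X * tform V Y Y)\<bar> \<le> 1"
proof -
  have "(tform V X Y)\<^sup>2 \<le> tform V X X * tform V Y Y"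
    using tform_gram[OF assms, of X Y] zero_le_power2[of "ldet V X Y"] by linarith
  then have "\<bar>tform V X Y\<bar> \<le> sqrt (tform V X X * tform V Y Y)"
    using real_sqrt_le_mono by fastforce
  moreover have "0 \<le> sqrt (tform V X X * tform V Y Y)" using tform_nonneg[OF assms] by simp
  ultimately show ?thesis unfolding abs_divide by (simp only: abs_of_nonneg divide_le_one_nonneg)
qed

text \<open>
  The cosines of three angles \<open>A\<close>, \<open>B\<close>, \<open>C\<close>: the hypotheses say that \<open>A \<le> \<bar>C - B\<bar>\<close> and \<open>B \<le> \<bar>C - A\<bar>\<close>,
  which forces \<open>A + B \<le> C\<close> as \<open>C > 0\<close>.
\<close>

lemma arccos_superadditive:
  assumes a: "\<bar>a\<bar> \<le> 1" and b: "\<bar>b\<bar> \<le> 1" and c: "\<bar>c\<bar> \<le> 1" "c < 1"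
    and 1: "a \<ge> c * b + sqrt (1 - c\<^sup>2) * sqrt (1 - b\<^sup>2)"
    and 2: "b \<ge> c * a + sqrt (1 - c\<^sup>2) * sqrt (1 - a\<^sup>2)"
  shows "arccos a + arccos b \<le> arccos c"
proof -
  define A B C where "A = arccos a" and "B = arccos b" and "C = arccos c"
  have ABC: "0 \<le> A" "A \<le> pi" "0 \<le> B" "B \<le> pi" "0 \<le> C" "C \<le> pi"
    using a b c by (simp_all add: A_def B_def C_def arccos_lbound arccos_ubound)
  have cs: "a = cos A" "b = cos B" "c = cos C" using a b c by (simp_all add: A_def B_def C_def abs_le_iff)
  have C0: "C \<noteq> 0" using c(2) cs(3) by auto
  have sn: "sqrt (1 - a\<^sup>2) = sin A" "sqrt (1 - b\<^sup>2) = sin B" "sqrt (1 - c\<^sup>2) = sin C"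
    unfolding cs using ABC by (metis sin_cos_sqrt sin_ge_zero)+
  have "cos \<bar>C - B\<bar> \<le> cos A" using 1 unfolding sn by (simp add: cs cos_diff)
  then have 1: "A \<le> \<bar>C - B\<bar>" using ABC by (subst (asm) cos_mono_le_eq) auto
  have "cos \<bar>C - A\<bar> \<le> cos B" using 2 unfolding sn by (simp add: cs cos_diff)
  then have 2: "B \<le> \<bar>C - A\<bar>" using ABC by (subst (asm) cos_mono_le_eq) auto
  show ?thesis using 1 2 C0 ABC unfolding A_def[symmetric] B_def[symmetric] C_def[symmetric] by linarith
qed

text \<open>The hypothesis compares the cosine of the sum of the two angles with \<open>c\<close>.
  Cosine is monotone only up to \<pi>, but a sum beyond \<pi> bounds any arccosine
  trivially.\<close>

lemma arccos_subadditive: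
  assumes a: "\<bar>a\<bar> \<le> 1" and b: "\<bar>b\<bar> \<le> 1" and c: "\<bar>c\<bar> \<le> 1"
    and 1: "c \<ge> a * b - sqrt (1 - a\<^sup>2) * sqrt (1 - b\<^sup>2)"
  shows "arccos c \<le> arccos a + arccos b"
proof -
  define A B C where "A = arccos a" and "B = arccos b" and "C = arccos c"
  have ABC: "0 \<le> A" "A \<le> pi" "0 \<le> B" "B \<le> pi" "0 \<le> C" "C \<le> pi"
    using a b c by (simp_all add: A_def B_def C_def arccos_lbound arccos_ubound)
  have cs: "a = cos A" "b = cos B" "c = cos C" using a b c by (simp_all add: A_def B_def C_def abs_le_iff)
  have sn: "sqrt (1 - a\<^sup>2) = sin A" "sqrt (1 - b\<^sup>2) = sin B"
    unfolding cs using ABC by (metis sin_cos_sqrt sin_ge_zero)+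
  have *: "cos (A + B) \<le> cos C" using 1 unfolding sn by (simp add: cs cos_add)
  have "C \<le> A + B"
  proof (cases "A + B \<le> pi")
    case True then show ?thesis using * ABC by (subst (asm) cos_mono_le_eq) auto
  qed (use ABC in linarith)
  then show ?thesis by (simp add: A_def B_def C_def)
qed

text \<open>Here \<open>p\<close> is the inner product of two unit vectors \<open>e\<close> and \<open>f\<close>, and \<open>q\<close>, \<open>r\<close> are those of the unit
  vector \<open>x e + y f\<close> with \<open>e\<close> and \<open>f\<close>.\<close>

lemma ang_add_unit:
  fixes p q r :: real
  assumes z: "x > 0" "y > 0"
    and p: "\<bar>p\<bar> < 1"
    and xx: "1 = x\<^sup>2 + y\<^sup>2 + 2 * x * y * p" and q: "q = x + y * p" and r: "r = x * p + y"
  shows "arccos q + arccos r = arccos p"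
proof -
  have p2: "p\<^sup>2 < 1" using p by (simp add: abs_square_less_1)
  have q1: "1 - q\<^sup>2 = y\<^sup>2 * (1 - p\<^sup>2)" unfolding q using xx by (simp add: power2_eq_square algebra_simps)
  have r1: "1 - r\<^sup>2 = x\<^sup>2 * (1 - p\<^sup>2)" unfolding r using xx by (simp add: power2_eq_square algebra_simps)
  have sq: "sqrt (1 - q\<^sup>2) = y * sqrt (1 - p\<^sup>2)" and sr: "sqrt (1 - r\<^sup>2) = x * sqrt (1 - p\<^sup>2)"
    using z by (simp_all add: q1 r1 real_sqrt_mult)
  have ss: "sqrt (1 - p\<^sup>2) * sqrt (1 - p\<^sup>2) = 1 - p\<^sup>2" using p2 by simp
  have "q\<^sup>2 \<le> 1" "r\<^sup>2 \<le> 1" using q1 r1 p2 by (smt (verit) mult_nonneg_nonneg zero_le_power2)+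
  then have qr: "\<bar>q\<bar> \<le> 1" "\<bar>r\<bar> \<le> 1" by (simp_all add: abs_square_le_1)
  have ss': "s * sqrt (1 - p\<^sup>2) * (t * sqrt (1 - p\<^sup>2)) = s * t * (1 - p\<^sup>2)" for s t
    using ss by (metis mult.assoc mult.left_commute)
  have ss2: "sqrt (1 - p\<^sup>2) * (t * sqrt (1 - p\<^sup>2)) = t * (1 - p\<^sup>2)" for t
    using ss'[of 1 t] by simp
  have "arccos q + arccos r \<le> arccos p"
  proof (rule arccos_superadditive)
    show "p * r + sqrt (1 - p\<^sup>2) * sqrt (1 - r\<^sup>2) \<le> q"
      unfolding sr ss2 by (simp add: q r power2_eq_square algebra_simps)
    show "p * q + sqrt (1 - p\<^sup>2) * sqrt (1 - q\<^sup>2) \<le> r"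
      unfolding sq ss2 by (simp add: q r power2_eq_square algebra_simps)
  qed (use p qr in auto)
  moreover have "arccos p \<le> arccos q + arccos r"
  proof (rule arccos_subadditive)
    have "q * r - y * x * (1 - p\<^sup>2) = p * (x\<^sup>2 + y\<^sup>2 + 2 * x * y * p)"
      by (simp add: q r power2_eq_square algebra_simps)
    then show "q * r - sqrt (1 - q\<^sup>2) * sqrt (1 - r\<^sup>2) \<le> p"
      unfolding sq sr ss' xx[symmetric] by simp
  qed (use p qr in auto)
  ultimately show ?thesis by linarith
qed

text \<open>After normalizing the tangential components to unit vectors, the multiple of
  \<open>V\<close> disappears and the coefficients become \<open>a * tx / tz\<close> and
  \<open>b * ty / tz\<close>, as required by \<open>ang_add_unit\<close>.\<close>

lemma ang_additive:
  assumes V: "V \<in> H2" and Z: "Z = a *\<^sub>R X + b *\<^sub>R Y + c *\<^sub>R V" and ab: "a > 0" "b > 0"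
    and n: "ldet V X Y \<noteq> 0"
  shows "ang V X Z + ang V Z Y = ang V X Y"
proof -
  define tx ty tz where "tx = sqrt (tform V X X)" and "ty = sqrt (tform V Y Y)" and "tz = sqrt (tform V Z Z)"
  have nz: "ldet V Z Y \<noteq> 0" using n ab by (simp add: Z)
  have n2: "ldet V Y X \<noteq> 0" using n ldet_swap(2)[of V X Y] by simp
  have pos: "tx > 0" "ty > 0" "tz > 0"
    using tform_pos[OF V n] tform_pos[OF V nz] tform_pos[OF V n2] by (simp_all add: tx_def ty_def tz_def)
  have sq: "tx\<^sup>2 = tform V X X" "ty\<^sup>2 = tform V Y Y" "tz\<^sup>2 = tform V Z Z"
    using pos by (simp_all add: tx_def ty_def tz_def)
  define p where "p = tform V X Y / (tx * ty)"
  have TXY: "tform V X Y = p * tx * ty" using pos by (simp add: p_def)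
  have tself: "tform V V A = 0" "tform V A V = 0" for A using tform_self[OF V] by auto
  have TXZ: "tform V X Z = a * tx\<^sup>2 + b * (p * tx * ty)" by (simp add: Z sq TXY tself)
  have TZY: "tform V Z Y = a * (p * tx * ty) + b * ty\<^sup>2" by (simp add: Z sq TXY tself)
  have TZZ: "tz\<^sup>2 = (a * tx)\<^sup>2 + (b * ty)\<^sup>2 + 2 * (a * tx) * (b * ty) * p"
    unfolding sq(3) by (simp add: Z tself tform_commute[of V Y X] TXY sq(1,2)[symmetric] power2_eq_square algebra_simps)
  have "arccos (a * tx / tz + b * ty / tz * p) + arccos (a * tx / tz * p + b * ty / tz) = arccos p"
  proof (rule ang_add_unit[where x = "a * tx / tz" and y = "b * ty / tz"])
    have "1 = tz\<^sup>2 / tz\<^sup>2" using pos by simp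
    also have "\<dots> = (a * tx / tz)\<^sup>2 + (b * ty / tz)\<^sup>2 + 2 * (a * tx / tz) * (b * ty / tz) * p"
      unfolding TZZ[THEN arg_cong[where f = "\<lambda>u. u / tz\<^sup>2"]] by (simp add: power_divide add_divide_distrib power2_eq_square)
    finally show "1 = (a * tx / tz)\<^sup>2 + (b * ty / tz)\<^sup>2 + 2 * (a * tx / tz) * (b * ty / tz) * p" .
    have "(tform V X Y)\<^sup>2 < tx\<^sup>2 * ty\<^sup>2" using tform_gram[OF V, of X Y] n unfolding sq
      by (smt (verit) zero_less_power2)
    then have "p\<^sup>2 * (tx\<^sup>2 * ty\<^sup>2) < 1 * (tx\<^sup>2 * ty\<^sup>2)" unfolding TXY by (simp add: power_mult_distrib mult.assoc)
    moreover have "tx\<^sup>2 * ty\<^sup>2 > 0" using pos by simp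
    ultimately have "p\<^sup>2 < 1" by (simp only: mult_less_cancel_right_pos)
    then show "\<bar>p\<bar> < 1" by (simp add: abs_square_less_1)
  qed (use pos ab in auto)
  moreover have "(a * tx\<^sup>2 + b * (p * tx * ty)) / (tx * tz) = a * tx / tz + b * ty / tz * p"
    "(a * (p * tx * ty) + b * ty\<^sup>2) / (tz * ty) = a * tx / tz * p + b * ty / tz"
    using pos by (simp_all add: field_simps power2_eq_square)
  moreover have "ang V X Z = arccos ((a * tx\<^sup>2 + b * (p * tx * ty)) / (tx * tz))"
    unfolding ang_def real_sqrt_mult tx_def[symmetric] ty_def[symmetric] tz_def[symmetric] TXZ by simp
  moreover have "ang V Z Y = arccos ((a * (p * tx * ty) + b * ty\<^sup>2) / (tz * ty))"
    unfolding ang_def real_sqrt_mult tx_def[symmetric] ty_def[symmetric] tz_def[symmetric] TZY by simp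
  moreover have "ang V X Y = arccos p"
    unfolding ang_def real_sqrt_mult tx_def[symmetric] ty_def[symmetric] p_def by simp
  ultimately show ?thesis by simp
qed

section \<open>The area of a triangle\<close>

lemma ldet_hl: "ldet (hl a) (hl b) (hl c) = (b$1 - a$1) * (c$2 - a$2) - (b$2 - a$2) * (c$1 - a$1)"
  by (simp add: ldet_def algebra_simps)

lemma ldet_lift_sgn:
  assumes "a \<in> hplane" "b \<in> hplane" "c \<in> hplane"
  shows "\<exists>k>0. ldet (lift a) (lift b) (lift c) = k * ldet (hl a) (hl b) (hl c)"
  using assms
  by (intro exI[of _ "1 / sqrt (1 - a \<bullet> a) * (1 / sqrt (1 - b \<bullet> b)) * (1 / sqrt (1 - c \<bullet> c))"])
     (simp add: lift_def hplane_iff)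

text \<open>The four arctangents of the sector formula are the angles: two of them differ by the
  angle at the centre, the other two give the angles at the remaining vertices up to \<pi> /
  2.\<close>

lemma harea_triangle_std:
  fixes p b c :: real
  assumes p: "p > 0" and bc: "b < c" and B: "p\<^sup>2 + b\<^sup>2 < 1" and C: "p\<^sup>2 + c\<^sup>2 < 1"
  shows "harea (convex hull {0, vector [p, b], vector [p, c]}) =
    pi - ang e3 (hl (vector [p, b])) (hl (vector [p, c]))
       - ang (lift (vector [p, b])) e3 (hl (vector [p, c]))
       - ang (lift (vector [p, c])) e3 (hl (vector [p, b]))"
proof -
  let ?B = "vector [p, b] :: real^2" and ?C = "vector [p, c] :: real^2"
  define s t where "s = b / p" and "t = c / p"
  have st: "s < t" using p bc by (simp add: s_def t_def divide_strict_right_mono)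
  have bc': "b = s * p" "c = t * p" using p by (simp_all add: s_def t_def)
  have hull: "convex hull {0, ?B, ?C} = {x. 0 \<le> x$1 \<and> x$1 \<le> p \<and> s * x$1 \<le> x$2 \<and> x$2 \<le> t * x$1}" (is "_ = ?K")
  proof
    show "convex hull {0, ?B, ?C} \<subseteq> ?K"
    proof (rule hull_minimal)
      show "{0, ?B, ?C} \<subseteq> ?K" using p st by (auto simp: bc' intro!: mult_right_mono)
      have "?K = {x. (- axis 1 1) \<bullet> x \<le> 0} \<inter> {x. axis 1 1 \<bullet> x \<le> p} \<inter> {x. (s *\<^sub>R axis 1 1 - axis 2 1) \<bullet> x \<le> 0}
         \<inter> {x. (axis 2 1 - t *\<^sub>R axis 1 1) \<bullet> x \<le> 0}"
        by (auto simp: inner2 axis_def)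
      then show "convex ?K" by (simp only:) (intro convex_Int convex_halfspace_le)
    qed
    show "?K \<subseteq> convex hull {0, ?B, ?C}"
    proof
      fix x :: "real^2" assume "x \<in> ?K"
      then have x: "0 \<le> x$1" "x$1 \<le> p" "s * x$1 \<le> x$2" "x$2 \<le> t * x$1" by auto
      define u v where "u = (t * x$1 - x$2) / ((t - s) * p)" and "v = (x$2 - s * x$1) / ((t - s) * p)"
      have d: "(t - s) * p > 0" using st p by simp
      have uv: "u \<ge> 0" "v \<ge> 0" using x d by (simp_all add: u_def v_def)
      have sum: "u + v = x$1 / p"
      proof -
        have "u + v = ((t - s) * x$1) / ((t - s) * p)" by (simp add: u_def v_def add_divide_distrib[symmetric] algebra_simps)
        then show ?thesis using st by simp
      qed
      have y: "u * b + v * c = x$2"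
      proof -
        have "u * b + v * c = ((t * x$1 - x$2) * (s * p) + (x$2 - s * x$1) * (t * p)) / ((t - s) * p)"
          by (simp add: u_def v_def bc' add_divide_distrib)
        also have "\<dots> = (x$2 * ((t - s) * p)) / ((t - s) * p)" by (simp add: algebra_simps)
        also have "\<dots> = x$2" using st p by (intro nonzero_mult_div_cancel_right) simp
        finally show ?thesis .
      qed
      have "x = (1 - (u + v)) *\<^sub>R 0 + u *\<^sub>R ?B + v *\<^sub>R ?C"
        using sum y p by (simp add: vec_eq_iff forall_2 distrib_right[symmetric])
      moreover have "1 - (u + v) \<ge> 0" using sum x p by simp
      ultimately show "x \<in> convex hull {0, ?B, ?C}"
        unfolding convex_hull_3 using uv by (smt (verit, best) mem_Collect_eq)
    qed
  qed
  have s1: "p\<^sup>2 * (1 + s\<^sup>2) = p\<^sup>2 + b\<^sup>2" and t1: "p\<^sup>2 * (1 + t\<^sup>2) = p\<^sup>2 + c\<^sup>2"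
    by (simp_all add: bc' power_mult_distrib algebra_simps)
  define q r where "q = sqrt (1 - (p\<^sup>2 + b\<^sup>2))" and "r = sqrt (1 - (p\<^sup>2 + c\<^sup>2))"
  have qr: "q > 0" "r > 0" "q\<^sup>2 = 1 - (p\<^sup>2 + b\<^sup>2)" "r\<^sup>2 = 1 - (p\<^sup>2 + c\<^sup>2)" using B C by (simp_all add: q_def r_def)
  have area: "harea (convex hull {0, ?B, ?C}) = (arctan (t / r) - arctan t) - (arctan (s / q) - arctan s)"
    unfolding hull using harea_sector[OF p, of s t] B C st by (simp add: s1 t1 q_def r_def)
  have vertex0: "ang e3 (hl ?B) (hl ?C) = arctan t - arctan s"
  proof -
    have "tform e3 (hl ?B) (hl ?C) = p\<^sup>2 * (1 + s * t)" "tform e3 (hl ?B) (hl ?B) = p\<^sup>2 * (1 + s\<^sup>2)" "tform e3 (hl ?C) (hl ?C) = p\<^sup>2 * (1 + t\<^sup>2)"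
      by (simp_all add: tform_def lor_def bc' power2_eq_square algebra_simps)
    then have "tform e3 (hl ?B) (hl ?C) / sqrt (tform e3 (hl ?B) (hl ?B) * tform e3 (hl ?C) (hl ?C))
       = (1 + s * t) / (sqrt (1 + s\<^sup>2) * sqrt (1 + t\<^sup>2))"
      using p by (simp add: real_sqrt_mult power2_eq_square)
    also have "\<dots> = cos (arctan t - arctan s)"
      by (simp add: cos_diff cos_arctan sin_arctan add_divide_distrib mult.commute)
    finally show ?thesis unfolding ang_def
      using arctan_monotone[OF st] arctan_bounded[of s] arctan_bounded[of t] by (simp add: arccos_cos)
  qed
  \<comment> \<open>The angle at \<open>(p, y)\<close> between the centre and the other end
    \<open>(p, z)\<close> of the vertical side; of \<open>z\<close> only the sign of
    \<open>y - z\<close> survives.\<close>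
  have vertex: "ang (lift (vector [p, y])) e3 (hl (vector [p, z])) = arccos (sgn (y - z) * y / (sqrt (p\<^sup>2 + y\<^sup>2) * sqrt (1 - p\<^sup>2)))"
    if y: "p\<^sup>2 + y\<^sup>2 < 1" and yz: "y \<noteq> z" for y z
  proof -
    define W where "W = (1 - (p\<^sup>2 + y\<^sup>2))"
    have W: "W > 0" using y by (simp add: W_def)
    let ?V = "lift (vector [p, y])"
    have V: "?V = (1 / sqrt W) *\<^sub>R hl (vector [p, y])" by (simp add: lift_def W_def inner2 power2_eq_square)
    have l3: "lor ?V e3 = - 1 / sqrt W" by (simp add: V lor_def)
    have lz: "lor ?V (hl (vector [p, z])) = (p\<^sup>2 + y * z - 1) / sqrt W" by (simp add: V lor_def power2_eq_square add_divide_distrib diff_divide_distrib)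
    have k1: "tform ?V e3 e3 = (p\<^sup>2 + y\<^sup>2) / W"
    proof -
      have "tform ?V e3 e3 = -1 + 1 / W" unfolding tform_def l3 using W by (simp add: lor_def)
      also have "\<dots> = (p\<^sup>2 + y\<^sup>2) / W" using W by (simp add: field_simps) (simp add: W_def)
      finally show ?thesis .
    qed
    have k2: "tform ?V e3 (hl (vector [p, z])) = (y - z) * y / W"
    proof -
      have "tform ?V e3 (hl (vector [p, z])) = -1 - (p\<^sup>2 + y * z - 1) / W"
        unfolding tform_def l3 lz using W by (simp add: lor_def)
      also have "\<dots> = (y - z) * y / W" using W by (simp add: field_simps) (simp add: W_def power2_eq_square algebra_simps)
      finally show ?thesis .
    qed
    have k3: "tform ?V (hl (vector [p, z])) (hl (vector [p, z])) = (y - z)\<^sup>2 * (1 - p\<^sup>2) / W"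
    proof -
      have "tform ?V (hl (vector [p, z])) (hl (vector [p, z])) = p\<^sup>2 + z\<^sup>2 - 1 + (p\<^sup>2 + y * z - 1)\<^sup>2 / W"
        unfolding tform_def lz using W by (simp add: lor_def power2_eq_square)
      also have "\<dots> = ((p\<^sup>2 + z\<^sup>2 - 1) * W + (p\<^sup>2 + y * z - 1)\<^sup>2) / W" using W by (simp add: add_divide_distrib)
      also have "(p\<^sup>2 + z\<^sup>2 - 1) * W + (p\<^sup>2 + y * z - 1)\<^sup>2 = (y - z)\<^sup>2 * (1 - p\<^sup>2)"
        by (simp add: W_def power2_eq_square algebra_simps)
      finally show ?thesis .
    qed
    have "sqrt (tform ?V e3 e3 * tform ?V (hl (vector [p, z])) (hl (vector [p, z]))) = \<bar>y - z\<bar> * (sqrt (p\<^sup>2 + y\<^sup>2) * sqrt (1 - p\<^sup>2)) / W"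
      unfolding k1 k3 using W by (simp add: real_sqrt_mult real_sqrt_divide)
    then have "tform ?V e3 (hl (vector [p, z])) / sqrt (tform ?V e3 e3 * tform ?V (hl (vector [p, z])) (hl (vector [p, z])))
       = ((y - z) / \<bar>y - z\<bar>) * (y / (sqrt (p\<^sup>2 + y\<^sup>2) * sqrt (1 - p\<^sup>2)))"
      unfolding k2 using W by simp
    also have "(y - z) / \<bar>y - z\<bar> = sgn (y - z)"
      using yz by (cases "y < z") (simp_all add: sgn_if divide_eq_eq)
    finally show ?thesis unfolding ang_def by simp
  qed
  \<comment> \<open>For the vertex on the ray of slope \<open>u\<close>, the cosine found in
    \<open>vertex\<close> is, up to sign, the sine of the arctangent in the area formula.\<close>
  have tr: "sin (arctan (u / w)) = u * p / (sqrt (p\<^sup>2 + (u * p)\<^sup>2) * sqrt (1 - p\<^sup>2))"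
    if w: "w > 0" "w\<^sup>2 = 1 - (p\<^sup>2 + (u * p)\<^sup>2)" for u w
  proof -
    have p1: "1 - p\<^sup>2 > 0" using w zero_less_power2[of w] zero_le_power2[of "u * p"] by linarith
    have "1 + (u / w)\<^sup>2 = (p\<^sup>2 * w\<^sup>2 + (u * p)\<^sup>2) / (p * w)\<^sup>2" using w(1) p by (simp add: field_simps power_mult_distrib)
    also have "p\<^sup>2 * w\<^sup>2 + (u * p)\<^sup>2 = (p\<^sup>2 + (u * p)\<^sup>2) * (1 - p\<^sup>2)" unfolding w(2) by (simp add: algebra_simps)
    finally have "sqrt (1 + (u / w)\<^sup>2) = sqrt (p\<^sup>2 + (u * p)\<^sup>2) * sqrt (1 - p\<^sup>2) / (p * w)"
      using w p by (simp add: real_sqrt_divide real_sqrt_mult)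
    then show ?thesis using w p by (simp add: sin_arctan)
  qed
  have vc: "ang (lift ?C) e3 (hl ?B) = pi / 2 - arctan (t / r)"
  proof -
    have "ang (lift ?C) e3 (hl ?B) = arccos (sin (arctan (t / r)))"
      using vertex[of c b] C bc p st tr[of r t] qr by (simp add: bc')
    also have "\<dots> = arccos (cos (pi / 2 - arctan (t / r)))" by (simp add: cos_diff)
    also have "\<dots> = pi / 2 - arctan (t / r)" using arctan_bounded[of "t / r"] by (intro arccos_cos) auto
    finally show ?thesis .
  qed
  have vb: "ang (lift ?B) e3 (hl ?C) = pi / 2 + arctan (s / q)"
  proof -
    have "ang (lift ?B) e3 (hl ?C) = arccos (- sin (arctan (s / q)))"
      using vertex[of b c] B bc p st tr[of q s] qr by (simp add: bc')
    also have "\<dots> = arccos (cos (pi / 2 + arctan (s / q)))" by (simp add: cos_add)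
    also have "\<dots> = pi / 2 + arctan (s / q)" using arctan_bounded[of "s / q"] by (intro arccos_cos) auto
    finally show ?thesis .
  qed
  show ?thesis unfolding area vertex0 vb vc by simp
qed

lemma ang_hl_lift:
  assumes "p \<in> hplane"
  shows "ang V (hl p) X = ang V (lift p) X" "ang V X (hl p) = ang V X (lift p)"
  using assms hplane_iff[of p] unfolding hl_lift[OF assms] by (simp_all add: ang_scale)

text \<open>Area and angles are invariant under Lorentz maps: a boost brings \<open>a\<close> to the
  centre and a rotation makes the opposite side vertical.\<close>

theorem harea_triangle:
  assumes abc: "a \<in> hplane" "b \<in> hplane" "c \<in> hplane" and nd: "ldet (hl a) (hl b) (hl c) \<noteq> 0"
  shows "harea (convex hull {a, b, c}) =
    pi - ang (lift a) (lift b) (lift c) - ang (lift b) (lift c) (lift a) - ang (lift c) (lift a) (lift b)"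
proof -
  obtain k where k: "k > 0" "ldet (lift a) (lift b) (lift c) = k * ldet (hl a) (hl b) (hl c)"
    using ldet_lift_sgn[OF abc] by blast
  have nd': "ldet (lift a) (lift b) (lift c) \<noteq> 0" using k nd by simp
  define f where "f = boost (lift a)"
  have f: "lorentz f" "f (lift a) = e3" using abc lorentz_boost boost_self by (simp_all add: f_def)
  define b1 c1 where "b1 = hmap f b" and "c1 = hmap f c"
  have h1: "b1 \<in> hplane" "c1 \<in> hplane" using abc f hmap_hplane by (simp_all add: b1_def c1_def)
  have l1: "lift b1 = f (lift b)" "lift c1 = f (lift c)" using abc f lift_hmap by (simp_all add: b1_def c1_def)
  have "(ldet e3 (lift b1) (lift c1))\<^sup>2 = (ldet (lift a) (lift b) (lift c))\<^sup>2"
    unfolding l1 f(2)[symmetric] by (rule lorentz_ldet_square[OF f(1)])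
  then have nd1: "ldet e3 (lift b1) (lift c1) \<noteq> 0" using nd' by auto
  have cr: "b1$1 * c1$2 - b1$2 * c1$1 \<noteq> 0"
    using nd1 by (simp add: lift_def ldet_def algebra_simps)
  define d where "d = sqrt ((c1$1 - b1$1)\<^sup>2 + (c1$2 - b1$2)\<^sup>2)"
  have d: "d > 0"
  proof -
    have "(c1$1 - b1$1)\<^sup>2 + (c1$2 - b1$2)\<^sup>2 \<noteq> 0"
    proof
      assume "(c1$1 - b1$1)\<^sup>2 + (c1$2 - b1$2)\<^sup>2 = 0"
      then have "c1$1 = b1$1" "c1$2 = b1$2" by (simp_all add: sum_power2_eq_zero_iff)
      then show False using cr by simp
    qed
    then have "(c1$1 - b1$1)\<^sup>2 + (c1$2 - b1$2)\<^sup>2 > 0"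
      using sum_power2_ge_zero[of "c1$1 - b1$1" "c1$2 - b1$2"] by linarith
    then show ?thesis by (simp add: d_def)
  qed
  \<comment> \<open>The sign selects, of the two rotations that make the side vertical, the one that
    puts it to the right of the centre.\<close>
  define \<sigma> where "\<sigma> = sgn (b1$1 * c1$2 - b1$2 * c1$1)"
  have \<sigma>: "\<sigma> * \<sigma> = 1" using cr by (simp add: \<sigma>_def sgn_mult_self_eq)
  define u v where "u = \<sigma> * (c1$2 - b1$2) / d" and "v = \<sigma> * (c1$1 - b1$1) / d"
  have uv: "u\<^sup>2 + v\<^sup>2 = 1"
  proof -
    have "u\<^sup>2 + v\<^sup>2 = (\<sigma> * \<sigma>) * ((c1$1 - b1$1)\<^sup>2 + (c1$2 - b1$2)\<^sup>2) / d\<^sup>2"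
      unfolding u_def v_def power_divide power_mult_distrib power2_eq_square[of \<sigma>] \<sigma>
      by (simp add: add_divide_distrib)
    also have "\<dots> = 1"
    proof -
      have "d\<^sup>2 = (c1$1 - b1$1)\<^sup>2 + (c1$2 - b1$2)\<^sup>2" unfolding d_def by simp
      then show ?thesis using d \<sigma> by (metis less_irrefl div_self mult_1 zero_eq_power2)
    qed
    finally show ?thesis .
  qed
  define g where "g = hrot u v \<circ> f"
  have g: "lorentz g" unfolding g_def by (intro lorentz_comp lorentz_hrot uv f)
  have ga: "g (lift a) = e3" by (simp add: g_def f vec_eq_iff forall_3)
  define b2 c2 where "b2 = hmap g b" and "c2 = hmap g c"
  have b2: "b2 = vector [u * b1$1 - v * b1$2, v * b1$1 + u * b1$2]"
    unfolding b2_def g_def using hmap_comp[OF lorentz_hrot[OF uv] f(1) abc(2)]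
    by (simp add: b1_def[symmetric] vec_eq_iff forall_2 hmap_def[of "hrot u v"])
  have c2: "c2 = vector [u * c1$1 - v * c1$2, v * c1$1 + u * c1$2]"
    unfolding c2_def g_def using hmap_comp[OF lorentz_hrot[OF uv] f(1) abc(3)]
    by (simp add: c1_def[symmetric] vec_eq_iff forall_2 hmap_def[of "hrot u v"])
  define p y z where "p = u * b1$1 - v * b1$2" and "y = v * b1$1 + u * b1$2" and "z = v * c1$1 + u * c1$2"
  have p': "p = \<sigma> * (b1$1 * c1$2 - b1$2 * c1$1) / d"
    by (simp add: p_def u_def v_def diff_divide_distrib[symmetric] algebra_simps)
  have "p = u * c1$1 - v * c1$2"
    unfolding p' by (simp add: u_def v_def diff_divide_distrib[symmetric] algebra_simps)
  then have b2': "b2 = vector [p, y]" and c2': "c2 = vector [p, z]"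
    using b2 c2 by (simp_all add: p_def y_def z_def)
  have p: "p > 0" unfolding p' \<sigma>_def using cr d by (auto simp: sgn_if)
  have h2: "b2 \<in> hplane" "c2 \<in> hplane" using hmap_hplane[OF g] abc by (simp_all add: b2_def c2_def)
  have l2: "lift b2 = g (lift b)" "lift c2 = g (lift c)" using lift_hmap[OF g] abc by (simp_all add: b2_def c2_def)
  have yz: "y \<noteq> z"
  proof
    assume "y = z"
    then have "lift b2 = lift c2" by (simp add: b2' c2')
    then have "(ldet (g (lift a)) (g (lift b)) (g (lift c)))\<^sup>2 = 0" unfolding l2[symmetric] by simp
    then show False using lorentz_ldet_square[OF g] nd' by simp
  qed
  have B: "p\<^sup>2 + y\<^sup>2 < 1" and C: "p\<^sup>2 + z\<^sup>2 < 1" using h2 by (simp_all add: b2' c2' hplane_iff inner2 power2_eq_square)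
  have sub: "{a, b, c} \<subseteq> hplane" using abc by simp
  have a2: "hmap g a = 0" using hmap_lift[OF g abc(1)] ga proj_e3 by simp
  have "harea (convex hull {a, b, c}) = harea (hmap g ` (convex hull {a, b, c}))"
    by (rule harea_hmap[OF g, symmetric]) (simp_all add: convex_hull_hplane[OF sub] compact_convex_hull finite_imp_compact)
  also have "hmap g ` (convex hull {a, b, c}) = convex hull {0, b2, c2}"
    unfolding hmap_convex_hull[OF g sub] by (simp add: a2 b2_def c2_def)
  also have "harea (convex hull {0, b2, c2}) = pi - ang e3 (lift b2) (lift c2) - ang (lift b2) (lift c2) e3 - ang (lift c2) e3 (lift b2)"
  proof (cases "y < z")
    case True
    show ?thesis using harea_triangle_std[OF p True B C] unfolding b2'[symmetric] c2'[symmetric]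
      by (simp add: ang_hl_lift h2 ang_commute[of "lift b2" e3])
  next
    case False
    then have "z < y" using yz by simp
    show ?thesis using harea_triangle_std[OF p \<open>z < y\<close> C B] unfolding b2'[symmetric] c2'[symmetric]
      by (simp add: ang_hl_lift h2 ang_commute[of "lift b2" e3] ang_commute[of e3] insert_commute)
  qed
  finally show ?thesis unfolding l2 ga[symmetric] by (simp add: ang_lorentz[OF g])
qed

subsection \<open>Convex polygons\<close>

lemma ldet_lift_sign:
  assumes "a \<in> hplane" "b \<in> hplane" "c \<in> hplane"
  shows "0 < \<sigma> * ldet (lift a) (lift b) (lift c) \<longleftrightarrow> 0 < \<sigma> * ldet (hl a) (hl b) (hl c)"
proof -
  obtain k where k: "k > 0" "ldet (lift a) (lift b) (lift c) = k * ldet (hl a) (hl b) (hl c)"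
    using ldet_lift_sgn[OF assms] by blast
  have "\<sigma> * ldet (lift a) (lift b) (lift c) = k * (\<sigma> * ldet (hl a) (hl b) (hl c))" by (simp add: k)
  then show ?thesis using zero_less_mult_pos[OF _ k(1)] k(1) by (metis mult_pos_pos)
qed

text \<open>The three signs say that \<open>Z\<close> points into the angle at \<open>V\<close>: in
  the expansion of \<open>Z\<close> by Cramer's rule the coefficients of \<open>X\<close> and
  \<open>Y\<close> are quotients of determinants of equal sign.\<close>

lemma ang_between:
  assumes V: "V \<in> H2" and "0 < \<sigma> * ldet V X Z" "0 < \<sigma> * ldet V Z Y" "0 < \<sigma> * ldet V X Y"
  shows "ang V X Z + ang V Z Y = ang V X Y"
proof -
  let ?D = "ldet X Y V"
  have r: "ldet V X Y = ?D" "ldet V Z Y = ldet Z Y V" "ldet V X Z = ldet X Z V" by (rule ldet_rotate)+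
  have D: "?D \<noteq> 0" using assms(4) r by auto
  have "?D *\<^sub>R Z = ldet Z Y V *\<^sub>R X + ldet X Z V *\<^sub>R Y + ldet X Y Z *\<^sub>R V" by (rule ldet_cramer)
  then have "(1 / ?D) *\<^sub>R (?D *\<^sub>R Z) = (1 / ?D) *\<^sub>R (ldet Z Y V *\<^sub>R X + ldet X Z V *\<^sub>R Y + ldet X Y Z *\<^sub>R V)" by simp
  then have Z: "Z = (ldet Z Y V / ?D) *\<^sub>R X + (ldet X Z V / ?D) *\<^sub>R Y + (ldet X Y Z / ?D) *\<^sub>R V"
    using D by (simp add: scaleR_add_right)
  show ?thesis
    by (rule ang_additive[OF V Z]) (use assms(2-4) D in \<open>auto simp: r zero_less_mult_iff zero_less_divide_iff\<close>)
qed

lemma hl_affine: "hl ((1 - u) *\<^sub>R a + u *\<^sub>R b) = (1 - u) *\<^sub>R hl a + u *\<^sub>R hl b"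
  by (simp add: vec_eq_iff forall_3)

lemma convex_ldet_halfplane: "convex {x. 0 \<le> \<sigma> * ldet A B (hl x)}"
proof (rule convexI)
  fix x y and u v :: real
  assume h: "x \<in> {x. 0 \<le> \<sigma> * ldet A B (hl x)}" "y \<in> {x. 0 \<le> \<sigma> * ldet A B (hl x)}" "0 \<le> u" "0 \<le> v" "u + v = 1"
  have u: "u = 1 - v" using h by simp
  have "\<sigma> * ldet A B (hl (u *\<^sub>R x + v *\<^sub>R y)) = (1 - v) * (\<sigma> * ldet A B (hl x)) + v * (\<sigma> * ldet A B (hl y))"
    unfolding u hl_affine by (simp add: algebra_simps)
  also have "\<dots> \<ge> 0"
    using h unfolding u by (intro add_nonneg_nonneg mult_nonneg_nonneg[of "1 - v"] mult_nonneg_nonneg[of v]) auto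
  finally show "u *\<^sub>R x + v *\<^sub>R y \<in> {x. 0 \<le> \<sigma> * ldet A B (hl x)}" by simp
qed

text \<open>Cramer's rule yields the barycentric coordinates, and the last entry of
  \<open>hl\<close> shows that they add up to 1.\<close>

lemma in_triangle:
  assumes D: "0 < \<sigma> * ldet (hl a) (hl b) (hl c)"
    and x: "0 \<le> \<sigma> * ldet (hl a) (hl b) (hl x)" "0 \<le> \<sigma> * ldet (hl b) (hl c) (hl x)" "0 \<le> \<sigma> * ldet (hl c) (hl a) (hl x)"
  shows "x \<in> convex hull {a, b, c}"
proof -
  let ?D = "ldet (hl a) (hl b) (hl c)"
  define \<alpha> \<beta> \<gamma> where "\<alpha> = ldet (hl x) (hl b) (hl c) / ?D" and "\<beta> = ldet (hl a) (hl x) (hl c) / ?D" and "\<gamma> = ldet (hl a) (hl b) (hl x) / ?D"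
  have D0: "?D \<noteq> 0" using D by auto
  have r: "ldet (hl x) (hl b) (hl c) = ldet (hl b) (hl c) (hl x)" "ldet (hl a) (hl x) (hl c) = ldet (hl c) (hl a) (hl x)"
    by (simp_all add: ldet_def algebra_simps)
  have pos: "\<alpha> \<ge> 0" "\<beta> \<ge> 0" "\<gamma> \<ge> 0"
    using D x unfolding \<alpha>_def \<beta>_def \<gamma>_def r by (auto simp: zero_le_mult_iff zero_less_mult_iff zero_le_divide_iff)
  have "?D *\<^sub>R hl x = ldet (hl x) (hl b) (hl c) *\<^sub>R hl a + ldet (hl a) (hl x) (hl c) *\<^sub>R hl b + ldet (hl a) (hl b) (hl x) *\<^sub>R hl c"
    by (rule ldet_cramer)
  then have "(1 / ?D) *\<^sub>R (?D *\<^sub>R hl x) = (1 / ?D) *\<^sub>R (ldet (hl x) (hl b) (hl c) *\<^sub>R hl a + ldet (hl a) (hl x) (hl c) *\<^sub>R hl b + ldet (hl a) (hl b) (hl x) *\<^sub>R hl c)"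
    by simp
  then have hx: "hl x = \<alpha> *\<^sub>R hl a + \<beta> *\<^sub>R hl b + \<gamma> *\<^sub>R hl c"
    using D0 by (simp add: \<alpha>_def \<beta>_def \<gamma>_def scaleR_add_right)
  then have "hl x $ 3 = (\<alpha> *\<^sub>R hl a + \<beta> *\<^sub>R hl b + \<gamma> *\<^sub>R hl c) $ 3" by simp
  then have s: "\<alpha> + \<beta> + \<gamma> = 1" by simp
  have "hl x $ 1 = (\<alpha> *\<^sub>R hl a + \<beta> *\<^sub>R hl b + \<gamma> *\<^sub>R hl c) $ 1" "hl x $ 2 = (\<alpha> *\<^sub>R hl a + \<beta> *\<^sub>R hl b + \<gamma> *\<^sub>R hl c) $ 2"
    using hx by simp_all
  then have "x = \<alpha> *\<^sub>R a + \<beta> *\<^sub>R b + \<gamma> *\<^sub>R c" by (simp add: vec_eq_iff forall_2)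
  then show ?thesis unfolding convex_hull_3 using s pos by blast
qed

section \<open>Fan triangulation\<close>

lemma harea_Un:
  assumes A: "A \<subseteq> hplane" "compact A" and B: "B \<subseteq> hplane" "compact B"
    and AB: "A \<inter> B \<subseteq> {x. a \<bullet> x = b}" and a: "a \<noteq> 0"
  shows "harea (A \<union> B) = harea A + harea B"
proof -
  have "{x. a \<bullet> x = b} \<in> null_sets lborel"
  proof -
    have "negligible {x. a \<bullet> x = b}" using a by (intro negligible_hyperplane) auto
    moreover have "{x. a \<bullet> x = b} \<in> sets lborel" using closed_hyperplane[of a b] by simp
    ultimately show ?thesis using null_sets_completion_iff negligible_iff_null_sets by blast
  qed
  then have ae: "AE x in lborel. \<not> (x \<in> A \<and> x \<in> B)"
    by (rule AE_I') (use AB in auto)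
  show ?thesis unfolding harea_def
    by (rule set_integral_Un_AE[OF ae]) (use A B hdensity_integrable in \<open>auto simp: compact_imp_closed\<close>)
qed

lemma ldet_hl_linear:
  "\<exists>u c. (\<forall>x. ldet A B (hl x) = u \<bullet> x - c) \<and> u = vector [A$2*B$3 - A$3*B$2, A$3*B$1 - A$1*B$3]"
  by (rule exI, rule exI[of _ "- (A$1*B$2 - A$2*B$1)"]) (auto simp: ldet_def inner2)

text \<open>The orientation is required for all increasing triples. Consecutive triples alone would
  also admit closed polygons that wind around several times.\<close>

locale convex_chain =
  fixes n :: nat and w :: "nat \<Rightarrow> real^2" and \<sigma> :: real
  assumes n3: "n \<ge> 3" and hw: "\<And>i. i < n \<Longrightarrow> w i \<in> hplane"
    and orient: "\<And>i j k. i < j \<Longrightarrow> j < k \<Longrightarrow> k < n \<Longrightarrow> 0 < \<sigma> * ldet (hl (w i)) (hl (w j)) (hl (w k))"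
begin

lemma orient_lift: "i < j \<Longrightarrow> j < k \<Longrightarrow> k < n \<Longrightarrow> 0 < \<sigma> * ldet (lift (w i)) (lift (w j)) (lift (w k))"
  using orient[of i j k] by (subst ldet_lift_sign) (auto simp: hw)

abbreviation "body k \<equiv> convex hull (w ` {..k})"

abbreviation "L i \<equiv> lift (w i)"

lemma hull_hplane: "k < n \<Longrightarrow> body k \<subseteq> hplane"
  by (intro convex_hull_hplane) (auto intro: hw)

lemma compact_hull: "compact (body k)"
  by (intro compact_convex_hull finite_imp_compact) auto

text \<open>Both claims come from one induction on the number of vertices: a point that satisfies
  the inequalities for one more vertex lies either on the old side of the diagonal through
  \<open>w 0\<close>, hence in the old hull, or in the triangle that is cut off.\<close>

lemma hull_halfplanes:
  assumes "2 \<le> k" "k < n"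
  shows "body k = {x. (\<forall>j<k. 0 \<le> \<sigma> * ldet (hl (w j)) (hl (w (Suc j))) (hl x)) \<and> 0 \<le> \<sigma> * ldet (hl (w k)) (hl (w 0)) (hl x)}"
    (is "_ = ?Q k")
    and "3 \<le> k \<Longrightarrow> body k = body (k - 1) \<union> convex hull {w 0, w (k - 1), w k}"
proof -
  have sub: "body k \<subseteq> ?Q k" if k: "2 \<le> k" "k < n" for k
  proof (rule hull_minimal)
    have "?Q k = (\<Inter>j\<in>{..<k}. {x. 0 \<le> \<sigma> * ldet (hl (w j)) (hl (w (Suc j))) (hl x)}) \<inter> {x. 0 \<le> \<sigma> * ldet (hl (w k)) (hl (w 0)) (hl x)}"
      by auto
    then show "convex (?Q k)" by (simp only:) (intro convex_Int convex_INT convex_ldet_halfplane)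
    show "w ` {..k} \<subseteq> ?Q k"
    proof (intro image_subsetI CollectI conjI allI impI)
      fix i j assume i: "i \<in> {..k}" and j: "j < k"
      consider "i < j" | "i = j" | "i = Suc j" | "i > Suc j" by linarith
      then show "0 \<le> \<sigma> * ldet (hl (w j)) (hl (w (Suc j))) (hl (w i))"
      proof cases
        case 1
        then have "0 < \<sigma> * ldet (hl (w i)) (hl (w j)) (hl (w (Suc j)))" using j k by (intro orient) auto
        then show ?thesis using ldet_rotate[of "hl (w i)"] by simp
      next
        case 4
        then show ?thesis using orient[of j "Suc j" i] i k by simp
      qed auto
    next
      fix i assume i: "i \<in> {..k}"
      consider "i = 0" | "i = k" | "0 < i" "i < k" using i by force
      then show "0 \<le> \<sigma> * ldet (hl (w k)) (hl (w 0)) (hl (w i))"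
      proof cases
        case 3
        then have "0 < \<sigma> * ldet (hl (w 0)) (hl (w i)) (hl (w k))" using k by (intro orient) auto
        then show ?thesis using ldet_rotate[of "hl (w k)"] by simp
      qed auto
    qed
  qed
  have step: "?Q (Suc k) \<subseteq> ?Q k \<union> convex hull {w 0, w k, w (Suc k)}" if k: "2 \<le> k" "Suc k < n" for k
  proof
    fix x assume x: "x \<in> ?Q (Suc k)"
    show "x \<in> ?Q k \<union> convex hull {w 0, w k, w (Suc k)}"
    proof (cases "0 \<le> \<sigma> * ldet (hl (w k)) (hl (w 0)) (hl x)")
      case True then show ?thesis using x by auto
    next
      case False
      then have "0 \<le> \<sigma> * ldet (hl (w 0)) (hl (w k)) (hl x)" using ldet_swap(1)[of "hl (w k)"] by simp
      moreover have "0 \<le> \<sigma> * ldet (hl (w k)) (hl (w (Suc k))) (hl x)" "0 \<le> \<sigma> * ldet (hl (w (Suc k))) (hl (w 0)) (hl x)"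
        using x by auto
      ultimately show ?thesis using in_triangle[OF orient[of 0 k "Suc k"]] k by auto
    qed
  qed
  have tri: "convex hull {w 0, w k, w (Suc k)} \<subseteq> body (Suc k)" for k
    by (intro hull_mono) auto
  have eq: "body k = ?Q k" if "2 \<le> k" "k < n" for k
    using that
  proof (induction k rule: dec_induct)
    case base
    have "?Q 2 \<subseteq> convex hull {w 0, w 1, w 2}"
    proof
      fix x assume x: "x \<in> ?Q 2"
      then have "0 \<le> \<sigma> * ldet (hl (w 0)) (hl (w (Suc 0))) (hl x)" "0 \<le> \<sigma> * ldet (hl (w 1)) (hl (w (Suc 1))) (hl x)"
        "0 \<le> \<sigma> * ldet (hl (w 2)) (hl (w 0)) (hl x)" by force+
      then show "x \<in> convex hull {w 0, w 1, w 2}" using in_triangle[OF orient[of 0 1 2]] n3 by (simp add: numeral_2_eq_2)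
    qed
    also have "\<dots> \<subseteq> body 2" by (intro hull_mono) auto
    finally show ?case using sub[of 2] n3 by auto
  next
    case (step m)
    have "?Q (Suc m) \<subseteq> body m \<union> convex hull {w 0, w m, w (Suc m)}" using that(1) step.IH step.hyps step.prems \<open>\<And>k. 2 \<le> k \<Longrightarrow> Suc k < n \<Longrightarrow> ?Q (Suc k) \<subseteq> ?Q k \<union> convex hull {w 0, w k, w (Suc k)}\<close>[of m] by simp
    also have "\<dots> \<subseteq> body (Suc m)" using tri[of m] by (auto intro: hull_mono[THEN subsetD, rotated])
    finally show ?case using sub[of "Suc m"] step.hyps step.prems by auto
  qed
  show "body k = ?Q k" using eq assms by blast
  show "body k = body (k - 1) \<union> convex hull {w 0, w (k - 1), w k}" if k: "3 \<le> k"
  proof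
    have Sk: "Suc (k - 1) = k" using k by simp
    have "?Q k \<subseteq> ?Q (k - 1) \<union> convex hull {w 0, w (k - 1), w k}" using step[of "k - 1"] k assms unfolding Sk by simp
    then show "body k \<subseteq> body (k - 1) \<union> convex hull {w 0, w (k - 1), w k}" using eq[of k] eq[of "k - 1"] k assms by simp
    show "body (k - 1) \<union> convex hull {w 0, w (k - 1), w k} \<subseteq> body k"
      using tri[of "k - 1"] unfolding Sk by (auto intro: hull_mono[THEN subsetD, rotated])
  qed
qed

text \<open>Each step glues a triangle to the diagonal from \<open>w 0\<close> to
  \<open>w k\<close>. Its angles at these two points merge with those of the polygon obtained so
  far, and its third angle is new.\<close>

lemma harea_hull:
  assumes "2 \<le> k" "k < n"
  shows "harea (body k) = (real k - 1) * pi - (ang (L 0) (L 1) (L k) + (\<Sum>j\<in>{1..<k}. ang (L j) (L (j - 1)) (L (Suc j))) + ang (L k) (L (k - 1)) (L 0))"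
  using assms
proof (induction k rule: dec_induct)
  case base
  have s: "w ` {..2} = {w 0, w 1, w 2}" by (auto simp: atMost_Suc numeral_2_eq_2)
  have "ldet (hl (w 0)) (hl (w 1)) (hl (w 2)) \<noteq> 0" using orient[of 0 1 2] n3 by auto
  then have "harea (body 2) = pi - ang (L 0) (L 1) (L 2) - ang (L 1) (L 2) (L 0) - ang (L 2) (L 0) (L 1)"
    unfolding s using n3 by (intro harea_triangle hw) auto
  moreover have "{1..<2::nat} = {1}" by auto
  ultimately show ?case using ang_commute[of "L 1" "L 2" "L 0"] ang_commute[of "L 2" "L 0" "L 1"]
    by (simp add: numeral_2_eq_2)
next
  case (step k)
  let ?T = "convex hull {w 0, w k, w (Suc k)}"
  have k: "2 \<le> k" "Suc k < n" using step by auto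
  have T: "?T \<subseteq> hplane" using k by (intro convex_hull_hplane) (auto intro: hw)
  have Tc: "compact ?T" by (intro compact_convex_hull finite_imp_compact) auto
  have U: "body (Suc k) = body k \<union> ?T" using hull_halfplanes(2)[of "Suc k"] k by simp
  obtain u c where uc: "\<And>x. ldet (hl (w 0)) (hl (w k)) (hl x) = u \<bullet> x - c"
    "u = vector [(hl (w 0))$2*(hl (w k))$3 - (hl (w 0))$3*(hl (w k))$2, (hl (w 0))$3*(hl (w k))$1 - (hl (w 0))$1*(hl (w k))$3]"
    using ldet_hl_linear by blast
  have u0: "u \<noteq> 0"
  proof
    assume "u = 0"
    then have "ldet (hl (w 0)) (hl (w k)) (hl (w (Suc k))) = ldet (hl (w 0)) (hl (w k)) (hl (w 0))"
      unfolding uc(1) by (simp only: inner_zero_left)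
    then show False using orient[of 0 k "Suc k"] k by simp
  qed
  \<comment> \<open>The triangle and the old polygon lie on opposite sides of the diagonal, so they
    share only a subset of a line, which has measure zero.\<close>
  have "?T \<subseteq> {x. 0 \<le> \<sigma> * ldet (hl (w 0)) (hl (w k)) (hl x)}"
    by (intro hull_minimal convex_ldet_halfplane) (use orient[of 0 k "Suc k"] k in auto)
  moreover have "body k \<subseteq> {x. 0 \<le> \<sigma> * ldet (hl (w k)) (hl (w 0)) (hl x)}"
    using hull_halfplanes(1)[of k] k by auto
  ultimately have "body k \<inter> ?T \<subseteq> {x. \<sigma> * ldet (hl (w 0)) (hl (w k)) (hl x) = 0}"
    using ldet_swap(1)[of "hl (w k)" "hl (w 0)"] by fastforce
  moreover have "\<sigma> \<noteq> 0" using orient[of 0 k "Suc k"] k by auto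
  ultimately have int: "body k \<inter> ?T \<subseteq> {x. u \<bullet> x = c}" using uc(1) by auto
  have "harea (body (Suc k)) = harea (body k) + harea ?T"
    unfolding U by (rule harea_Un[OF hull_hplane compact_hull T Tc int u0]) (use k in simp)
  also have "harea ?T = pi - ang (L 0) (L k) (L (Suc k)) - ang (L k) (L (Suc k)) (L 0) - ang (L (Suc k)) (L 0) (L k)"
    by (rule harea_triangle) (use k hw orient[of 0 k "Suc k"] in auto)
  also have "harea (body k) = (real k - 1) * pi - (ang (L 0) (L 1) (L k) + (\<Sum>j\<in>{1..<k}. ang (L j) (L (j - 1)) (L (Suc j))) + ang (L k) (L (k - 1)) (L 0))"
    using step by simp
  also have "\<dots> + (pi - ang (L 0) (L k) (L (Suc k)) - ang (L k) (L (Suc k)) (L 0) - ang (L (Suc k)) (L 0) (L k))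
    = (real (Suc k) - 1) * pi - ((ang (L 0) (L 1) (L k) + ang (L 0) (L k) (L (Suc k))) + (\<Sum>j\<in>{1..<k}. ang (L j) (L (j - 1)) (L (Suc j)))
       + (ang (L k) (L (k - 1)) (L 0) + ang (L k) (L 0) (L (Suc k))) + ang (L (Suc k)) (L k) (L 0))"
    by (simp add: ang_commute[of "L k" "L (Suc k)"] ang_commute[of "L (Suc k)" "L 0"] algebra_simps)
  also have "ang (L 0) (L 1) (L k) + ang (L 0) (L k) (L (Suc k)) = ang (L 0) (L 1) (L (Suc k))"
    by (rule ang_between[where \<sigma> = \<sigma>]) (use k hw orient_lift in auto)
  \<comment> \<open>Seen from \<open>w k\<close>, the points are met in the opposite sense, hence
    the sign \<open>- \<sigma>\<close>.\<close>
  also have "ang (L k) (L (k - 1)) (L 0) + ang (L k) (L 0) (L (Suc k)) = ang (L k) (L (k - 1)) (L (Suc k))"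
  proof (rule ang_between[where \<sigma> = "- \<sigma>"])
    have "0 < \<sigma> * ldet (L 0) (L (k - 1)) (L k)" "0 < \<sigma> * ldet (L 0) (L k) (L (Suc k))" "0 < \<sigma> * ldet (L (k - 1)) (L k) (L (Suc k))"
      using k by (auto intro!: orient_lift)
    moreover have "ldet (L k) (L (k - 1)) (L 0) = - ldet (L 0) (L (k - 1)) (L k)" "ldet (L k) (L 0) (L (Suc k)) = - ldet (L 0) (L k) (L (Suc k))"
       "ldet (L k) (L (k - 1)) (L (Suc k)) = - ldet (L (k - 1)) (L k) (L (Suc k))"
      by (simp_all add: ldet_def algebra_simps)
    ultimately show "0 < - \<sigma> * ldet (L k) (L (k - 1)) (L 0)" "0 < - \<sigma> * ldet (L k) (L 0) (L (Suc k))" "0 < - \<sigma> * ldet (L k) (L (k - 1)) (L (Suc k))"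
      by simp_all
  qed (use k hw in auto)
  finally show ?case using k by (simp add: algebra_simps)
qed

end

section \<open>Polygons with cyclically indexed vertices\<close>

lemma add_mod_eq_imp_eq:
  fixes a b i n :: nat
  assumes "(i + a) mod n = (i + b) mod n" "a < n" "b < n"
  shows "a = b"
proof -
  have *: "a = b" if "(i + a) mod n = (i + b) mod n" "a < n" "b < n" "a \<le> b" for a b
  proof -
    have "n dvd (i + b) - (i + a)" using that mod_eq_dvd_iff_nat[of "i + a" "i + b" n] by simp
    then have "n dvd b - a" by simp
    moreover have "b - a < n" using that by simp
    ultimately have "b - a = 0" by (metis dvd_imp_le gr0I leD)
    then show ?thesis using that by simp
  qed
  show ?thesis using *[of a b] *[of b a] assms by (cases "a \<le> b") auto
qed

text \<open>The vertices of a convex polygon in cyclic order, indexed periodically; \<open>\<sigma> = \<plusminus>1\<close> is their orientation.\<close>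

locale convex_cycle =
  fixes n :: nat and u :: "nat \<Rightarrow> real^2" and \<sigma> :: real and P :: "(real^2) set"
  assumes n3: "n \<ge> 3" and periodic: "\<And>i. u (i mod n) = u i" and hu: "\<And>i. u i \<in> hplane"
    and \<sigma>: "\<sigma> * \<sigma> = 1"
    and orient: "\<And>i a b. 0 < a \<Longrightarrow> a < b \<Longrightarrow> b < n \<Longrightarrow> 0 < \<sigma> * ldet (lift (u i)) (lift (u (i + a))) (lift (u (i + b)))"
    and P: "P = convex hull (u ` {..<n})"
begin

abbreviation "V i \<equiv> lift (u i)"

lemma V_H2 [simp]: "V i \<in> H2" by (simp add: hu)

lemma V_periodic: "V (i + n) = V i"
  using periodic[of "i + n"] periodic[of i] by simp

lemma V_mod: "i mod n = j mod n \<Longrightarrow> V i = V j"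
  using periodic[of i] periodic[of j] by simp

text \<open>The fan formula at \<open>k = n - 1\<close>. The predecessor of \<open>i\<close> is
  written as \<open>i + n - 1\<close> because truncated subtraction would be wrong at
  \<open>i = 0\<close>.\<close>

theorem harea_polygon: "harea P = (real n - 2) * pi - (\<Sum>i<n. ang (V i) (V (i + n - 1)) (V (i + 1)))"
proof -
  interpret convex_chain n u \<sigma>
  proof
    fix i j k assume ijk: "i < j" "j < k" "k < n"
    then have "0 < \<sigma> * ldet (V i) (V (i + (j - i))) (V (i + (k - i)))" by (intro orient) auto
    then show "0 < \<sigma> * ldet (hl (u i)) (hl (u j)) (hl (u k))" using ijk by (simp add: ldet_lift_sign hu)
  qed (use n3 hu in auto)
  have e: "{..n - 1} = {..<n}" using n3 by auto
  let ?f = "\<lambda>i. ang (V i) (V (i + n - 1)) (V (i + 1))"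
  have "sum ?f {..<n} = ?f 0 + sum ?f {1..<n}"
    using n3 by (simp add: lessThan_atLeast0 sum.atLeast_Suc_lessThan)
  also have "sum ?f {1..<n} = sum ?f {1..<n - 1} + ?f (n - 1)"
    using n3 sum.atLeastLessThan_Suc[of 1 "n - 1" ?f] by simp
  also have "sum ?f {1..<n - 1} = (\<Sum>j\<in>{1..<n - 1}. ang (V j) (V (j - 1)) (V (Suc j)))"
  proof (rule sum.cong)
    fix j assume "j \<in> {1..<n - 1}"
    then have "j + n - 1 = (j - 1) + n" by auto
    then show "?f j = ang (V j) (V (j - 1)) (V (Suc j))" using V_periodic[of "j - 1"] by simp
  qed simp
  also have "?f 0 = ang (V 0) (V 1) (V (n - 1))" by (simp add: ang_commute)
  also have "?f (n - 1) = ang (V (n - 1)) (V (n - 1 - 1)) (V 0)"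
  proof -
    have "n - 1 + n - 1 = (n - 1 - 1) + n" "n - 1 + 1 = 0 + n" using n3 by auto
    then show ?thesis using V_periodic[of "n - 1 - 1"] V_periodic[of 0] by metis
  qed
  finally show ?thesis using harea_hull[of "n - 1"] n3 unfolding P e by (simp add: algebra_simps of_nat_diff)
qed

end

text \<open>A face of a polytope is exposed, so the line through the edge touches \<open>P\<close>
  in the edge alone. Its normal \<open>a\<close> is orthogonal to \<open>B - A\<close>; therefore
  \<open>ldet\<close> differs from the signed distance to the line by a factor that does not depend
  on the point.\<close>

lemma exposed_edge_sign:
  assumes P: "polytope P" and e: "closed_segment A B face_of P" and AB: "A \<noteq> B"
    and X: "X \<in> P - closed_segment A B" and Y: "Y \<in> P - closed_segment A B"
  shows "0 < ldet (hl A) (hl B) (hl X) * ldet (hl A) (hl B) (hl Y)"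
proof -
  have "closed_segment A B exposed_face_of P"
    using exposed_face_of_polyhedron polytope_imp_polyhedron P e by blast
  then obtain a b where ab: "P \<subseteq> {x. a \<bullet> x \<le> b}" "closed_segment A B = P \<inter> {x. a \<bullet> x = b}"
    unfolding exposed_face_of_def by blast
  have A: "a \<bullet> A = b" and B: "a \<bullet> B = b" using ab(2) ends_in_segment[where a = A and b = B] by auto
  have d: "a \<bullet> (B - A) = 0" using A B by (simp add: inner_diff_right)
  define d1 d2 where "d1 = B$1 - A$1" and "d2 = B$2 - A$2"
  have ad: "a$1 * d1 + a$2 * d2 = 0" using d by (simp add: inner2 d1_def d2_def)
  have d0: "d1\<^sup>2 + d2\<^sup>2 > 0" using AB unfolding sum_power2_gt_zero_iff d1_def d2_def
    by (simp add: vec_eq_iff forall_2) (metis)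
  have *: "(d1 * a$2 - d2 * a$1) * ldet (hl A) (hl B) (hl Z) < 0" if Z: "Z \<in> P - closed_segment A B" for Z
  proof -
    have "a \<bullet> Z \<noteq> b" "a \<bullet> Z \<le> b" using Z ab by auto
    then have "a \<bullet> (Z - A) < 0" using A by (simp add: inner_diff_right)
    then have n: "(d1\<^sup>2 + d2\<^sup>2) * (a$1 * (Z$1 - A$1) + a$2 * (Z$2 - A$2)) < 0"
      using d0 by (simp add: inner2 mult_pos_neg)
    have "(d1 * a$2 - d2 * a$1) * ldet (hl A) (hl B) (hl Z) = (d1 * a$2 - d2 * a$1) * (d1 * (Z$2 - A$2) - d2 * (Z$1 - A$1))"
      by (simp add: ldet_hl d1_def d2_def)
    also have "\<dots> = (d1\<^sup>2 + d2\<^sup>2) * (a$1 * (Z$1 - A$1) + a$2 * (Z$2 - A$2))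
       - (a$1 * d1 + a$2 * d2) * (d1 * (Z$1 - A$1) + d2 * (Z$2 - A$2))"
      by (simp add: power2_eq_square algebra_simps)
    finally show ?thesis using n ad by simp
  qed
  show ?thesis using *[OF X] *[OF Y] by (auto simp: mult_less_0_iff zero_less_mult_iff)
qed

text \<open>The edges are all that is given. Each edge has the remaining vertices on one side; two
  consecutive edges have the same sign, as both see the triangle formed by them; and a Pluecker
  relation carries the sign over to arbitrary increasing triples.\<close>

lemma polygon_orientation:
  assumes n3: "n \<ge> 3" and ng: "hngon n P" and cv: "cyclic_vertices n v P"
  obtains \<sigma> where "convex_cycle n (\<lambda>i. v (i mod n)) \<sigma> P"
proof -
  define u where "u = (\<lambda>i. v (i mod n))"
  have P: "P \<subseteq> hplane" "compact P" "convex P" "polytope P"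
    using ng by (auto simp: hngon_def hpolygon_def hconvex_body_def polytope_def)
  let ?E = "{x. x extreme_point_of P}"
  have bij: "bij_betw v {..<n} ?E" and edge: "\<And>i. i < n \<Longrightarrow> closed_segment (v i) (v ((i + 1) mod n)) edge_of P"
    using cv by (auto simp: cyclic_vertices_def)
  have vE: "v i extreme_point_of P" if "i < n" for i using bij that by (auto simp: bij_betw_def)
  have vP: "v i \<in> P" if "i < n" for i using vE[OF that] by (simp add: extreme_point_of_def)
  have inj: "v i = v j \<Longrightarrow> i < n \<Longrightarrow> j < n \<Longrightarrow> i = j" for i j
    using bij by (auto simp: bij_betw_def inj_on_def)
  have uv: "u i = v (i mod n)" for i by (simp add: u_def)
  have mn: "i mod n < n" for i using n3 by simp
  let ?D = "\<lambda>i j. ldet (hl (u i)) (hl (u (i + 1))) (hl (u j))"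
  let ?ok = "\<lambda>i j. j mod n \<noteq> i mod n \<and> j mod n \<noteq> (i + 1) mod n"
  have same: "0 < ?D i j * ?D i k" if jk: "?ok i j" "?ok i k" for i j k
  proof -
    have e: "closed_segment (u i) (u (i + 1)) face_of P"
      using edge[OF mn[of i]] by (simp add: edge_of_def uv mod_Suc_eq)
    have ne: "i mod n \<noteq> (i + 1) mod n" using add_mod_eq_imp_eq[of i 0 n 1] n3 by auto
    then have ne': "u i \<noteq> u (i + 1)" using inj mn uv by metis
    have out: "u j \<in> P - closed_segment (u i) (u (i + 1))" if j: "?ok i j" for j
    proof
      show "u j \<in> P" using vP mn uv by metis
      have 1: "u j \<noteq> u i" "u j \<noteq> u (i + 1)" using j inj mn uv by metis+
      have "u j \<notin> open_segment (u i) (u (i + 1))"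
        using vE[OF mn[of j]] vP[OF mn[of i]] vP[OF mn[of "i + 1"]] uv by (metis extreme_point_of_def)
      then show "u j \<notin> closed_segment (u i) (u (i + 1))" using 1 by (auto simp: closed_segment_eq_open)
    qed
    show ?thesis by (rule exposed_edge_sign[OF P(4) e ne' out[OF jk(1)] out[OF jk(2)]])
  qed
  have ok2: "?ok i (i + 2)" for i
    using add_mod_eq_imp_eq[of i 0 n 2] add_mod_eq_imp_eq[of i 1 n 2] n3 by auto
  have ok02: "?ok 0 2" using ok2[of 0] unfolding add_0 .
  define \<sigma> where "\<sigma> = sgn (?D 0 2)"
  have D02: "?D 0 2 \<noteq> 0"
  proof -
    have "0 < ?D 0 2 * ?D 0 2" by (rule same[OF ok02 ok02])
    then show ?thesis by (metis less_irrefl mult_zero_left)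
  qed
  have \<sigma>: "\<sigma> * \<sigma> = 1" using D02 by (simp add: \<sigma>_def sgn_mult_self_eq)
  have sg: "0 < \<sigma> * x \<longleftrightarrow> 0 < ?D 0 2 * x" for x using D02 by (auto simp: \<sigma>_def sgn_if zero_less_mult_iff)
  have main: "0 < \<sigma> * ?D i j" if "?ok i j" for i j
    using that
  proof (induction i arbitrary: j)
    case 0
    show ?case unfolding sg by (rule same[OF ok02 0])
  next
    case (Suc i)
    have "0 < \<sigma> * ?D i (i + 2)" using Suc.IH[OF ok2] .
    \<comment> \<open>The triangle on three consecutive vertices belongs to both edges, which
      transfers the sign from one edge to the next.\<close>
    moreover have "?D i (i + 2) = ?D (Suc i) i" using ldet_rotate[of "hl (u i)"] by simp
    moreover have "?ok (Suc i) i"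
      using add_mod_eq_imp_eq[of i 0 n 1] add_mod_eq_imp_eq[of i 0 n 2] n3 by auto
    then have "0 < ?D (Suc i) i * ?D (Suc i) j" by (rule same[OF _ Suc.prems])
    ultimately show ?case by (auto simp: zero_less_mult_iff)
  qed
  have tri: "0 < \<sigma> * ldet (hl (u i)) (hl (u (i + a))) (hl (u (i + b)))" if "0 < a" "a < b" "b < n" for i a b
    using that(2,3)
  proof (induction b)
    case (Suc b)
    let ?X = "\<lambda>a b. \<sigma> * ldet (hl (u i)) (hl (u (i + a))) (hl (u (i + b)))"
    have first: "0 < ?X 1 c" if "1 < c" "c < n" for c
      using main[where i = i and j = "i + c"] add_mod_eq_imp_eq[of i c n 0] add_mod_eq_imp_eq[of i c n 1] that n3 by auto
    have consec: "0 < ?X b (Suc b)" if "0 < b"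
    proof -
      have "?ok (i + b) i"
        using add_mod_eq_imp_eq[of i 0 n b] add_mod_eq_imp_eq[of i 0 n "b + 1"] that Suc.prems by (auto simp: add.assoc)
      then have "0 < \<sigma> * ?D (i + b) i" using main by blast
      then show ?thesis using ldet_rotate[of "hl (u i)"] by simp
    qed
    show ?case
    proof (cases "a = b")
      case True
      then show ?thesis using consec \<open>0 < a\<close> by simp
    next
      case False
      then have ab: "a < b" using Suc.prems by simp
      have IH: "0 < ?X a b" using Suc.IH ab Suc.prems by simp
      have c: "0 < ?X b (Suc b)" using consec ab by simp
      \<comment> \<open>The three-term Pluecker relation for the vertices \<open>i + 1\<close>,
        \<open>i + a\<close>, \<open>i + b\<close>, \<open>i + b + 1\<close> seen from the vertex
        \<open>i\<close>. All its other determinants have a known sign.\<close>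
      have "?X 1 b * ?X a (Suc b) = ?X 1 a * ?X b (Suc b) + ?X 1 (Suc b) * ?X a b"
        by (simp add: ldet_def algebra_simps)
      moreover have "0 \<le> ?X 1 a" using first[of a] \<open>0 < a\<close> ab Suc.prems by (cases "a = 1") auto
      moreover have "0 < ?X 1 (Suc b)" "0 < ?X 1 b" 
        using first[of "Suc b"] first[of b] ab \<open>0 < a\<close> Suc.prems by simp_all
      ultimately have "0 < ?X 1 b * ?X a (Suc b)" using IH c by (simp add: add_nonneg_pos)
      then show ?thesis using \<open>0 < ?X 1 b\<close> zero_less_mult_pos by blast
    qed
  qed simp
  have uh: "u i \<in> hplane" for i using P(1) vP[OF mn[of i]] by (auto simp: uv)
  show ?thesis
  proof (rule that[of \<sigma>], unfold u_def[symmetric], unfold_locales)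
    show "0 < \<sigma> * ldet (lift (u i)) (lift (u (i + a))) (lift (u (i + b)))" if "0 < a" "a < b" "b < n" for i a b
      using tri[OF that] by (simp add: ldet_lift_sign uh)
    have "P = convex hull ?E" using Krein_Milman_Minkowski P by blast
    moreover have "u ` {..<n} = ?E" using bij by (simp add: bij_betw_def uv image_def) 
    ultimately show "P = convex hull (u ` {..<n})" by simp
  qed (use n3 uh \<sigma> in \<open>auto simp: uv\<close>)
qed

subsection \<open>Ordinary reduced polygons\<close>

lemma arccos_sqrt_arcsin:
  fixes S :: real
  assumes "0 \<le> S" "S \<le> 1"
  shows "arccos (sqrt (1 - S\<^sup>2)) = arcsin S"
proof -
  have "sqrt (1 - S\<^sup>2) = cos (arcsin S)" using assms by (simp add: cos_arcsin)
  moreover have "0 \<le> arcsin S" using assms arcsin_le_arcsin[of 0 S] by simp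
  moreover have "arcsin S \<le> pi" using arcsin_bounded[of S] assms pi_ge_zero by linarith
  ultimately show ?thesis by (simp add: arccos_cos)
qed

text \<open>
  The butterfly formed by two heights of the polygon, which meet at the angle \<open>\<phi>\<close>: two vertices \<open>V\<close>, \<open>U\<close> and the unit normals \<open>N\<close>, \<open>N'\<close> of the sides opposite to them, where the
  side with normal \<open>N\<close> starts at \<open>U\<close> and the one with normal \<open>N'\<close> at \<open>V\<close>; the points \<open>T\<close>, \<open>T'\<close> are
  the feet of the two heights, \<open>sinh\<close> and \<open>cosh\<close> of which are \<open>s\<close> and \<open>C\<close>.  The angle \<open>\<psi>\<close> between a
  height and the side at its vertex is given by \<open>S = sin \<psi>\<close>, and \<open>c = cosh d(V, U)\<close>.
\<close>

locale butterfly =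
  fixes V U N N' T T' :: "real^3" and C s c S :: real
  assumes V: "V \<in> H2" and U: "U \<in> H2" and N: "lor N N = 1" and N': "lor N' N' = 1"
    and VN: "lor V N = s" and UN': "lor U N' = s" and UN: "lor U N = 0" and VN': "lor V N' = 0"
    and NN': "lor N N' = - (C * S)" and VU: "lor V U = - c"
    and T: "V = C *\<^sub>R T + s *\<^sub>R N" and T': "U = C *\<^sub>R T' + s *\<^sub>R N'"
    and C: "C > 1" and s: "s > 0" "s\<^sup>2 = C\<^sup>2 - 1"
    and or: "0 < ldet V U N * ldet V U N'"
    and S0: "S > 0"
begin

lemma ldet_VUN: "(ldet V U N)\<^sup>2 = c\<^sup>2 - C\<^sup>2"
  unfolding ldet_square using V U
  by (simp add: H2_self VU VN UN N lor_commute[of U V] lor_commute[of N V] lor_commute[of N U] s(2) power2_eq_square[symmetric])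

text \<open>In the right triangle with hypotenuse \<open>V U\<close> the height is a leg. The
  hypothesis \<open>or\<close> keeps the determinant in \<open>ldet_VUN\<close> from vanishing,
  which excludes the degenerate case.\<close>

lemma c_gt: "c > C" "c > 1"
proof -
  have "(ldet V U N)\<^sup>2 > 0" using or by auto
  then have "C\<^sup>2 < c\<^sup>2" unfolding ldet_VUN by simp
  moreover have "c \<ge> 1" using reverse_cauchy[OF V U] VU by simp
  ultimately show "C < c" using C power_less_imp_less_base[of C 2 c] by simp
  then show "c > 1" using C by simp
qed

text \<open>The Gram determinant of \<open>V\<close>, \<open>U\<close>, \<open>N\<close>, \<open>N'\<close> vanishes, which leaves two possible values of \<open>c\<close>; the
  orientation selects this one.\<close>

lemma rel: "(c - 1) * (1 + C * S) = C\<^sup>2 - 1"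
proof -
  define p q where "p = ldet V U N" and "q = ldet V U N'"
  have p2: "p\<^sup>2 = c\<^sup>2 - C\<^sup>2" unfolding p_def by (rule ldet_VUN)
  have q2: "q\<^sup>2 = c\<^sup>2 - C\<^sup>2"
    unfolding ldet_square q_def using V U
    by (simp add: H2_self VU VN' UN' N' lor_commute[of U V] lor_commute[of N' V] lor_commute[of N' U] s(2) power2_eq_square[symmetric])
  have gram: "ldet V U N * ldet V U N' = - (lor V V * (lor U U * lor N N' - lor U N' * lor U N)
      - lor V U * (lor V U * lor N N' - lor U N' * lor V N) + lor V N' * (lor V U * lor U N - lor U U * lor V N))"
    by (simp add: lor_def ldet_def algebra_simps)
  have pq: "p * q = C * S * (1 - c\<^sup>2) + c * s\<^sup>2"
    unfolding p_def q_def gram using V U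
    by (simp add: H2_self VU VN UN UN' VN' NN' power2_eq_square algebra_simps)
  have "p * q > 0" using or by (simp add: p_def q_def)
  moreover have "p\<^sup>2 = q\<^sup>2" using p2 q2 by simp
  ultimately have "p = q" by (auto simp: power2_eq_iff)
  then have "C * S * (1 - c\<^sup>2) + c * s\<^sup>2 = c\<^sup>2 - C\<^sup>2" using pq p2 by (simp add: power2_eq_square)
  then have "(c + 1) * ((c - 1) * (1 + C * S)) = (c + 1) * (C\<^sup>2 - 1)"
    unfolding s(2) by (simp add: power2_eq_square algebra_simps)
  then show ?thesis using c_gt(2) by simp
qed

lemma CS_pos: "1 + C * S > 0" using C S0 by (simp add: add_pos_pos)

lemma c_eq: "c = C * (C + S) / (1 + C * S)"
  using rel CS_pos by (simp add: field_simps power2_eq_square)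

lemma S1: "S < 1"
proof -
  have "C * (1 + C * S) < C * (C + S)" using c_gt(1) unfolding c_eq using CS_pos by (simp add: pos_less_divide_eq)
  then have "1 + C * S < C + S" using C by simp
  then have "0 < (C - 1) * (1 - S)" by (simp add: algebra_simps)
  then show ?thesis using C by (simp add: zero_less_mult_iff)
qed

lemma cos_butterfly: "c * S / C = S * (C + S) / (1 + C * S)"
  using C by (simp add: c_eq)

lemma T_inner:
  "lor V T = - C" "lor V T' = - c / C" "lor U T = - c / C" "lor T T' = (- c - s\<^sup>2 * (C * S)) / C\<^sup>2"
  "lor T T = -1" "lor T' T' = -1"
proof -
  have eT: "T = (1 / C) *\<^sub>R (V - s *\<^sub>R N)" and eT': "T' = (1 / C) *\<^sub>R (U - s *\<^sub>R N')" using T T' C by simp_all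
  have C2: "1 + s\<^sup>2 = C\<^sup>2" by (simp add: s)
  show "lor V T = - C" unfolding eT using V VN C C2
    by (simp add: H2_self field_simps power2_eq_square)
  show "lor V T' = - c / C" "lor U T = - c / C" unfolding eT eT' using VU VN' UN by (simp_all add: lor_commute[of U V])
  show "lor T T' = (- c - s\<^sup>2 * (C * S)) / C\<^sup>2"
    unfolding eT eT' using VU VN' UN NN' C by (simp add: lor_commute[of N U] power2_eq_square field_simps)
  have q: "lor ((1 / C) *\<^sub>R X) ((1 / C) *\<^sub>R X) = lor X X / C\<^sup>2" for X
    by (simp add: power2_eq_square)
  have *: "lor (V - s *\<^sub>R N) (V - s *\<^sub>R N) = - (1 + s\<^sup>2)"
    using V VN N by (simp add: H2_self lor_commute[of N V] power2_eq_square)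
  show "lor T T = -1" unfolding eT q * C2 using C by simp
  have *: "lor (U - s *\<^sub>R N') (U - s *\<^sub>R N') = - (1 + s\<^sup>2)"
    using U UN' N' by (simp add: H2_self lor_commute[of N' U] power2_eq_square)
  show "lor T' T' = -1" unfolding eT' q * C2 using C by simp
qed

text \<open>This identifies \<open>S\<close>, introduced through the product of the normals, as a
  sine: with the value of \<open>c\<close> inserted, the cosine of the angle simplifies to the
  square root of \<open>1 - S\<^sup>2\<close>.\<close>

lemma ang_V: "ang V T' T = arcsin S"
proof -
  define D where "D = 1 + C * S"
  have D: "D > 0" using CS_pos by (simp add: D_def)
  have t1: "tform V T' T = s\<^sup>2 * (c - C * S) / C\<^sup>2"
  proof -
    have "tform V T' T = (- c - s\<^sup>2 * (C * S)) / C\<^sup>2 + c"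
      unfolding tform_def using C by (simp add: T_inner lor_commute[of T' T])
    also have "\<dots> = (c * (C\<^sup>2 - 1) - s\<^sup>2 * (C * S)) / C\<^sup>2" using C by (simp add: field_simps)
    also have "\<dots> = s\<^sup>2 * (c - C * S) / C\<^sup>2" by (simp add: s(2) algebra_simps)
    finally show ?thesis .
  qed
  have t2: "tform V T T = s\<^sup>2" unfolding s(2) by (simp add: tform_def T_inner power2_eq_square)
  have t3: "tform V T' T' = (c\<^sup>2 - C\<^sup>2) / C\<^sup>2" using C by (simp add: tform_def T_inner field_simps power2_eq_square)
  have cD: "c * D = C * (C + S)" unfolding c_eq D_def[symmetric] using D by simp
  have e1: "c - C * S = C\<^sup>2 * (1 - S\<^sup>2) / D"
  proof -
    have "(c - C * S) * D = C\<^sup>2 * (1 - S\<^sup>2)" unfolding left_diff_distrib cD by (simp add: D_def power2_eq_square algebra_simps)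
    then show ?thesis using D by (simp add: field_simps)
  qed
  have e2: "c\<^sup>2 - C\<^sup>2 = C\<^sup>2 * s\<^sup>2 * (1 - S\<^sup>2) / D\<^sup>2"
  proof -
    have "(c\<^sup>2 - C\<^sup>2) * D\<^sup>2 = (c * D)\<^sup>2 - C\<^sup>2 * D\<^sup>2" by (simp add: power_mult_distrib algebra_simps)
    also have "\<dots> = C\<^sup>2 * s\<^sup>2 * (1 - S\<^sup>2)" unfolding cD s(2) by (simp add: D_def power2_eq_square algebra_simps)
    finally show ?thesis using D by (simp add: field_simps)
  qed
  define k where "k = sqrt (1 - S\<^sup>2)"
  have S2: "1 - S\<^sup>2 > 0" using S0 S1 by (simp add: abs_square_less_1)
  then have k: "k > 0" "1 - S\<^sup>2 = k\<^sup>2" by (simp_all add: k_def)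
  have "sqrt (tform V T' T' * tform V T T) = s\<^sup>2 * k / D"
  proof (rule real_sqrt_unique)
    show "(s\<^sup>2 * k / D)\<^sup>2 = tform V T' T' * tform V T T"
      unfolding t2 t3 e2 k using C D by (simp add: power_divide power_mult_distrib power2_eq_square)
    show "0 \<le> s\<^sup>2 * k / D" using k D by simp
  qed
  moreover have "tform V T' T = s\<^sup>2 * k / D * k"
    unfolding t1 e1 k using C by (simp add: power2_eq_square)
  ultimately have "ang V T' T = arccos k" unfolding ang_def using k D s(1) by simp
  then show ?thesis using arccos_sqrt_arcsin[of S] S0 S1 by (simp add: k_def)
qed

lemma flip: "butterfly U V N' N T' T C s c S"
proof
  show "lor N' N = - (C * S)" "lor U V = - c" using NN' VU by (simp_all add: lor_commute)
  show "0 < ldet U V N' * ldet U V N" using or by (simp add: ldet_swap(1)[of U V] mult.commute)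
qed (use V U N N' VN UN' UN VN' T T' C s S0 in auto)

lemma ang_U: "ang U T T' = arcsin S"
  by (rule butterfly.ang_V[OF flip])

text \<open>The two cross products are normals of the heights, of length \<open>s\<close>, so the
  value is, up to sign, \<open>s\<^sup>2\<close> times the cosine of the angle between the
  heights.\<close>

lemma chord_inner: "lor (lcross T V) (lcross T' U) = - (s\<^sup>2 * (c * S / C))"
proof -
  have "lor (lcross T V) (lcross T' U) = (- c / C) * (- c / C) - ((- c - s\<^sup>2 * (C * S)) / C\<^sup>2) * (- c)"
    unfolding lor_lcross_lcross by (simp add: T_inner VU lor_commute[of T U])
  also have "\<dots> = - (s\<^sup>2 * (c * S / C))" using C by (simp add: field_simps power2_eq_square)
  finally show ?thesis .
qed

end

section \<open>The butterflies of a reduced polygon\<close>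

lemma pos_comb:
  fixes a b x y :: real
  assumes "a > 0" "b > 0"
  shows "0 < x \<Longrightarrow> 0 \<le> y \<Longrightarrow> 0 < a * x + b * y" "0 \<le> x \<Longrightarrow> 0 < y \<Longrightarrow> 0 < a * x + b * y"
  using assms by (simp_all add: add_pos_nonneg add_nonneg_pos)

lemma sum_periodic_shift:
  fixes f :: "nat \<Rightarrow> real"
  assumes "\<And>i. f (i + n) = f i"
  shows "(\<Sum>i<n. f (i + a)) = (\<Sum>i<n. f i)"
proof (induction a)
  case (Suc a)
  have "(\<Sum>i<n. f (i + Suc a)) + f a = (\<Sum>i<Suc n. f (i + a))"
    by (subst sum.lessThan_Suc_shift) simp
  also have "\<dots> = (\<Sum>i<n. f (i + a)) + f a" using assms[of a] by (simp add: add.commute)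
  finally show ?case using Suc by simp
qed simp

text \<open>\<open>T i\<close> is the foot of the height from the vertex \<open>V i\<close>; \<open>N i\<close> below is the inner normal of the side it lies on.\<close>

locale reduced_cycle = convex_cycle +
  fixes m :: nat and C s :: real and T :: "nat \<Rightarrow> real^3"
  assumes nm: "n = 2 * m + 1" and C: "C > 1" and s: "s > 0" "s\<^sup>2 = C\<^sup>2 - 1"
    and T_H2: "T i \<in> H2" and T_periodic: "T (i + n) = T i"
    and T_comb: "\<exists>a b. a > 0 \<and> b > 0 \<and> T i = a *\<^sub>R V (i + m) + b *\<^sub>R V (i + m + 1)"
    and VT: "lor (V i) (T i) = - C"
    and T_perp: "lor (V i - C *\<^sub>R T i) (V (i + m)) = 0" "lor (V i - C *\<^sub>R T i) (V (i + m + 1)) = 0"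
begin

definition N :: "nat \<Rightarrow> real^3" where "N i = (1 / s) *\<^sub>R (V i - C *\<^sub>R T i)"
definition c :: "nat \<Rightarrow> real" where "c i = - lor (V i) (V (i + m))"
text \<open>Chosen so that the hypothesis on the product of the normals in \<open>butterfly\<close>
  holds; that it is the sine of an angle is shown by \<open>ang_V\<close> there.\<close>

definition S :: "nat \<Rightarrow> real" where "S i = - lor (N i) (N (i + m)) / C"

lemma m1: "m \<ge> 1" using n3 nm by simp

lemma V_eq: "V i = C *\<^sub>R T i + s *\<^sub>R N i"
  using s by (simp add: N_def)

lemma N_inner: "lor (N i) (N i) = 1" "lor (V i) (N i) = s" "lor (N i) (V (i + m)) = 0" "lor (N i) (V (i + m + 1)) = 0"
proof -
  have "lor (V i - C *\<^sub>R T i) (V i - C *\<^sub>R T i) = s\<^sup>2"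
    using VT[of i] T_H2[of i] unfolding s(2) by (simp add: H2_self lor_commute[of "T i" "V i"] power2_eq_square)
  then show "lor (N i) (N i) = 1" using s(1) unfolding N_def lor_simps(5,6) by (simp only: power2_eq_square) simp
  have "lor (V i) (V i - C *\<^sub>R T i) = s\<^sup>2"
    using VT[of i] unfolding s(2) by (simp add: H2_self power2_eq_square)
  then show "lor (V i) (N i) = s" using s(1) unfolding N_def lor_simps(6) by (simp only: power2_eq_square) simp
  show "lor (N i) (V (i + m)) = 0" "lor (N i) (V (i + m + 1)) = 0" using T_perp[of i] by (simp_all add: N_def)
qed

lemma N_periodic: "N (i + n) = N i"
  by (simp add: N_def V_periodic T_periodic)

lemma orient0: "0 < a \<Longrightarrow> a \<le> b \<Longrightarrow> b < n \<Longrightarrow> 0 \<le> \<sigma> * ldet (V i) (V (i + a)) (V (i + b))"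
  using orient[of a b i] by (cases "a = b") auto

lemma V2m1: "V (i + m + m + 1) = V i"
proof -
  have "i + m + m + 1 = i + n" by (simp add: nm)
  then show ?thesis by (metis V_periodic)
qed

text \<open>Neighbouring vertices lie on the same side of the line with normal \<open>N i\<close>.
  Expanded in the two ends of that side and \<open>V i\<close>, the vector \<open>V (i + 1)\<close>
  contributes only through its coefficient at \<open>V i\<close>, whose sign is a matter of
  orientation.\<close>

lemma N_V_nonneg: "0 \<le> lor (N i) (V (i + 1))"
proof -
  let ?A = "V (i + m)" and ?B = "V (i + m + 1)"
  have "ldet ?A ?B (V i) *\<^sub>R V (i + 1) = ldet (V (i + 1)) ?B (V i) *\<^sub>R ?A + ldet ?A (V (i + 1)) (V i) *\<^sub>R ?B + ldet ?A ?B (V (i + 1)) *\<^sub>R V i"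
    by (rule ldet_cramer)
  then have "lor (N i) (ldet ?A ?B (V i) *\<^sub>R V (i + 1)) = ldet ?A ?B (V (i + 1)) * s"
    using N_inner[of i] by (simp add: lor_commute[of "N i" "V i"])
  then have eq: "(\<sigma> * ldet ?A ?B (V i)) * lor (N i) (V (i + 1)) = (\<sigma> * ldet ?A ?B (V (i + 1))) * s" by simp
  have "0 < \<sigma> * ldet (V i) ?A ?B" using orient[of m "m + 1" i] m1 nm by (simp add: add.assoc)
  then have 1: "0 < \<sigma> * ldet ?A ?B (V i)" using ldet_rotate[of "V i" ?A ?B] by simp
  have "0 \<le> \<sigma> * ldet (V (i + 1)) ?A ?B"
  \<comment> \<open>In a triangle \<open>V (i + 1)\<close> is itself an end of the side, and the
    determinant is zero.\<close>
  proof (cases "m = 1")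
    case False
    then show ?thesis using orient0[of "m - 1" m "i + 1"] m1 nm by simp
  qed simp
  then have "0 \<le> \<sigma> * ldet ?A ?B (V (i + 1))" using ldet_rotate[of "V (i + 1)" ?A ?B] by simp
  then have "0 \<le> (\<sigma> * ldet ?A ?B (V i)) * lor (N i) (V (i + 1))" unfolding eq using s by simp
  then show ?thesis using 1 by (simp add: zero_le_mult_iff)
qed

text \<open>As \<open>i + 2 * m + 1 = i + n\<close>, each of the vertices \<open>V i\<close> and
  \<open>V (i + m)\<close> is an end of the side opposite to the other. The positive coefficients of
  the two feet then provide the orientation hypothesis.\<close>

lemma butterfly: "butterfly (V i) (V (i + m)) (N i) (N (i + m)) (T i) (T (i + m)) C s (c i) (S i)"
proof
  obtain a b where ab: "a > 0" "b > 0" "T i = a *\<^sub>R V (i + m) + b *\<^sub>R V (i + m + 1)" using T_comb by blast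
  obtain a' b' where ab': "a' > 0" "b' > 0" "T (i + m) = a' *\<^sub>R V (i + m + m) + b' *\<^sub>R V i"
    using T_comb[of "i + m"] V2m1[of i] by auto
  show "lor (N i) (N (i + m)) = - (C * S i)" using C by (simp add: S_def)
  show "lor (V i) (V (i + m)) = - c i" by (simp add: c_def)
  have i0: "lor (N (i + m)) (V i) = 0" using N_inner(4)[of "i + m"] V2m1[of i] by simp
  then show "lor (V i) (N (i + m)) = 0" by (simp add: lor_commute)
  show "lor (V (i + m)) (N i) = 0" using N_inner(3)[of i] by (simp add: lor_commute)
  have p: "ldet (V i) (V (i + m)) (N i) = - (C * b / s) * ldet (V i) (V (i + m)) (V (i + m + 1))"
    by (simp add: N_def ab)
  have q: "ldet (V i) (V (i + m)) (N (i + m)) = - (C * a' / s) * ldet (V i) (V (i + m)) (V (i + m + m))"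
    by (simp add: N_def ab')
  have "0 < \<sigma> * ldet (V i) (V (i + m)) (V (i + m + 1))" "0 < \<sigma> * ldet (V i) (V (i + m)) (V (i + m + m))"
    using orient[of m "m + 1" i] orient[of m "m + m" i] m1 nm by (simp_all add: add.assoc)
  then have "0 < (\<sigma> * ldet (V i) (V (i + m)) (V (i + m + 1))) * (\<sigma> * ldet (V i) (V (i + m)) (V (i + m + m)))" by simp
  also have "\<dots> = (\<sigma> * \<sigma>) * (ldet (V i) (V (i + m)) (V (i + m + 1)) * ldet (V i) (V (i + m)) (V (i + m + m)))" by (simp add: mult_ac)
  finally have "0 < ldet (V i) (V (i + m)) (V (i + m + 1)) * ldet (V i) (V (i + m)) (V (i + m + m))" unfolding \<sigma> by simp
  moreover have "ldet (V i) (V (i + m)) (N i) * ldet (V i) (V (i + m)) (N (i + m))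
     = (C * b / s) * (C * a' / s) * (ldet (V i) (V (i + m)) (V (i + m + 1)) * ldet (V i) (V (i + m)) (V (i + m + m)))"
    unfolding p q by (simp add: mult_ac)
  moreover have "0 < (C * b / s) * (C * a' / s)" using C ab ab' s by simp
  ultimately show "0 < ldet (V i) (V (i + m)) (N i) * ldet (V i) (V (i + m)) (N (i + m))" by (metis mult_pos_pos)
  \<comment> \<open>This number equals \<open>s * S i\<close>. It is positive because the foot of
    one height lies strictly inside the half-plane bounded by the side on which the other height
    stands.\<close>
  have "0 < lor (N (i + m)) (T i)"
  proof -
    have "lor (N (i + m)) (T i) = a * s + b * lor (N (i + m)) (V (i + m + 1))"
      unfolding ab using N_inner(2)[of "i + m"] by (simp add: lor_commute[of "N (i + m)" "V (i + m)"])
    then show ?thesis using N_V_nonneg[of "i + m"] ab s by (simp add: add_pos_nonneg)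
  qed
  moreover have "s * S i = lor (N (i + m)) (T i)"
  proof -
    have "C * lor (N (i + m)) (T i) = lor (N (i + m)) (V i) - s * lor (N (i + m)) (N i)"
      by (subst V_eq) simp
    also have "\<dots> = s * (C * S i)" using i0 C by (simp add: S_def lor_commute)
    finally show ?thesis using C by simp
  qed
  ultimately show "0 < S i" using s by (metis zero_less_mult_pos)
  show "V i = C *\<^sub>R T i + s *\<^sub>R N i" "V (i + m) = C *\<^sub>R T (i + m) + s *\<^sub>R N (i + m)" by (rule V_eq)+
qed (use s C N_inner in auto)

lemma S_periodic: "S (i + n) = S i"
proof -
  have "i + n + m = i + m + n" by simp
  then show ?thesis unfolding S_def by (metis N_periodic)
qed

text \<open>The height from \<open>V i\<close> cuts the angle in two. One part belongs to the
  butterfly that starts at \<open>V i\<close>, the other to the one that ends there.\<close>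

theorem angle_split: "ang (V i) (V (i + n - 1)) (V (i + 1)) = arcsin (S i) + arcsin (S (i + m + 1))"
proof -
  obtain a b where ab: "a > 0" "b > 0" "T i = a *\<^sub>R V (i + m) + b *\<^sub>R V (i + m + 1)" using T_comb by blast
  obtain a' b' where ab': "a' > 0" "b' > 0" "T (i + m) = a' *\<^sub>R V (i + m + m) + b' *\<^sub>R V i"
    using T_comb[of "i + m"] V2m1[of i] by auto
  have j1: "i + m + 1 + m = i + n" by (simp add: nm)
  have j2: "i + m + 1 + m + 1 = (i + 1) + n" by (simp add: nm)
  \<comment> \<open>The butterfly with index \<open>i + m + 1\<close> has \<open>V i\<close> as its
    second vertex, because \<open>i + m + 1 + m = i + n\<close>.\<close>
  obtain a'' b'' where ab'': "a'' > 0" "b'' > 0" "T (i + m + 1) = a'' *\<^sub>R V i + b'' *\<^sub>R V (i + 1)"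
    using T_comb[of "i + m + 1"] V_periodic[of i] V_periodic[of "i + 1"] unfolding j1 j2 by auto
  have n1: "i + n - 1 = i + m + m" by (simp add: nm)
  have "ang (V i) (V (i + 1)) (T i) + ang (V i) (T i) (V (i + m + m)) = ang (V i) (V (i + 1)) (V (i + m + m))"
  proof (rule ang_between[where \<sigma> = \<sigma>])
    have "0 < a * (\<sigma> * ldet (V i) (V (i + m)) (V (i + (m + m)))) + b * (\<sigma> * ldet (V i) (V (i + (m + 1))) (V (i + (m + m))))"
      using orient[of m "m + m" i] orient0[of "m + 1" "m + m" i] m1 nm by (intro pos_comb(1) ab) auto
    then show "0 < \<sigma> * ldet (V i) (T i) (V (i + m + m))" by (simp add: ab(3) algebra_simps)
    have "0 < a * (\<sigma> * ldet (V i) (V (i + 1)) (V (i + m))) + b * (\<sigma> * ldet (V i) (V (i + 1)) (V (i + (m + 1))))"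
      using orient[of 1 "m + 1" i] orient0[of 1 m i] m1 nm by (intro pos_comb(2) ab) auto
    then show "0 < \<sigma> * ldet (V i) (V (i + 1)) (T i)" by (simp add: ab(3) algebra_simps)
    show "0 < \<sigma> * ldet (V i) (V (i + 1)) (V (i + m + m))"
      using orient[of 1 "m + m" i] m1 nm by (simp add: add.assoc)
  qed simp
  moreover have "ang (V i) (T i) (V (i + m + m)) = arcsin (S i)"
  proof -
    have "ang (V i) (T (i + m)) (T i) = ang (V i) (V (i + m + m)) (T i)"
      unfolding ab'(3) ang_add_vertex[OF V_H2] ang_scale(1)[OF ab'(1)] ..
    then show ?thesis using butterfly.ang_V[OF butterfly[of i]] by (simp add: ang_commute)
  qed
  moreover have "ang (V i) (V (i + 1)) (T i) = arcsin (S (i + m + 1))"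
  proof -
    have "ang (V i) (T (i + m + 1)) (T i) = ang (V i) (b'' *\<^sub>R V (i + 1) + a'' *\<^sub>R V i) (T i)"
      unfolding ab''(3) by (simp add: add.commute)
    also have "\<dots> = ang (V i) (V (i + 1)) (T i)"
      unfolding ang_add_vertex[OF V_H2] ang_scale(1)[OF ab''(2)] ..
    finally show ?thesis using butterfly.ang_U[OF butterfly[of "i + m + 1"]] unfolding j1 V_periodic T_periodic by simp
  qed
  ultimately show ?thesis unfolding n1 by (simp add: ang_commute)
qed

theorem harea_reduced: "harea P = (real n - 2) * pi - 2 * (\<Sum>i<n. arcsin (S i))"
proof -
  have "(\<Sum>i<n. arcsin (S (i + m + 1))) = (\<Sum>i<n. arcsin (S i))"
    using sum_periodic_shift[of "\<lambda>i. arcsin (S i)" n "m + 1"] S_periodic by (simp add: add.assoc)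
  then show ?thesis unfolding harea_polygon angle_split sum.distrib by simp
qed

end

section \<open>The angles between the heights\<close>

lemma lcross_scaleR: "lcross (c *\<^sub>R x) y = c *\<^sub>R lcross x y" "lcross x (c *\<^sub>R y) = c *\<^sub>R lcross x y"
  by (simp_all add: vec_eq_iff forall_3 algebra_simps)

text \<open>
  The unit normals of three lines that meet pairwise.  As the points of intersection have the same
  time orientation, two of the angles are interior angles of the triangle formed by the lines and
  the third one is an exterior angle.
\<close>

lemma arccos_three_lines:
  assumes u: "lor X X = 1" "lor Y Y = 1" "lor Z Z = 1"
    and f: "\<sigma> *\<^sub>R lcross X Y \<in> future" "\<sigma> *\<^sub>R lcross Y Z \<in> future" "\<sigma> *\<^sub>R lcross X Z \<in> future"
  shows "arccos (lor X Y) + arccos (lor Y Z) \<le> arccos (lor X Z)"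
proof -
  define a b c where "a = lor X Y" and "b = lor Y Z" and "c = lor X Z"
  have a': "lor Y X = a" "lor Z Y = b" "lor Z X = c" by (simp_all add: a_def b_def c_def lor_commute)
  note abc = a_def[symmetric] b_def[symmetric] c_def[symmetric] a'
  have \<sigma>0: "\<sigma> * \<sigma> > 0"
  proof -
    have "\<sigma> \<noteq> 0" using f(1) by (auto simp: future_def)
    then show ?thesis by (simp add: zero_less_mult_iff) linarith
  qed
  have sq: "\<bar>lor P Q\<bar> < 1" if "\<sigma> *\<^sub>R lcross P Q \<in> future" "lor P P = 1" "lor Q Q = 1" for P Q
  proof -
    have "\<sigma> * \<sigma> * lor (lcross P Q) (lcross P Q) < 0" using that(1) by (simp add: future_def mult.assoc del: lor_lcross)
    then have "lor (lcross P Q) (lcross P Q) < 0" using \<sigma>0 by (simp add: mult_less_0_iff del: lor_lcross)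
    then have "(lor P Q)\<^sup>2 < 1" unfolding lor_lcross_lcross using that by (simp add: lor_commute[of Q P] power2_eq_square)
    then show ?thesis by (simp add: abs_square_less_1)
  qed
  have lt: "\<bar>a\<bar> < 1" "\<bar>b\<bar> < 1" "\<bar>c\<bar> < 1" unfolding a_def b_def c_def using f u by (auto intro: sq)
  have neg: "lor P Q < 0" if "\<sigma> *\<^sub>R P \<in> future" "\<sigma> *\<^sub>R Q \<in> future" for P Q
  proof -
    have "lor (\<sigma> *\<^sub>R P) (\<sigma> *\<^sub>R Q) < 0" using that by (rule future_lor_neg)
    then have "\<sigma> * \<sigma> * lor P Q < 0" by (simp add: mult.assoc)
    then show ?thesis using \<sigma>0 by (simp add: mult_less_0_iff)
  qed
  \<comment> \<open>The points of intersection are future vectors up to a common factor, so their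
    products are negative; this supplies the signs needed for taking square roots below.\<close>
  have b1: "b > c * a" using neg[OF f(1) f(3)] unfolding lor_lcross_lcross abc u by simp
  have a1: "a > c * b" using neg[OF f(2) f(3)] unfolding lor_lcross_lcross abc u by (simp add: mult.commute)
  have "0 \<le> (ldet X Y Z)\<^sup>2" by simp
  \<comment> \<open>For unit normals the negative Gram determinant is this expression, and its sign
    says that the square of \<open>a - c * b\<close> is at least
    \<open>(1 - c\<^sup>2) * (1 - b\<^sup>2)\<close>, likewise with the roles permuted.\<close>
  then have g: "0 \<le> a\<^sup>2 + b\<^sup>2 + c\<^sup>2 - 2 * a * b * c - 1"
    unfolding ldet_square abc u by (simp add: power2_eq_square algebra_simps)
  have root: "sqrt (1 - x\<^sup>2) * sqrt (1 - y\<^sup>2) \<le> z"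
    if "z > 0" "(1 - x\<^sup>2) * (1 - y\<^sup>2) \<le> z\<^sup>2" for x y z :: real
    unfolding real_sqrt_mult[symmetric] using that by (intro real_le_lsqrt) auto
  show ?thesis unfolding a_def[symmetric] b_def[symmetric] c_def[symmetric]
  proof (rule arccos_superadditive)
    have "sqrt (1 - c\<^sup>2) * sqrt (1 - b\<^sup>2) \<le> a - c * b"
      by (rule root) (use a1 g in \<open>simp_all add: power2_eq_square algebra_simps\<close>)
    then show "c * b + sqrt (1 - c\<^sup>2) * sqrt (1 - b\<^sup>2) \<le> a" by simp
    have "sqrt (1 - c\<^sup>2) * sqrt (1 - a\<^sup>2) \<le> b - c * a"
      by (rule root) (use b1 g in \<open>simp_all add: power2_eq_square algebra_simps\<close>)
    then show "c * a + sqrt (1 - c\<^sup>2) * sqrt (1 - a\<^sup>2) \<le> b" by simp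
  qed (use lt in auto)
qed

text \<open>Since \<open>n - 2 * m = 1\<close>, the number \<open>m\<close> is coprime to
  \<open>n\<close>, so multiplication by \<open>m\<close> permutes the residues modulo
  \<open>n\<close>.\<close>

lemma sum_mult_reindex:
  fixes f :: "nat \<Rightarrow> real"
  assumes f: "\<And>i. f (i mod n) = f i" and n: "n = 2 * m + 1"
  shows "(\<Sum>k<n. f (k * m)) = (\<Sum>i<n. f i)"
proof -
  have cop: "coprime n m"
  proof (rule coprimeI)
    fix d assume "d dvd n" "d dvd m"
    then have "d dvd n - 2 * m" by (intro dvd_diff_nat) auto
    then show "is_unit d" using n by simp
  qed
  have inj: "inj_on (\<lambda>k. k * m mod n) {..<n}"
  proof (rule inj_onI)
    have *: "a = b" if "a < n" "b < n" "a * m mod n = b * m mod n" "a \<le> b" for a b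
    proof -
      have "n dvd b * m - a * m" using that mod_eq_dvd_iff_nat[of "a * m" "b * m" n] by simp
      then have "n dvd (b - a) * m" by (simp add: diff_mult_distrib)
      then have "n dvd b - a" using cop by (simp add: coprime_dvd_mult_left_iff)
      moreover have "b - a < n" using that by simp
      ultimately have "b - a = 0" by (metis dvd_imp_le gr0I leD)
      then show ?thesis using that by simp
    qed
    fix a b assume "a \<in> {..<n}" "b \<in> {..<n}" "a * m mod n = b * m mod n"
    then show "a = b" using *[of a b] *[of b a] by (cases "a \<le> b") auto
  qed
  have img: "(\<lambda>k. k * m mod n) ` {..<n} = {..<n}"
  proof (rule card_subset_eq)
    have "0 < n" using n by simp
    then show "(\<lambda>k. k * m mod n) ` {..<n} \<subseteq> {..<n}" by auto
  qed (simp_all add: card_image[OF inj])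
  have "(\<Sum>k<n. f (k * m)) = (\<Sum>k<n. f (k * m mod n))" by (simp add: f)
  also have "\<dots> = sum f ((\<lambda>k. k * m mod n) ` {..<n})" by (simp add: sum.reindex[OF inj])
  finally show ?thesis by (simp add: img)
qed

context reduced_cycle
begin

text \<open>\<open>M i\<close> is the unit normal of the height from \<open>V i\<close>; the lines \<open>L 0, \<dots>, L n = - L 0\<close> are the heights in the order
  in which they turn through a half-turn.\<close>

definition M :: "nat \<Rightarrow> real^3" where "M i = (\<sigma> / s) *\<^sub>R lcross (T i) (V i)"
definition L :: "nat \<Rightarrow> real^3" where "L k = (-1) ^ k *\<^sub>R M (k * m)"

lemma V_add_mult: "V (i + k * n) = V i"
  using periodic[of "i + k * n"] periodic[of i] by simp

lemma T_add_mult: "T (i + k * n) = T i"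
proof (induction k)
  case (Suc k)
  have "i + Suc k * n = (i + k * n) + n" by simp
  then show ?case using Suc T_periodic by metis
qed simp

lemma S_add_mult: "S (i + k * n) = S i"
proof (induction k)
  case (Suc k)
  have "i + Suc k * n = (i + k * n) + n" by simp
  then show ?case using Suc S_periodic by metis
qed simp

lemma S_mod: "S (i mod n) = S i"
  using S_add_mult[of "i mod n" "i div n"] by (simp add: mod_div_mult_eq)

lemma M_add_mult: "M (i + k * n) = M i"
  by (simp add: M_def V_add_mult T_add_mult)

lemma M_unit: "lor (M i) (M i) = 1"
proof -
  have "lor (lcross (T i) (V i)) (lcross (T i) (V i)) = s\<^sup>2"
    unfolding lor_lcross_lcross s(2) using VT[of i] T_H2[of i]
    by (simp add: H2_self lor_commute[of "T i" "V i"] power2_eq_square)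
  then have "lor (M i) (M i) = (\<sigma> * \<sigma>) / (s * s) * s\<^sup>2" by (simp add: M_def del: lor_lcross)
  then show ?thesis using s(1) unfolding \<sigma> by (simp only: power2_eq_square) simp
qed

text \<open>The height from \<open>V j\<close> ends strictly between \<open>V (j + m)\<close> and
  \<open>V (j + m + 1)\<close>; thus its line separates the \<open>m\<close> vertices after
  \<open>V j\<close> from the \<open>m\<close> vertices before it.\<close>

lemma M_V_sign:
  shows "1 \<le> d \<Longrightarrow> d \<le> m \<Longrightarrow> 0 < lor (M j) (V (j + d))"
    and "m + 1 \<le> d \<Longrightarrow> d \<le> 2 * m \<Longrightarrow> lor (M j) (V (j + d)) < 0"
    and "lor (M j) (V j) = 0"
proof -
  obtain a b where ab: "a > 0" "b > 0" "T j = a *\<^sub>R V (j + m) + b *\<^sub>R V (j + m + 1)" using T_comb by blast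
  have e: "lor (M j) X = (a * (\<sigma> * ldet (V j) X (V (j + m))) + b * (\<sigma> * ldet (V j) X (V (j + (m + 1))))) / s" for X
    using ldet_rotate[of "V (j + m)" "V j" X] ldet_rotate[of "V (j + m + 1)" "V j" X]
    by (simp add: M_def ab algebra_simps add_divide_distrib)
  show "lor (M j) (V j) = 0" by (simp add: e)
  show "0 < lor (M j) (V (j + d))" if d: "1 \<le> d" "d \<le> m"
    unfolding e using s(1) orient0[of d m j] orient[of d "m + 1" j] d nm
    by (intro divide_pos_pos pos_comb(2) ab) auto
  show "lor (M j) (V (j + d)) < 0" if d: "m + 1 \<le> d" "d \<le> 2 * m"
  proof -
    have "0 < a * (\<sigma> * ldet (V j) (V (j + m)) (V (j + d))) + b * (\<sigma> * ldet (V j) (V (j + (m + 1))) (V (j + d)))"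
      using orient0[of "m + 1" d j] orient[of m d j] d nm m1 by (intro pos_comb(1) ab) auto
    then have "a * (\<sigma> * ldet (V j) (V (j + d)) (V (j + m))) + b * (\<sigma> * ldet (V j) (V (j + d)) (V (j + (m + 1)))) < 0"
      using ldet_swap(2)[of "V j" "V (j + m)" "V (j + d)"] ldet_swap(2)[of "V j" "V (j + (m + 1))" "V (j + d)"] by simp
    then show ?thesis unfolding e using s(1) by (intro divide_neg_pos)
  qed
qed

text \<open>The line of the height from \<open>V j\<close> separates \<open>V (j + d)\<close> from
  the foot \<open>T (j + d)\<close>, so the two heights meet. The double cross product writes their
  common point as a combination of that vertex and that foot with coefficients of one sign, positive
  or negative according to the half in which \<open>d\<close> lies.\<close>

lemma M_cross:
  shows "1 \<le> d \<Longrightarrow> d \<le> m \<Longrightarrow> \<sigma> *\<^sub>R lcross (M (j + d)) (M j) \<in> future"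
    and "m + 1 \<le> d \<Longrightarrow> d \<le> 2 * m \<Longrightarrow> - (\<sigma> *\<^sub>R lcross (M (j + d)) (M j)) \<in> future"
proof -
  let ?i = "j + d"
  obtain a b where ab: "a > 0" "b > 0" "T ?i = a *\<^sub>R V (?i + m) + b *\<^sub>R V (?i + m + 1)" using T_comb by blast
  have "lcross (M ?i) (M j) = (\<sigma> / s) *\<^sub>R lcross (lcross (T ?i) (V ?i)) (M j)"
    by (simp add: M_def[of ?i] lcross_scaleR)
  then have "\<sigma> *\<^sub>R lcross (M ?i) (M j) = ((\<sigma> * \<sigma>) / s) *\<^sub>R (lor (V ?i) (M j) *\<^sub>R T ?i - lor (T ?i) (M j) *\<^sub>R V ?i)"
    unfolding lcross_lcross by simp
  then have e: "\<sigma> *\<^sub>R lcross (M ?i) (M j) = (1 / s) *\<^sub>R (lor (M j) (V ?i) *\<^sub>R T ?i - lor (M j) (T ?i) *\<^sub>R V ?i)"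
    by (simp only: \<sigma> lor_commute)
  have t: "lor (M j) (T ?i) = a * lor (M j) (V (j + (d + m))) + b * lor (M j) (V (j + (d + m + 1)))"
    by (simp add: ab(3) add.assoc)
  have fut: "T ?i \<in> future" "V ?i \<in> future" using T_H2 H2_future V_H2 by blast+
  show "\<sigma> *\<^sub>R lcross (M ?i) (M j) \<in> future" if d: "1 \<le> d" "d \<le> m"
  proof -
    have 1: "lor (M j) (V (j + (d + m))) < 0" using M_V_sign(2)[of "d + m" j] d by simp
    have 2: "lor (M j) (V (j + (d + m + 1))) \<le> 0"
    proof (cases "d = m")
      case True
      then have "j + (d + m + 1) = j + 1 * n" by (simp add: nm)
      then have "V (j + (d + m + 1)) = V j" using V_add_mult[of j 1] by metis
      then show ?thesis using M_V_sign(3)[of j] by simp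
    next
      case False
      then show ?thesis using M_V_sign(2)[of "d + m + 1" j] d by simp
    qed
    have "0 < - lor (M j) (T ?i)" using pos_comb(1)[OF ab(1,2), of "- lor (M j) (V (j + (d + m)))" "- lor (M j) (V (j + (d + m + 1)))"] 1 2
      unfolding t by simp
    then have "lor (M j) (V ?i) *\<^sub>R T ?i + (- lor (M j) (T ?i)) *\<^sub>R V ?i \<in> future"
      using M_V_sign(1)[OF d] by (intro future_add future_scale fut)
    then show ?thesis unfolding e using s(1) by (intro future_scale) simp_all
  qed
  show "- (\<sigma> *\<^sub>R lcross (M ?i) (M j)) \<in> future" if d: "m + 1 \<le> d" "d \<le> 2 * m"
  proof -
    \<comment> \<open>Past the middle the indices \<open>d + m\<close> and \<open>d + m + 1\<close>
      exceed \<open>2 * m\<close>; subtracting \<open>n\<close> turns them into \<open>d'\<close>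
      and \<open>d' + 1\<close>.\<close>
    obtain d' where d': "d = d' + m + 1" using d by (metis add.commute add.assoc le_Suc_ex)
    have p: "j + (d + m) = (j + d') + 1 * n" "j + (d + m + 1) = (j + (d' + 1)) + 1 * n" by (simp_all add: d' nm)
    have 2: "0 < lor (M j) (V (j + (d + m + 1)))"
      unfolding p V_add_mult using M_V_sign(1)[of "d' + 1" j] d d' by simp
    have 1: "0 \<le> lor (M j) (V (j + (d + m)))"
      unfolding p V_add_mult using M_V_sign(1)[of d' j] M_V_sign(3)[of j] d d' by (cases "d' = 0") auto
    have "0 < lor (M j) (T ?i)" unfolding t using 1 2 by (intro pos_comb(2) ab)
    then have "(- lor (M j) (V ?i)) *\<^sub>R T ?i + lor (M j) (T ?i) *\<^sub>R V ?i \<in> future"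
      using M_V_sign(2)[OF d] by (intro future_add future_scale fut) auto
    then have "(1 / s) *\<^sub>R ((- lor (M j) (V ?i)) *\<^sub>R T ?i + lor (M j) (T ?i) *\<^sub>R V ?i) \<in> future"
      using s(1) by (intro future_scale) simp_all
    moreover have "(1 / s) *\<^sub>R ((- lor (M j) (V ?i)) *\<^sub>R T ?i + lor (M j) (T ?i) *\<^sub>R V ?i) = - (\<sigma> *\<^sub>R lcross (M ?i) (M j))"
      unfolding e by (simp add: algebra_simps)
    ultimately show ?thesis by simp
  qed
qed

lemma L_unit: "lor (L k) (L k) = 1"
  by (simp add: L_def M_unit power_mult_distrib[symmetric])

text \<open>Two steps of length \<open>m\<close> fall short of a full turn by one vertex. If the
  indices differ by \<open>2 * f\<close>, the heights thus start at vertices that are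
  \<open>f\<close> apart; if they differ by \<open>2 * f + 1\<close>, the offset is
  \<open>f + m + 1\<close>, and the negative sign of that case is absorbed by the alternating
  signs.\<close>

lemma L_cross:
  assumes "a < b" "b < n"
  shows "\<sigma> *\<^sub>R lcross (L a) (L b) \<in> future"
proof -
  define e where "e = b - a"
  have b: "b = a + e" and e: "1 \<le> e" "e \<le> 2 * m" using assms nm by (auto simp: e_def)
  have lc: "lcross (L a) (L b) = ((-1) ^ a * (-1) ^ b) *\<^sub>R lcross (M (a * m)) (M (b * m))"
    by (simp add: L_def lcross_scaleR)
  have sg: "(-1) ^ a * (-1) ^ b = ((-1) ^ e :: real)" by (simp add: b power_add flip: power_mult_distrib)
  show ?thesis
  proof (cases "even e")
    case True
    then obtain f where f: "e = 2 * f" by auto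
    have i: "b * m + f = a * m + f * n" by (simp add: b f nm algebra_simps)
    have "\<sigma> *\<^sub>R lcross (M (b * m + f)) (M (b * m)) \<in> future" using e f by (intro M_cross(1)) auto
    then show ?thesis unfolding lc sg using True unfolding i M_add_mult by simp
  next
    case False
    then obtain f where f: "e = 2 * f + 1" by (auto elim: oddE)
    have i: "b * m + (f + m + 1) = a * m + (f + 1) * n" by (simp add: b f nm algebra_simps)
    have "- (\<sigma> *\<^sub>R lcross (M (b * m + (f + m + 1))) (M (b * m))) \<in> future" using e f by (intro M_cross(2)) auto
    then show ?thesis unfolding lc sg using False unfolding i M_add_mult by simp
  qed
qed

definition \<phi> :: "nat \<Rightarrow> real" where "\<phi> i = arccos (S i * (C + S i) / (1 + C * S i))"

lemma L_consecutive: "arccos (lor (L k) (L (k + 1))) = \<phi> (k * m)"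
proof -
  let ?i = "k * m"
  have i: "(k + 1) * m = ?i + m" by simp
  have "lor (L k) (L (k + 1)) = ((-1) ^ k * (-1) ^ (k + 1)) * ((\<sigma> / s) * (\<sigma> / s) * lor (lcross (T ?i) (V ?i)) (lcross (T (?i + m)) (V (?i + m))))"
    unfolding L_def M_def i by (simp del: lor_lcross)
  also have "(-1) ^ k * (-1) ^ (k + 1) = (-1 :: real)" by (simp flip: power_mult_distrib)
  also have "lor (lcross (T ?i) (V ?i)) (lcross (T (?i + m)) (V (?i + m))) = - (s\<^sup>2 * (c ?i * S ?i / C))"
    by (rule butterfly.chord_inner[OF butterfly])
  also have "-1 * ((\<sigma> / s) * (\<sigma> / s) * - (s\<^sup>2 * (c ?i * S ?i / C))) = (\<sigma> * \<sigma>) * (c ?i * S ?i / C)"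
    using s(1) by (simp add: power2_eq_square)
  also have "\<dots> = S ?i * (C + S ?i) / (1 + C * S ?i)"
    unfolding \<sigma> using butterfly.cos_butterfly[OF butterfly[of ?i]] by simp
  finally show ?thesis by (simp add: \<phi>_def)
qed

text \<open>Repeated use of \<open>arccos_three_lines\<close> bounds the first \<open>n - 1\<close>
  angles by the angle from \<open>L 0\<close> to \<open>L (n - 1)\<close>. As \<open>n\<close> is
  odd, \<open>L n = - L 0\<close>, so the last angle is the supplement of that one.\<close>

theorem sum_\<phi>: "(\<Sum>i<n. \<phi> i) \<le> pi"
proof -
  have part: "(\<Sum>j<k. \<phi> (j * m)) \<le> arccos (lor (L 0) (L k))" if "1 \<le> k" "k < n" for k
    using that
  proof (induction k rule: dec_induct)
    case base
    then show ?case using L_consecutive[of 0] by simp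
  next
    case (step k)
    have "arccos (lor (L 0) (L k)) + arccos (lor (L k) (L (Suc k))) \<le> arccos (lor (L 0) (L (Suc k)))"
      by (rule arccos_three_lines[where \<sigma> = \<sigma>]) (use step in \<open>auto intro: L_cross simp: L_unit\<close>)
    then show ?case using step L_consecutive[of k] by simp
  qed
  have n1: "n - 1 + 1 = n" using n3 by simp
  have "L n = - L 0"
  proof -
    have "n * m = 0 + m * n" by simp
    then have "M (n * m) = M 0" using M_add_mult by metis
    then show ?thesis by (simp add: L_def) (simp add: nm)
  qed
  then have last: "\<phi> ((n - 1) * m) = arccos (- lor (L 0) (L (n - 1)))"
    using L_consecutive[of "n - 1"] unfolding n1 by (simp add: lor_commute)
  have b: "\<bar>lor (L 0) (L (n - 1))\<bar> \<le> 1"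
  proof -
    let ?X = "lcross (L 0) (L (n - 1))"
    have "\<sigma> *\<^sub>R ?X \<in> future" using n3 by (intro L_cross) auto
    then have "(\<sigma> * \<sigma>) * lor ?X ?X < 0" by (simp add: future_def mult.assoc del: lor_lcross)
    then have "(lor (L 0) (L (n - 1)))\<^sup>2 < 1" unfolding \<sigma> lor_lcross_lcross L_unit lor_commute[of "L (n - 1)" "L 0"]
      by (simp add: power2_eq_square)
    then show ?thesis by (simp add: abs_square_less_1 less_imp_le)
  qed
  have "(\<Sum>j<n. \<phi> (j * m)) = (\<Sum>j<n - 1. \<phi> (j * m)) + \<phi> ((n - 1) * m)"
    using n3 sum.lessThan_Suc[of "\<lambda>j. \<phi> (j * m)" "n - 1"] by simp
  also have "\<dots> \<le> pi" using part[of "n - 1"] n3 b unfolding last by (simp add: arccos_minus abs_le_iff)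
  finally have "(\<Sum>j<n. \<phi> (j * m)) \<le> pi" .
  moreover have "(\<Sum>j<n. \<phi> (j * m)) = (\<Sum>i<n. \<phi> i)"
    by (rule sum_mult_reindex[OF _ nm]) (simp add: \<phi>_def S_mod)
  ultimately show ?thesis by simp
qed

end

text \<open>\<open>cos \<phi>\<close> for a butterfly as a function of \<open>S = sin \<psi>\<close>, and the rate at which \<open>\<phi>\<close> decreases with \<open>\<psi>\<close>.\<close>

definition butterfly_cos :: "real \<Rightarrow> real \<Rightarrow> real" where
  "butterfly_cos C S = S * (C + S) / (1 + C * S)"

definition butterfly_slope :: "real \<Rightarrow> real \<Rightarrow> real" where
  "butterfly_slope C S = (C + 2 * S + C * S\<^sup>2) / ((1 + C * S) * sqrt (1 + 2 * C * S + S\<^sup>2))"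

section \<open>Convexity of the angle of a butterfly\<close>

lemma butterfly_slope_pos: "C > 1 \<Longrightarrow> 0 \<le> S \<Longrightarrow> butterfly_slope C S > 0"
  unfolding butterfly_slope_def
  by (intro divide_pos_pos mult_pos_pos) (auto intro!: add_pos_nonneg)

text \<open>A falling rate of decrease is the convexity of \<phi> as a function of \<psi>; it
  follows from the sign of the derivative.\<close>

lemma butterfly_slope_strict_antimono:
  assumes C: "C > 1" and S: "0 \<le> S" "S < S'" "S' \<le> 1"
  shows "butterfly_slope C S' < butterfly_slope C S"
proof (rule DERIV_neg_imp_decreasing[OF S(2)])
  fix x assume "S \<le> x" "x \<le> S'"
  then have x: "0 \<le> x" "x \<le> 1" using S by auto
  define A B D W where "A = 1 + 2 * C * x + x\<^sup>2" and "B = 1 + C * x" and "D = C + 2 * x + C * x\<^sup>2" and "W = sqrt A"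
  have A: "A > 0" and B: "B > 0" using C x by (auto simp: A_def B_def intro!: add_pos_nonneg)
  have W: "W > 0" "W * W = A" using A by (simp_all add: W_def)
  have dW: "((\<lambda>S. sqrt (1 + 2 * C * S + S\<^sup>2)) has_real_derivative (C + x) / W) (at x)"
    using A unfolding W_def A_def by (auto intro!: derivative_eq_intros simp: field_simps)
  have dD: "((\<lambda>S. C + 2 * S + C * S\<^sup>2) has_real_derivative 2 * B) (at x)"
    unfolding B_def by (auto intro!: derivative_eq_intros simp: algebra_simps)
  have dB: "((\<lambda>S. 1 + C * S) has_real_derivative C) (at x)" by (auto intro!: derivative_eq_intros)
  have d: "(butterfly_slope C has_real_derivative ((2 * B) * (B * W) - D * (C * W + ((C + x) / W) * B)) / ((B * W) * (B * W))) (at x)"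
    unfolding butterfly_slope_def[abs_def] B_def D_def W_def A_def
    using DERIV_divide[OF dD DERIV_mult[OF dB dW]] A B W unfolding B_def W_def A_def by auto
  have num: "(2 * B) * (B * W) - D * (C * W + ((C + x) / W) * B) = (A * (2 * B\<^sup>2 - C * D) - D * B * (C + x)) / W"
  proof -
    have "((2 * B) * (B * W) - D * (C * W + ((C + x) / W) * B)) * W = (W * W) * (2 * B\<^sup>2 - C * D) - D * B * (C + x)"
      using W(1) by (simp add: field_simps power2_eq_square)
    then show ?thesis using W by (simp add: eq_divide_eq)
  qed
  \<comment> \<open>The numerator of the derivative factors; \<open>C > 1\<close> makes the first
    factor positive and \<open>x \<le> 1\<close> the second.\<close>
  have "A * (2 * B\<^sup>2 - C * D) - D * B * (C + x) = - ((C\<^sup>2 - 1) * (2 + C * x * (3 - x\<^sup>2)))"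
    unfolding A_def B_def D_def by (simp add: power2_eq_square algebra_simps)
  also have "\<dots> < 0"
  proof -
    have "x\<^sup>2 \<le> 1" using x by (simp add: power_le_one)
    then have "0 < 2 + C * x * (3 - x\<^sup>2)" using C x by (intro add_pos_nonneg mult_nonneg_nonneg) auto
    moreover have "C\<^sup>2 - 1 > 0" using C by (simp add: one_less_power)
    ultimately show ?thesis by simp
  qed
  finally have "((2 * B) * (B * W) - D * (C * W + ((C + x) / W) * B)) / ((B * W) * (B * W)) < 0"
    unfolding num using W B by (simp add: divide_neg_pos)
  then show "\<exists>y. (butterfly_slope C has_real_derivative y) (at x) \<and> y < 0" using d by blast
qed

lemma arccos_butterfly_cos_deriv:
  assumes C: "C > 1" and x: "0 < x" "x < pi / 2"
  shows "((\<lambda>x. arccos (butterfly_cos C (sin x))) has_real_derivative - butterfly_slope C (sin x)) (at x)"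
proof -
  define S where "S = sin x"
  have S: "0 < S" "S < 1" using x sin_gt_zero[of x] sin_monotone_2pi[of x "pi / 2"] by (auto simp: S_def)
  have c: "cos x > 0" using x by (intro cos_gt_zero) auto
  have cS: "cos x = sqrt (1 - S\<^sup>2)" unfolding S_def using c by (simp add: cos_squared_eq[symmetric])
  define A B where "A = 1 + 2 * C * S + S\<^sup>2" and "B = 1 + C * S"
  have A: "A > 0" and B: "B > 0" using C S by (auto simp: A_def B_def intro!: add_pos_nonneg)
  have S2: "1 - S\<^sup>2 > 0" using S by (simp add: abs_square_less_1)
  have m: "1 - butterfly_cos C S = (1 - S\<^sup>2) / B" using B unfolding butterfly_cos_def B_def by (simp add: field_simps power2_eq_square)
  have p: "1 + butterfly_cos C S = A / B" using B unfolding butterfly_cos_def B_def A_def by (simp add: field_simps power2_eq_square)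
  have b: "-1 < butterfly_cos C S" "butterfly_cos C S < 1" using m p A B S2 by (smt (verit) divide_pos_pos)+
  have sq: "sqrt (1 - (butterfly_cos C S)\<^sup>2) = cos x * sqrt A / B"
  proof -
    have "1 - (butterfly_cos C S)\<^sup>2 = (1 - butterfly_cos C S) * (1 + butterfly_cos C S)" by (simp add: power2_eq_square algebra_simps)
    also have "\<dots> = (1 - S\<^sup>2) * A / (B * B)" unfolding m p by simp
    finally show ?thesis using B by (simp add: cS real_sqrt_divide real_sqrt_mult)
  qed
  have "((\<lambda>S. S * (C + S) / (1 + C * S)) has_real_derivative ((C + 2 * S) * B - S * (C + S) * C) / (B * B)) (at S)"
    using B unfolding B_def by (auto intro!: derivative_eq_intros simp: algebra_simps)
  then have db: "(butterfly_cos C has_real_derivative (C + 2 * S + C * S\<^sup>2) / (B * B)) (at S)"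
    unfolding butterfly_cos_def[abs_def] by (rule DERIV_cong) (simp add: B_def power2_eq_square algebra_simps)
  have "((\<lambda>x. butterfly_cos C (sin x)) has_real_derivative (C + 2 * S + C * S\<^sup>2) / (B * B) * cos x) (at x)"
    using DERIV_chain2[OF db[unfolded S_def] DERIV_sin] by (simp add: S_def)
  then have "((\<lambda>x. arccos (butterfly_cos C (sin x))) has_real_derivative
      inverse (- sqrt (1 - (butterfly_cos C (sin x))\<^sup>2)) * ((C + 2 * S + C * S\<^sup>2) / (B * B) * cos x)) (at x)"
    by (intro DERIV_chain2[OF DERIV_arccos]) (use b in \<open>auto simp: S_def\<close>)
  moreover have "inverse (- sqrt (1 - (butterfly_cos C (sin x))\<^sup>2)) * ((C + 2 * S + C * S\<^sup>2) / (B * B) * cos x) = - butterfly_slope C (sin x)"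
    unfolding S_def[symmetric] sq butterfly_slope_def B_def[symmetric] A_def[symmetric] using c A B by (simp add: field_simps)
  ultimately show ?thesis by simp
qed

text \<open>A strictly convex function lies above its tangents: the mean value theorem gives a slope
  at an intermediate point, which is compared with the slope at \<open>y\<close>.\<close>

lemma arccos_butterfly_cos_tangent:
  assumes C: "C > 1" and x: "0 < x" "x < pi / 2" and y: "0 < y" "y < pi / 2" and xy: "x \<noteq> y"
  shows "arccos (butterfly_cos C (sin y)) - butterfly_slope C (sin y) * (x - y) < arccos (butterfly_cos C (sin x))"
proof -
  let ?F = "\<lambda>x. arccos (butterfly_cos C (sin x))"
  have slope: "butterfly_slope C (sin b) < butterfly_slope C (sin a)" if "0 < a" "a < b" "b < pi / 2" for a b
    using that by (intro butterfly_slope_strict_antimono[OF C] sin_ge_zero sin_monotone_2pi sin_le_one) auto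
  consider "x < y" | "y < x" using xy by linarith
  then show ?thesis
  proof cases
    case 1
    obtain z where z: "x < z" "z < y" "?F y - ?F x = (y - x) * (- butterfly_slope C (sin z))"
      using MVT2[OF 1, of ?F "\<lambda>x. - butterfly_slope C (sin x)"] arccos_butterfly_cos_deriv[OF C] x y by auto
    have "(y - x) * butterfly_slope C (sin y) < (y - x) * butterfly_slope C (sin z)"
      using slope[of z y] z x y by (intro mult_strict_left_mono) auto
    then show ?thesis using z(3) by (simp add: algebra_simps)
  next
    case 2
    obtain z where z: "y < z" "z < x" "?F x - ?F y = (x - y) * (- butterfly_slope C (sin z))"
      using MVT2[OF 2, of ?F "\<lambda>x. - butterfly_slope C (sin x)"] arccos_butterfly_cos_deriv[OF C] x y by auto
    have "(x - y) * butterfly_slope C (sin z) < (x - y) * butterfly_slope C (sin y)"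
      using slope[of y z] z x y by (intro mult_strict_left_mono) auto
    then show ?thesis using z(3) by (simp add: algebra_simps)
  qed
qed

text \<open>Jensen's inequality by means of the tangent at \<open>arcsin t\<close>: summing the
  tangent inequalities leaves a positive multiple of the difference of the two sides of the claim,
  and a single term with \<open>S i \<noteq> t\<close> makes the sum strict.\<close>

lemma sum_arcsin_bound:
  fixes S :: "nat \<Rightarrow> real"
  assumes C: "C > 1" and S: "\<And>i. i < n \<Longrightarrow> 0 < S i \<and> S i < 1" and t: "0 < t" "t < 1"
    and le: "(\<Sum>i<n. arccos (butterfly_cos C (S i))) \<le> real n * arccos (butterfly_cos C t)"
  shows "real n * arcsin t \<le> (\<Sum>i<n. arcsin (S i))"
    and "(\<Sum>i<n. arcsin (S i)) = real n * arcsin t \<Longrightarrow> i < n \<Longrightarrow> S i = t"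
proof -
  have bd: "0 < arcsin x" "arcsin x < pi / 2" "sin (arcsin x) = x" if "0 < x" "x < 1" for x
    using that arcsin_less_arcsin[of 0 x] arcsin_lt_bounded[of x] by auto
  have tb: "butterfly_slope C t > 0" using butterfly_slope_pos[OF C] t by simp
  let ?G = "\<lambda>i. arccos (butterfly_cos C t) - butterfly_slope C t * (arcsin (S i) - arcsin t)"
  have lt: "?G i < arccos (butterfly_cos C (S i))" if "i < n" "S i \<noteq> t" for i
  proof -
    have "arcsin (S i) \<noteq> arcsin t" using that S[OF that(1)] t by (metis bd(3))
    then show ?thesis using arccos_butterfly_cos_tangent[OF C, of "arcsin (S i)" "arcsin t"] bd S[OF that(1)] t by simp
  qed
  have le1: "?G i \<le> arccos (butterfly_cos C (S i))" if "i < n" for i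
    using lt[OF that] by (cases "S i = t") auto
  have sG: "(\<Sum>i<n. ?G i) = real n * arccos (butterfly_cos C t) - butterfly_slope C t * ((\<Sum>i<n. arcsin (S i)) - real n * arcsin t)"
    by (simp add: sum_subtractf sum_distrib_left[symmetric])
  have "(\<Sum>i<n. ?G i) \<le> (\<Sum>i<n. arccos (butterfly_cos C (S i)))" by (intro sum_mono) (use le1 in auto)
  then have "0 \<le> butterfly_slope C t * ((\<Sum>i<n. arcsin (S i)) - real n * arcsin t)" using le sG by linarith
  then show "real n * arcsin t \<le> (\<Sum>i<n. arcsin (S i))" using tb by (simp add: zero_le_mult_iff)
  show "S i = t" if eq: "(\<Sum>i<n. arcsin (S i)) = real n * arcsin t" and i: "i < n"
  proof (rule ccontr)
    assume "S i \<noteq> t"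
    then have "(\<Sum>i<n. ?G i) < (\<Sum>i<n. arccos (butterfly_cos C (S i)))"
      using i lt le1 by (intro sum_strict_mono_ex1) auto
    then show False using le sG eq by simp
  qed
qed

lemma (in reduced_cycle) harea_reduced_bound:
  assumes t: "0 < t" "t < 1" "arccos (butterfly_cos C t) = pi / real n"
  shows "harea P \<le> (real n - 2) * pi - 2 * real n * arcsin t"
    and "harea P = (real n - 2) * pi - 2 * real n * arcsin t \<Longrightarrow> S i = t"
proof -
  have S: "0 < S i \<and> S i < 1" for i using butterfly.S0[OF butterfly] butterfly.S1[OF butterfly] by simp
  have le: "(\<Sum>i<n. arccos (butterfly_cos C (S i))) \<le> real n * arccos (butterfly_cos C t)"
    using sum_\<phi> n3 unfolding t by (simp add: \<phi>_def butterfly_cos_def)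
  show "harea P \<le> (real n - 2) * pi - 2 * real n * arcsin t"
    using sum_arcsin_bound(1)[OF C S t(1,2) le] unfolding harea_reduced by simp
  assume "harea P = (real n - 2) * pi - 2 * real n * arcsin t"
  then have "(\<Sum>i<n. arcsin (S i)) = real n * arcsin t" unfolding harea_reduced by simp
  then have "S (i mod n) = t" using sum_arcsin_bound(2)[OF C S t(1,2) le, of "i mod n"] n3 by simp
  then show "S i = t" by (simp add: S_mod)
qed

section \<open>From the definitions in the disc to the hyperboloid\<close>

lemma hmetric_tform:
  assumes "p \<in> hplane"
  shows "tform (lift p) (hl a) (hl b) = (1 - p \<bullet> p) * hmetric p (a - p) (b - p)"
proof -
  have w: "1 - p \<bullet> p > 0" using assms by (simp add: hplane_iff)
  then have "1 / sqrt (1 - p \<bullet> p) * (1 / sqrt (1 - p \<bullet> p)) = 1 / (1 - p \<bullet> p)" by simp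
  moreover have "tform (lift p) (hl a) (hl b) = (a \<bullet> b - 1) + (1 / sqrt (1 - p \<bullet> p) * (1 / sqrt (1 - p \<bullet> p))) * ((p \<bullet> a - 1) * (p \<bullet> b - 1))"
    unfolding tform_def lift_def by (simp add: lor_hl)
  ultimately have 1: "tform (lift p) (hl a) (hl b) = (a \<bullet> b - 1) + (p \<bullet> a - 1) * (p \<bullet> b - 1) / (1 - p \<bullet> p)" by simp
  have "(1 - p \<bullet> p) * hmetric p (a - p) (b - p) = (a - p) \<bullet> (b - p) + (p \<bullet> (a - p)) * (p \<bullet> (b - p)) / (1 - p \<bullet> p)"
    unfolding hmetric_def using w by (simp add: distrib_left power2_eq_square)
  also have "\<dots> = ((a - p) \<bullet> (b - p) * (1 - p \<bullet> p) + (p \<bullet> (a - p)) * (p \<bullet> (b - p))) / (1 - p \<bullet> p)"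
    using w by (simp add: add_divide_distrib)
  also have "(a - p) \<bullet> (b - p) * (1 - p \<bullet> p) + (p \<bullet> (a - p)) * (p \<bullet> (b - p)) = (a \<bullet> b - 1) * (1 - p \<bullet> p) + (p \<bullet> a - 1) * (p \<bullet> b - 1)"
    by (simp add: inner_diff_left inner_diff_right inner_commute algebra_simps)
  also have "\<dots> / (1 - p \<bullet> p) = (a \<bullet> b - 1) + (p \<bullet> a - 1) * (p \<bullet> b - 1) / (1 - p \<bullet> p)"
    using w by (simp add: add_divide_distrib)
  finally show ?thesis using 1 by simp
qed

lemma hangle_ang:
  assumes "p \<in> hplane" "a \<in> hplane" "b \<in> hplane"
  shows "hangle a p b = ang (lift p) (lift a) (lift b)"
proof -
  have w: "1 - p \<bullet> p > 0" using assms by (simp add: hplane_iff)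
  have sq: "sqrt ((1 - p \<bullet> p) * x * ((1 - p \<bullet> p) * y)) = (1 - p \<bullet> p) * sqrt (x * y)" for x y
  proof -
    have "(1 - p \<bullet> p) * x * ((1 - p \<bullet> p) * y) = (1 - p \<bullet> p)\<^sup>2 * (x * y)" by (simp add: power2_eq_square)
    then show ?thesis using w by (simp only: real_sqrt_mult real_sqrt_abs)
  qed
  have "hangle a p b = ang (lift p) (hl a) (hl b)"
    unfolding hangle_def ang_def hmetric_tform[OF assms(1)] sq using w by simp
  then show ?thesis by (simp add: ang_hl_lift assms)
qed

lemma lift_segment:
  assumes "a \<in> hplane" "b \<in> hplane" "q = (1 - t) *\<^sub>R a + t *\<^sub>R b" "0 \<le> t" "t \<le> 1"
  shows "\<exists>\<alpha> \<beta>. lift q = \<alpha> *\<^sub>R lift a + \<beta> *\<^sub>R lift b \<and> (0 < t \<and> t < 1 \<longrightarrow> \<alpha> > 0 \<and> \<beta> > 0)"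
proof -
  have "q \<in> closed_segment a b" using assms by (auto simp: in_segment)
  then have q: "q \<in> hplane" using segment_hplane assms by blast
  define k ka kb where "k = 1 / sqrt (1 - q \<bullet> q)" and "ka = sqrt (1 - a \<bullet> a)" and "kb = sqrt (1 - b \<bullet> b)"
  have pos: "k > 0" "ka > 0" "kb > 0" using q assms by (simp_all add: k_def ka_def kb_def hplane_iff)
  have ha: "hl a = ka *\<^sub>R lift a" "hl b = kb *\<^sub>R lift b" using hl_lift assms by (simp_all add: ka_def kb_def)
  have "lift q = k *\<^sub>R ((1 - t) *\<^sub>R hl a + t *\<^sub>R hl b)"
    by (simp add: lift_def k_def assms(3) hl_affine)
  also have "\<dots> = (k * (1 - t) * ka) *\<^sub>R lift a + (k * t * kb) *\<^sub>R lift b"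
    by (simp add: ha scaleR_add_right mult.assoc)
  finally show ?thesis using pos by (intro exI conjI) auto
qed

lemma hsetdist_point:
  assumes "p \<in> B" "\<And>q. q \<in> B \<Longrightarrow> hdist v p \<le> hdist v q"
  shows "hsetdist {v} B = hdist v p"
  unfolding hsetdist_def by (rule cInf_eq_minimum) (use assms in auto)

text \<open>The projection condition says that \<open>lift v - cosh w *\<^sub>R lift p\<close> is
  normal to the line of the side. As \<open>p\<close> lies on the side, it is also the nearest point
  of the side, which identifies its distance with \<open>w\<close>.\<close>

lemma height_foot:
  assumes v: "v \<in> hplane" and a: "a \<in> hplane" and b: "b \<in> hplane" and ab: "a \<noteq> b"
    and p: "is_hprojection (hline_through a b) v p" "p \<in> rel_interior (closed_segment a b)"
    and d: "hsetdist {v} (closed_segment a b) = w" and w: "w > 0"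
  shows "lift p \<in> H2" "\<exists>\<alpha> \<beta>. \<alpha> > 0 \<and> \<beta> > 0 \<and> lift p = \<alpha> *\<^sub>R lift a + \<beta> *\<^sub>R lift b"
    "lor (lift v) (lift p) = - cosh w"
    "lor (lift v - cosh w *\<^sub>R lift p) (lift a) = 0" "lor (lift v - cosh w *\<^sub>R lift p) (lift b) = 0"
proof -
  have "p \<in> open_segment a b" using p(2) ab by (simp add: rel_interior_closed_segment)
  then obtain t where t: "0 < t" "t < 1" "p = (1 - t) *\<^sub>R a + t *\<^sub>R b" by (auto simp: in_segment)
  have pseg: "p \<in> closed_segment a b" using \<open>p \<in> open_segment a b\<close> open_closed_segment by blast
  then have ph: "p \<in> hplane" using segment_hplane a b by blast
  then show T: "lift p \<in> H2" by simp
  show comb: "\<exists>\<alpha> \<beta>. \<alpha> > 0 \<and> \<beta> > 0 \<and> lift p = \<alpha> *\<^sub>R lift a + \<beta> *\<^sub>R lift b"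
    using lift_segment[OF a b t(3)] t by auto
  define D where "D = - lor (lift v) (lift p)"
  have perp: "lor (lift v - D *\<^sub>R lift p) (lift q) = 0" if q: "q \<in> hplane" "q \<in> hline_through a b" for q
  proof -
    have "hmetric p (v - p) (q - p) = 0" using p(1) q by (simp add: is_hprojection_def)
    then have "tform (lift p) (hl v) (hl q) = 0" using hmetric_tform[OF ph] by simp
    then have "sqrt (1 - v \<bullet> v) * (sqrt (1 - q \<bullet> q) * tform (lift p) (lift v) (lift q)) = 0"
      unfolding hl_lift[OF v] hl_lift[OF q(1)] by auto
    then have "tform (lift p) (lift v) (lift q) = 0" using v q by (auto simp: hplane_iff)
    then show ?thesis by (simp add: tform_def D_def lor_commute[of "lift p" "lift v"])
  qed
  have la: "a \<in> hline_through a b" "b \<in> hline_through a b"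
    using a b by (auto simp: hline_through_def hull_inc)
  note pa = perp[OF a la(1)] and pb = perp[OF b la(2)]
  have D1: "D \<ge> 1" using reverse_cauchy[of "lift v" "lift p"] v ph by (simp add: D_def)
  have "hdist v p \<le> hdist v q" if q: "q \<in> closed_segment a b" for q
  proof -
    have qh: "q \<in> hplane" using q segment_hplane a b by blast
    obtain \<tau> where "q = (1 - \<tau>) *\<^sub>R a + \<tau> *\<^sub>R b" "0 \<le> \<tau>" "\<tau> \<le> 1" using q by (auto simp: in_segment)
    then obtain \<alpha> \<beta> where "lift q = \<alpha> *\<^sub>R lift a + \<beta> *\<^sub>R lift b" using lift_segment[OF a b] by metis
    then have "lor (lift v - D *\<^sub>R lift p) (lift q) = \<alpha> * lor (lift v - D *\<^sub>R lift p) (lift a) + \<beta> * lor (lift v - D *\<^sub>R lift p) (lift b)"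
      by (simp only: lor_simps(2,6))
    \<comment> \<open>The hyperbolic theorem of Pythagoras: cosh of the hypotenuse is the product of
      the values of cosh at the legs.\<close>
    then have "lor (lift v) (lift q) = D * lor (lift p) (lift q)" unfolding pa pb by simp
    moreover have "D * lor (lift p) (lift q) \<le> D * (-1)"
      using reverse_cauchy[of "lift p" "lift q"] ph qh D1 by (intro mult_left_mono) auto
    ultimately have "D \<le> - lor (lift v) (lift q)" by simp
    then have "cosh (hdist v p) \<le> cosh (hdist v q)" using cosh_hdist v ph qh by (simp add: D_def)
    then show ?thesis using hdist_nonneg v ph qh by (simp add: cosh_real_nonneg_le_iff)
  qed
  then have "w = hdist v p" using hsetdist_point[OF pseg, of v] d by simp
  then have D: "D = cosh w" using cosh_hdist[OF v ph] by (simp add: D_def)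
  show "lor (lift v) (lift p) = - cosh w" using D by (simp add: D_def)
  show "lor (lift v - cosh w *\<^sub>R lift p) (lift a) = 0" "lor (lift v - cosh w *\<^sub>R lift p) (lift b) = 0"
    using pa pb unfolding D .
qed

lemma (in convex_cycle) u_inj: "inj_on u {..<n}"
proof (rule inj_onI)
  have *: "u i \<noteq> u j" if ij: "i < j" "j < n" for i j
  proof
    assume eq: "u i = u j"
    show False
    proof (cases "j - i + 1 < n")
      case True
      then show False using orient[of "j - i" "j - i + 1" i] ij eq by simp
    next
      case False
      then have "i + (n - 1) = j" using ij by simp
      moreover have "1 < n - 1" "n - 1 < n" using n3 by auto
      then have "0 < \<sigma> * ldet (V i) (V (i + 1)) (V (i + (n - 1)))" by (intro orient) auto
      ultimately show False using eq by simp
    qed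
  qed
  fix i j assume "i \<in> {..<n}" "j \<in> {..<n}" "u i = u j"
  then show "i = j" using *[of i j] *[of j i] by (cases i j rule: linorder_cases) auto
qed

lemma ordinary_reduced_cycle:
  assumes R: "ordinary_reduced n w R" and w: "w > 0" and n3: "n \<ge> 3"
  obtains u \<sigma> T where "reduced_cycle n u \<sigma> R ((n - 1) div 2) (cosh w) (sinh w) T"
proof -
  define m where "m = (n - 1) div 2"
  have "odd n" and ng: "hngon n R" using R by (auto simp: ordinary_reduced_def)
  then have nm: "n = 2 * m + 1" by (auto simp: m_def elim: oddE)
  then have m': "(n + 1) div 2 = m + 1" by simp
  obtain v where cv: "cyclic_vertices n v R" and ht: "\<And>i. i < n \<Longrightarrow>
      hsetdist {v i} (closed_segment (v ((i + m) mod n)) (v ((i + (m + 1)) mod n))) = w \<and>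
      (\<exists>p. is_hprojection (hline_through (v ((i + m) mod n)) (v ((i + (m + 1)) mod n))) (v i) p \<and>
         p \<in> rel_interior (closed_segment (v ((i + m) mod n)) (v ((i + (m + 1)) mod n))))"
    using R unfolding ordinary_reduced_def Let_def m_def[symmetric] m' by auto
  obtain \<sigma> where cc: "convex_cycle n (\<lambda>i. v (i mod n)) \<sigma> R" using polygon_orientation[OF n3 ng cv] .
  define u where "u = (\<lambda>i. v (i mod n))"
  have vu: "v (i mod n) = u i" for i by (simp add: u_def)
  interpret convex_cycle n u \<sigma> R using cc unfolding u_def .
  define Q where "Q i p \<longleftrightarrow> lift p \<in> H2 \<and>
     (\<exists>\<alpha> \<beta>. \<alpha> > 0 \<and> \<beta> > 0 \<and> lift p = \<alpha> *\<^sub>R V (i + m) + \<beta> *\<^sub>R V (i + m + 1)) \<and>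
     lor (V i) (lift p) = - cosh w \<and> lor (V i - cosh w *\<^sub>R lift p) (V (i + m)) = 0 \<and>
     lor (V i - cosh w *\<^sub>R lift p) (V (i + m + 1)) = 0" for i p
  have exQ: "\<exists>p. Q i p" if i: "i < n" for i
  proof -
    have vi: "v i = u i" using i by (simp add: u_def)
    have ne: "u (i + m) \<noteq> u (i + m + 1)"
    proof
      assume "u (i + m) = u (i + m + 1)"
      then have "u ((i + m) mod n) = u ((i + m + 1) mod n)" by (simp only: periodic)
      then have "(i + m) mod n = (i + m + 1) mod n" using u_inj n3 by (auto simp: inj_on_def)
      then show False using add_mod_eq_imp_eq[of "i + m" 0 n 1] n3 by auto
    qed
    obtain p where p: "is_hprojection (hline_through (u (i + m)) (u (i + m + 1))) (u i) p"
       "p \<in> rel_interior (closed_segment (u (i + m)) (u (i + m + 1)))"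
      and d: "hsetdist {u i} (closed_segment (u (i + m)) (u (i + m + 1))) = w"
      using ht[OF i] unfolding vi vu add.assoc[symmetric] by blast
    show ?thesis unfolding Q_def using height_foot[OF hu hu hu ne p d w] by (intro exI[of _ p]) auto
  qed
  \<comment> \<open>The foot is chosen for the residue of \<open>i\<close>, which makes the family
    periodic.\<close>
  define p where "p i = (SOME p. Q (i mod n) p)" for i
  have V_mod': "V (i mod n + k) = V (i + k)" for i k
    by (rule V_mod) (simp add: mod_add_left_eq)
  have "Q (i mod n) (p i)" for i unfolding p_def by (rule someI_ex[OF exQ]) (use n3 in simp)
  then have p: "Q i (p i)" for i unfolding Q_def add.assoc V_mod' periodic .
  have p_periodic: "p (i + n) = p i" for i by (simp add: p_def)
  have "reduced_cycle n u \<sigma> R m (cosh w) (sinh w) (\<lambda>i. lift (p i))"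
  proof
    show "cosh w > 1" using w cosh_real_nonneg_less_iff[of 0 w] by simp
    show "sinh w > 0" using w by simp
    show "(sinh w)\<^sup>2 = (cosh w)\<^sup>2 - 1" by (simp add: cosh_square_eq)
  qed (use p p_periodic nm in \<open>auto simp: Q_def\<close>)
  then show ?thesis using that unfolding m_def by blast
qed

subsection \<open>Regular polygons\<close>

text \<open>The difference is orthogonal to the timelike vector \<open>X + Y\<close>, so it would be
  spacelike if it were not 0, but its square is 0.\<close>

lemma H2_eqI: assumes "X \<in> H2" "Y \<in> H2" "lor X Y = -1" shows "X = Y"
proof (rule ccontr)
  assume "X \<noteq> Y"
  moreover have "X + Y \<in> future" using assms H2_future future_add by blast
  moreover have "lor (X + Y) (X - Y) = 0" using assms by (simp add: H2_self lor_commute[of Y X])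
  ultimately have "lor (X - Y) (X - Y) > 0" using orthogonal_timelike_spacelike[of "X + Y" "X - Y"] by simp
  then show False using assms by (simp add: H2_self lor_commute[of Y X])
qed

section \<open>Regular polygons centred at the origin\<close>

definition std_vertex :: "nat \<Rightarrow> real \<Rightarrow> nat \<Rightarrow> real^2" where
  "std_vertex n r k = vector [r * cos (2 * pi * real k / real n), r * sin (2 * pi * real k / real n)]"

text \<open>\<open>r\<close> is the Euclidean circumradius in the disc, not the hyperbolic
  one.\<close>

definition std_polygon :: "nat \<Rightarrow> real \<Rightarrow> (real^2) set" where
  "std_polygon n r = convex hull (std_vertex n r ` {..<n})"

lemma std_vertex_nth [simp]:
  "std_vertex n r k $ 1 = r * cos (2 * pi * real k / real n)" "std_vertex n r k $ 2 = r * sin (2 * pi * real k / real n)"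
  by (simp_all add: std_vertex_def)

lemma inner_std_vertex: "std_vertex n r j \<bullet> std_vertex n r k = r\<^sup>2 * cos (2 * pi * (real k - real j) / real n)"
proof -
  have "2 * pi * (real k - real j) / real n = 2 * pi * real k / real n - 2 * pi * real j / real n"
    by (simp add: diff_divide_distrib algebra_simps)
  then show ?thesis by (simp only: cos_diff) (simp add: inner2 power2_eq_square algebra_simps)
qed

lemma std_vertex_hplane: assumes "0 < r" "r < 1" shows "std_vertex n r k \<in> hplane"
  using assms inner_std_vertex[of n r k k] by (simp add: hplane_iff power_less_one_iff)

lemma std_vertex_mod: "n > 0 \<Longrightarrow> std_vertex n r (k mod n) = std_vertex n r k"
proof -
  assume n: "n > 0"
  have "real k = real (k mod n) + real n * real (k div n)"
    by (metis mod_mult_div_eq of_nat_add of_nat_mult)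
  then have "2 * pi * real k / real n = 2 * pi * real (k mod n) / real n + 2 * pi * real (k div n)"
    using n by (simp add: field_simps)
  moreover have "cos (x + 2 * pi * real j) = cos x" "sin (x + 2 * pi * real j) = sin x" for x j
    using cos_int_2pin[of "int j"] sin_int_2pin[of "int j"] by (simp_all add: cos_add sin_add)
  ultimately show ?thesis by (simp add: vec_eq_iff forall_2)
qed

lemma std_vertex_int:
  assumes "n > 0"
  shows "\<exists>k<n. std_vertex n r k = vector [r * cos (2 * pi * real_of_int j / real n), r * sin (2 * pi * real_of_int j / real n)]"
proof -
  define l where "l = nat (j mod int n)"
  have l: "l < n" "int l = j mod int n" using assms by (auto simp: l_def nat_less_iff)
  define d where "d = j div int n"
  have "j = int l + int n * d" unfolding l(2) d_def by simp
  then have "real_of_int j = real_of_int (int l + int n * d)" by simp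
  then have e: "real_of_int j = real l + real n * real_of_int d" by simp
  have a: "2 * pi * real_of_int j / real n = 2 * pi * real l / real n + 2 * pi * real_of_int d"
    unfolding e using assms by (simp add: field_simps)
  show ?thesis using l(1) unfolding a cos_add sin_add cos_int_2pin sin_int_2pin
    by (intro exI[of _ l]) (simp add: std_vertex_def)
qed

text \<open>The left-hand side is twice the signed area of a triangle inscribed in the unit circle,
  by its central angles; the product form shows the sign.\<close>

lemma sin_triangle:
  fixes x y :: real
  shows "sin (2 * x) + sin (2 * (y - x)) - sin (2 * y) = 4 * (sin x * sin (y - x) * sin y)"
proof -
  have 1: "sin (2 * x) = 2 * sin x * cos x" "sin (2 * y) = 2 * sin y * cos y" "sin (2 * (y - x)) = 2 * sin (y - x) * cos (y - x)" by (rule sin_double)+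
  define a b c d where "a = sin x" and "b = cos x" and "c = sin y" and "d = cos y"
  have t: "a\<^sup>2 = 1 - b\<^sup>2" "c\<^sup>2 = 1 - d\<^sup>2" unfolding a_def b_def c_def d_def by (simp_all add: sin_squared_eq)
  have t': "a * a = 1 - b * b" "c * c = 1 - d * d" using t by (simp_all add: power2_eq_square)
  have "2 * a * b + 2 * (c * b - d * a) * (d * b + c * a) - 2 * c * d - 4 * (a * (c * b - d * a) * c)
    = 2 * a * b * (1 - d * d) + 2 * c * d * (b * b) + 2 * (c * c) * a * b - 2 * c * d * (a * a) - 2 * c * d - 4 * a * b * (c * c) + 4 * c * d * (a * a)"
    by (simp add: algebra_simps)
  also have "\<dots> = 0" unfolding t' by (simp add: algebra_simps)
  finally show ?thesis unfolding 1 sin_diff cos_diff a_def b_def c_def d_def by simp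
qed

lemma std_vertex_orient:
  assumes "0 < a" "a < b" "b < n" and r: "0 < r"
  shows "0 < ldet (hl (std_vertex n r i)) (hl (std_vertex n r (i + a))) (hl (std_vertex n r (i + b)))"
proof -
  define x where "x = (\<lambda>k. 2 * pi * real k / real n)"
  define A B where "A = pi * real a / real n" and "B = pi * real b / real n"
  have AB: "0 < A" "A < B" "B < pi" using assms
    by (auto simp: A_def B_def divide_strict_right_mono field_simps)
  have xa: "x (i + a) = x i + 2 * A" "x (i + b) = x i + 2 * B"
    by (simp_all add: x_def A_def B_def add_divide_distrib algebra_simps)
  have "ldet (hl (std_vertex n r i)) (hl (std_vertex n r (i + a))) (hl (std_vertex n r (i + b)))
    = r\<^sup>2 * (sin (x (i + a) - x i) + sin (x (i + b) - x (i + a)) - sin (x (i + b) - x i))"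
    by (simp add: ldet_def sin_diff x_def power2_eq_square algebra_simps)
  also have "\<dots> = r\<^sup>2 * (sin (2 * A) + sin (2 * (B - A)) - sin (2 * B))"
    unfolding xa by (simp add: right_diff_distrib)
  also have "\<dots> = r\<^sup>2 * (4 * (sin A * sin (B - A) * sin B))" unfolding sin_triangle ..
  also have "\<dots> > 0" using AB r by (intro mult_pos_pos sin_gt_zero) auto
  finally show ?thesis .
qed

lemma std_polygon_cycle:
  assumes "n \<ge> 3" "0 < r" "r < 1"
  shows "convex_cycle n (std_vertex n r) 1 (std_polygon n r)"
proof
  show "std_vertex n r (i mod n) = std_vertex n r i" for i using assms by (simp add: std_vertex_mod)
  show "0 < 1 * ldet (lift (std_vertex n r i)) (lift (std_vertex n r (i + a))) (lift (std_vertex n r (i + b)))"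
    if "0 < a" "a < b" "b < n" for i a b
    using std_vertex_orient[OF that assms(2), of i] ldet_lift_sign[of "std_vertex n r i" "std_vertex n r (i + a)" "std_vertex n r (i + b)" 1]
    by (simp add: std_vertex_hplane assms)
qed (use assms in \<open>auto simp: std_vertex_hplane std_polygon_def\<close>)

text \<open>The sine of half the angle of the regular polygon, and \<open>cosh\<close> of its height.\<close>

definition std_sin :: "nat \<Rightarrow> real \<Rightarrow> real" where
  "std_sin n r = cos (pi / real n) * sqrt (1 - r\<^sup>2) / sqrt (1 - r\<^sup>2 * (cos (pi / real n))\<^sup>2)"

definition std_cosh :: "nat \<Rightarrow> real \<Rightarrow> real" where
  "std_cosh n r = (1 + r\<^sup>2 * cos (pi / real n)) / (sqrt (1 - r\<^sup>2 * (cos (pi / real n))\<^sup>2) * sqrt (1 - r\<^sup>2))"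

lemma cos_pi_n: assumes "n \<ge> 3" shows "0 < cos (pi / real n)" "cos (pi / real n) < 1"
proof -
  have "pi / real n \<le> pi / 3" using assms by (intro divide_left_mono) auto
  then have x: "0 < pi / real n" "pi / real n < pi / 2" using assms pi_gt_zero by (simp, linarith)
  then show "0 < cos (pi / real n)" by (intro cos_gt_zero) auto
  show "cos (pi / real n) < 1" using cos_monotone_0_pi[of 0 "pi / real n"] x by simp
qed

text \<open>The third claim is the relation that a butterfly with angle \<pi> / n would satisfy, and
  it makes the regular polygon the extremal case. The fourth one gives the squared cosine of half
  the interior angle, in the form found by \<open>ang_center\<close>.\<close>

lemma std_sin_bounds:
  assumes n: "n \<ge> 3" and r: "0 < r" "r < 1"
  shows "0 < std_sin n r" "std_sin n r < 1" "butterfly_cos (std_cosh n r) (std_sin n r) = cos (pi / real n)"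
    "1 - (std_sin n r)\<^sup>2 = (1 - (cos (pi / real n))\<^sup>2) / (1 - r\<^sup>2 * (cos (pi / real n))\<^sup>2)"
proof -
  define k where "k = cos (pi / real n)"
  have k: "0 < k" "k < 1" using cos_pi_n[OF n] by (simp_all add: k_def)
  have k2: "k\<^sup>2 < 1" and r2: "r\<^sup>2 < 1" using k r by (simp_all add: power_less_one_iff)
  define a b where "a = sqrt (1 - r\<^sup>2)" and "b = sqrt (1 - r\<^sup>2 * k\<^sup>2)"
  have rk: "r\<^sup>2 * k\<^sup>2 < 1" using mult_strict_mono[OF r2 k2] by simp
  have ab: "a > 0" "b > 0" "a * a = 1 - r\<^sup>2" "b * b = 1 - r\<^sup>2 * k\<^sup>2" using r2 rk by (simp_all add: a_def b_def)
  have S: "std_sin n r = k * a / b" and C: "std_cosh n r = (1 + r\<^sup>2 * k) / (b * a)"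
    by (simp_all add: std_sin_def std_cosh_def k_def a_def b_def)
  show "0 < std_sin n r" unfolding S using k ab by simp
  have "(std_sin n r)\<^sup>2 = k\<^sup>2 * (1 - r\<^sup>2) / (1 - r\<^sup>2 * k\<^sup>2)"
    unfolding S power_divide power_mult_distrib power2_eq_square[of a] power2_eq_square[of b] ab ..
  then show e: "1 - (std_sin n r)\<^sup>2 = (1 - (cos (pi / real n))\<^sup>2) / (1 - r\<^sup>2 * (cos (pi / real n))\<^sup>2)"
    using rk unfolding k_def[symmetric] by (simp add: field_simps)
  have "1 - (std_sin n r)\<^sup>2 > 0" unfolding e k_def[symmetric] using k2 rk by simp
  then have "\<bar>std_sin n r\<bar> < 1" by (simp add: abs_square_less_1)
  then show "std_sin n r < 1" by simp
  have CS: "std_cosh n r * std_sin n r = k * (1 + r\<^sup>2 * k) / (b * b)"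
    unfolding S C using ab(1,2) by simp
  have d: "1 + std_cosh n r * std_sin n r = (1 + k) / (b * b)"
    unfolding CS unfolding ab(4) using rk by (simp add: field_simps power2_eq_square)
  have m: "std_sin n r * (std_cosh n r + std_sin n r) = k * (1 + k) / (b * b)"
  proof -
    have "std_sin n r * (std_cosh n r + std_sin n r) = (k * (1 + r\<^sup>2 * k) + k * k * (a * a)) / (b * b)"
      using CS by (simp add: distrib_left mult.commute[of "std_sin n r" "std_cosh n r"]) (simp add: S add_divide_distrib mult_ac)
    also have "\<dots> = k * (1 + k) / (b * b)" unfolding ab(3) by (simp add: power2_eq_square algebra_simps)
    finally show ?thesis .
  qed
  show "butterfly_cos (std_cosh n r) (std_sin n r) = cos (pi / real n)"
    unfolding butterfly_cos_def m d k_def[symmetric] using k ab(1,2) by simp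
qed

text \<open>With \<open>k\<close> the cosine of \<pi> / n, the hypothesis \<open>pq\<close> says
  that \<open>p\<close> and \<open>q\<close> are seen from the centre at the angle 2 \<pi> / n, and
  the value is half the interior angle of the polygon.\<close>

lemma ang_center:
  assumes p: "p \<bullet> p = r\<^sup>2" and q: "q \<bullet> q = r\<^sup>2" and r: "0 < r" "r < 1" and pq: "p \<bullet> q = r\<^sup>2 * (2 * k\<^sup>2 - 1)" and k: "k\<^sup>2 < 1"
  shows "ang (lift p) e3 (lift q) = arccos (sqrt ((1 - k\<^sup>2) / (1 - r\<^sup>2 * k\<^sup>2)))"
proof -
  have r2: "r\<^sup>2 < 1" using r by (simp add: power_less_one_iff)
  have h: "p \<in> hplane" "q \<in> hplane" using p q r2 by (simp_all add: hplane_iff)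
  define w where "w = 1 - r\<^sup>2"
  have w: "w > 0" using r2 by (simp add: w_def)
  have rk: "r\<^sup>2 * k\<^sup>2 < 1" using mult_strict_mono[OF r2 k] by simp
  have ww: "1 / sqrt w * (1 / sqrt w) = 1 / w" using w by simp
  have P: "lift p = (1 / sqrt w) *\<^sub>R hl p" by (simp add: lift_def p w_def)
  have 3: "lor (hl p) e3 = -1" by (simp add: lor_def)
  have t11: "tform (lift p) e3 e3 = r\<^sup>2 / w"
  proof -
    have "tform (lift p) e3 e3 = -1 + (1 / sqrt w * (1 / sqrt w))" unfolding tform_def P by (simp add: 3) (simp add: lor_def)
    then show ?thesis unfolding ww using w by (simp add: field_simps) (simp add: w_def)
  qed
  have t12: "tform (lift p) e3 (hl q) = r\<^sup>2 * (2 - 2 * k\<^sup>2) / w"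
  proof -
    have "tform (lift p) e3 (hl q) = -1 - (1 / sqrt w * (1 / sqrt w)) * (p \<bullet> q - 1)" unfolding tform_def P by (simp add: 3 lor_hl) (simp add: lor_def)
    then show ?thesis unfolding ww pq using w by (simp add: field_simps) (simp add: w_def algebra_simps)
  qed
  have t22: "tform (lift p) (hl q) (hl q) = r\<^sup>2 * (2 - 2 * k\<^sup>2) * (2 - 2 * r\<^sup>2 * k\<^sup>2) / w"
  proof -
    have "tform (lift p) (hl q) (hl q) = - w + (1 / sqrt w * (1 / sqrt w)) * (p \<bullet> q - 1)\<^sup>2"
      unfolding tform_def P by (simp add: lor_hl q w_def power2_eq_square)
    also have "\<dots> = ((p \<bullet> q - 1)\<^sup>2 - w * w) / w" unfolding ww using w by (simp add: field_simps)
    also have "(p \<bullet> q - 1)\<^sup>2 - w * w = r\<^sup>2 * (2 - 2 * k\<^sup>2) * (2 - 2 * r\<^sup>2 * k\<^sup>2)"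
      unfolding pq w_def by (simp add: power2_eq_square algebra_simps)
    finally show ?thesis .
  qed
  define x y where "x = 1 - k\<^sup>2" and "y = 1 - r\<^sup>2 * k\<^sup>2"
  have xy: "x > 0" "y > 0" using k rk by (simp_all add: x_def y_def)
  have "tform (lift p) e3 e3 * tform (lift p) (hl q) (hl q) = (r\<^sup>2 * 2 / w)\<^sup>2 * (x * y)"
  proof -
    have "2 - 2 * k\<^sup>2 = 2 * x" "2 - 2 * r\<^sup>2 * k\<^sup>2 = 2 * y" by (simp_all add: x_def y_def)
    then show ?thesis unfolding t11 t22 by (simp add: power2_eq_square)
  qed
  then have sq: "sqrt (tform (lift p) e3 e3 * tform (lift p) (hl q) (hl q)) = (r\<^sup>2 * 2 / w) * (sqrt x * sqrt y)"
    using w by (simp add: real_sqrt_mult del: power_divide)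
  have "tform (lift p) e3 (hl q) = (r\<^sup>2 * 2 / w) * x" unfolding t12 x_def by (simp add: algebra_simps)
  then have "ang (lift p) e3 (hl q) = arccos ((r\<^sup>2 * 2 / w * x) / ((r\<^sup>2 * 2 / w) * (sqrt x * sqrt y)))"
    unfolding ang_def sq by simp
  also have "(r\<^sup>2 * 2 / w * x) / ((r\<^sup>2 * 2 / w) * (sqrt x * sqrt y)) = x / (sqrt x * sqrt y)"
    using r(1) w by (intro mult_divide_mult_cancel_left) auto
  also have "x / (sqrt x * sqrt y) = sqrt (x / y)"
    using xy by (simp add: real_sqrt_divide) (metis real_div_sqrt less_imp_le divide_divide_eq_left)
  finally show ?thesis by (simp add: ang_hl_lift h x_def y_def)
qed

text \<open>The rays to the centre bisect the interior angles, so each of these is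
  \<open>2 * arcsin (std_sin n r)\<close>.\<close>

theorem harea_std_polygon:
  assumes n: "n \<ge> 3" and r: "0 < r" "r < 1"
  shows "harea (std_polygon n r) = (real n - 2) * pi - 2 * real n * arcsin (std_sin n r)"
proof -
  interpret convex_cycle n "std_vertex n r" 1 "std_polygon n r" by (rule std_polygon_cycle[OF assms])
  define k where "k = cos (pi / real n)"
  have k: "0 < k" "k < 1" using cos_pi_n[OF n] by (simp_all add: k_def)
  have k2: "k\<^sup>2 < 1" using k by (simp add: power_less_one_iff)
  have c2: "cos (2 * pi / real n) = 2 * k\<^sup>2 - 1" unfolding k_def using cos_double_cos[of "pi / real n"] by simp
  have s0: "0 < sin (2 * pi / real n)"
    using n by (intro sin_gt_zero) (auto simp: field_simps)
  have "ang (V i) (V (i + n - 1)) (V (i + 1)) = 2 * arcsin (std_sin n r)" for i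
  proof -
    define p where "p = std_vertex n r (i + n - 1)"
    have np: "std_vertex n r i = std_vertex n r (i + n - 1 + 1)" using std_vertex_mod[of n r "i + n"] std_vertex_mod[of n r i] n by simp
    have ip: "std_vertex n r i \<bullet> std_vertex n r i = r\<^sup>2" "p \<bullet> p = r\<^sup>2" "std_vertex n r (i + 1) \<bullet> std_vertex n r (i + 1) = r\<^sup>2"
      unfolding p_def inner_std_vertex by simp_all
    have in1: "std_vertex n r i \<bullet> std_vertex n r (i + 1) = r\<^sup>2 * (2 * k\<^sup>2 - 1)"
      unfolding inner_std_vertex c2[symmetric] by simp
    have in2: "std_vertex n r i \<bullet> p = r\<^sup>2 * (2 * k\<^sup>2 - 1)"
      unfolding np p_def inner_commute[of _ "std_vertex n r (i + n - 1)"] inner_std_vertex c2[symmetric] by simp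
    have half: "arccos (sqrt ((1 - k\<^sup>2) / (1 - r\<^sup>2 * k\<^sup>2))) = arcsin (std_sin n r)"
      using arccos_sqrt_arcsin[of "std_sin n r"] std_sin_bounds[OF n r] by (simp add: k_def)
    have cr: "0 < ldet (hl (std_vertex n r j)) (hl (std_vertex n r (j + 1))) e3" for j
    proof -
      define y where "y = 2 * pi * real j / real n"
      have y1: "2 * pi * real (j + 1) / real n = y + 2 * pi / real n" by (simp add: y_def add_divide_distrib algebra_simps)
      have "ldet (hl (std_vertex n r j)) (hl (std_vertex n r (j + 1))) e3 = r\<^sup>2 * sin (2 * pi * real (j + 1) / real n - y)"
        unfolding y_def by (simp only: sin_diff) (simp add: ldet_def power2_eq_square algebra_simps)
      then show ?thesis unfolding y1 using r s0 by simp
    qed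
    have e: "hl 0 = e3" by (simp add: vec_eq_iff forall_3)
    have h0: "(0::real^2) \<in> hplane" by (simp add: hplane_iff)
    have "ang (V i) (V (i + 1)) e3 + ang (V i) e3 (lift p) = ang (V i) (V (i + 1)) (lift p)"
    proof (rule ang_between[where \<sigma> = 1])
      show "0 < 1 * ldet (V i) (V (i + 1)) e3"
        using cr[of i] ldet_lift_sign[of "std_vertex n r i" "std_vertex n r (i + 1)" 0 1] hu h0 by (simp add: lift_0 e)
      have "0 < 1 * ldet (lift p) (V i) e3"
        using cr[of "i + n - 1"] ldet_lift_sign[of p "std_vertex n r i" 0 1] hu h0 unfolding p_def np[symmetric] by (simp add: lift_0 e)
      then show "0 < 1 * ldet (V i) e3 (lift p)" using ldet_rotate[of "lift p" "V i" e3] by simp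
      show "0 < 1 * ldet (V i) (V (i + 1)) (lift p)"
        using orient[of 1 "n - 1" i] n by (simp add: p_def)
    qed simp
    moreover have "ang (V i) e3 (V (i + 1)) = arcsin (std_sin n r)"
      using ang_center[OF ip(1,3) r in1 k2] half by simp
    moreover have "ang (V i) e3 (lift p) = arcsin (std_sin n r)"
      using ang_center[OF ip(1,2) r in2 k2] half by simp
    ultimately show ?thesis by (simp add: p_def ang_commute)
  qed
  then show ?thesis unfolding harea_polygon by simp
qed

text \<open>The radius can be recovered from the closed form of
  \<open>1 - (std_sin n r)\<^sup>2\<close>. Hence the area determines the polygon in the equality
  case.\<close>

lemma std_sin_inj:
  assumes n: "n \<ge> 3" and r: "0 < r" "r < 1" and r': "0 < r'" "r' < 1" and e: "std_sin n r = std_sin n r'"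
  shows "r = r'"
proof -
  define k where "k = cos (pi / real n)"
  have k: "0 < k" "k < 1" using cos_pi_n[OF n] by (simp_all add: k_def)
  have k2: "0 < k\<^sup>2" "k\<^sup>2 < 1" and r2: "r\<^sup>2 < 1" "r'\<^sup>2 < 1" using k r r' by (simp_all add: power_less_one_iff)
  have p: "1 - r\<^sup>2 * k\<^sup>2 > 0" "1 - r'\<^sup>2 * k\<^sup>2 > 0"
    using mult_strict_mono[OF r2(1) k2(2)] mult_strict_mono[OF r2(2) k2(2)] by simp_all
  have "(1 - k\<^sup>2) / (1 - r\<^sup>2 * k\<^sup>2) = (1 - k\<^sup>2) / (1 - r'\<^sup>2 * k\<^sup>2)"
    unfolding k_def std_sin_bounds(4)[OF n r, symmetric] std_sin_bounds(4)[OF n r', symmetric] e ..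
  then have "1 - r\<^sup>2 * k\<^sup>2 = 1 - r'\<^sup>2 * k\<^sup>2" using p k2(2)
    by (auto simp add: divide_eq_eq eq_divide_eq)
  then have "r\<^sup>2 * k\<^sup>2 = r'\<^sup>2 * k\<^sup>2" by simp
  then have "r\<^sup>2 = r'\<^sup>2" using k2 by (simp only: mult_right_cancel)
  then show ?thesis using r r' by simp
qed

text \<open>The vertices of an equilateral and equiangular polygon, up to Lorentz maps.\<close>

locale circulant =
  fixes n :: nat and W :: "nat \<Rightarrow> real^3" and g1 g2 \<tau> :: real
  assumes n3: "n \<ge> 3" and W_H2: "W i \<in> H2" and W_periodic: "W (i + n) = W i"
    and inj: "inj_on W {..<n}"
    and g1: "lor (W i) (W (i + 1)) = g1" and g2: "lor (W i) (W (i + 2)) = g2"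
    and or: "0 < \<tau> * ldet (W i) (W (i + 1)) (W (i + 2))"
begin

lemma g1_less: "g1 < -1"
proof -
  have "g1 \<noteq> -1"
  proof
    assume "g1 = -1"
    then have "W 0 = W 1" using g1[of 0] W_H2 H2_eqI by simp
    then show False using inj_onD[OF inj, of 0 1] n3 by simp
  qed
  then show ?thesis using reverse_cauchy[OF W_H2 W_H2] g1[of 0] by (metis less_eq_real_def)
qed

text \<open>The reflection in the perpendicular bisector of two consecutive points exchanges the points next to them.\<close>

lemma recurrence: "W (i + 3) = W i + ((g2 - g1) / (1 + g1)) *\<^sub>R (W (i + 2) - W (i + 1))"
proof -
  \<comment> \<open>The reflection formula with normal \<open>B - A\<close>: the coefficient is -2
    times \<open>lor (W i) (B - A)\<close> divided by \<open>lor (B - A) (B - A)\<close>, which is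
    \<open>- 2 * (1 + g1)\<close>.\<close>
  define k where "k = (g2 - g1) / (1 + g1)"
  define A B X Y where "A = W (i + 1)" and "B = W (i + 2)" and "X = W i + k *\<^sub>R (B - A)" and "Y = W (i + 3)"
  have k: "k * (1 + g1) = g2 - g1" using g1_less by (simp add: k_def)
  have AA: "lor A A = -1" "lor B B = -1" "lor (W i) (W i) = -1" "lor Y Y = -1" using W_H2 by (simp_all add: A_def B_def Y_def H2_self)
  have AB: "lor A B = g1" using g1[of "i + 1"] by (simp add: A_def B_def)
  then have BA: "lor B A = g1" using lor_commute[of A B] by simp
  have W0a: "lor (W i) A = g1" "lor (W i) B = g2" using g1[of i] g2[of i] by (simp_all add: A_def B_def)
  have W0: "lor (W i) A = g1" "lor (W i) B = g2" "lor A (W i) = g1" "lor B (W i) = g2"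
    using W0a lor_commute[of A "W i"] lor_commute[of B "W i"] by simp_all
  have YA: "lor A Y = g2" "lor B Y = g1" using g1[of "i + 2"] g2[of "i + 1"] by (simp_all add: A_def B_def Y_def eval_nat_numeral)
  have XA: "lor A X = g2" using k by (simp add: X_def AA AB BA W0 algebra_simps)
  have XB: "lor B X = g1" using k by (simp add: X_def AA AB BA W0 algebra_simps)
  have XX: "lor X X = -1"
  proof -
    have "lor X X = -1 + 2 * (k * (g2 - g1)) - 2 * (k * (k * (1 + g1)))"
      by (simp add: X_def AA AB BA W0 algebra_simps)
    then show ?thesis unfolding k by simp
  qed
  \<comment> \<open>\<open>X\<close> and \<open>Y\<close> have equal products with \<open>A\<close>,
    with \<open>B\<close> and with themselves; this determines the determinants up to sign, and the
    orientation fixes the sign.\<close>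
  have "(ldet A B X)\<^sup>2 = (ldet A B Y)\<^sup>2"
    unfolding ldet_square by (simp add: AA AB XA XB XX YA)
  moreover have "0 < \<tau> * ldet A B X"
  proof -
    have "ldet A B X = ldet (W i) A B" by (simp add: X_def ldet_rotate[of "W i" A B])
    then show ?thesis using or[of i] by (simp add: A_def B_def)
  qed
  moreover have "0 < \<tau> * ldet A B Y" using or[of "i + 1"] by (simp add: A_def B_def Y_def eval_nat_numeral)
  ultimately have "ldet A B X = ldet A B Y" by (auto simp: power2_eq_iff zero_less_mult_iff)
  then have dXY: "lor X (lcross A B) = lor Y (lcross A B)" by (simp add: lor_commute[of _ "lcross A B"])
  have "ldet A B (lcross A B) = g1\<^sup>2 - 1"
    unfolding lor_lcross[symmetric] lor_lcross_lcross by (simp add: AA AB BA power2_eq_square)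
  moreover have "g1\<^sup>2 \<noteq> 1" using g1_less by (auto simp: power2_eq_1_iff)
  ultimately have nd: "ldet A B (lcross A B) \<noteq> 0" by simp
  have "X = Y" by (rule lor_nondegenerate[OF nd _ _ dXY]) (use XA XB YA in \<open>simp_all add: lor_commute\<close>)
  then show ?thesis by (simp add: X_def Y_def A_def B_def k_def)
qed

text \<open>The coefficient of the recurrence does not depend on the index, so the products at
  offset \<open>d\<close> follow from those at smaller offsets in the same way for every
  \<open>i\<close>: the Gram matrix is circulant.\<close>

lemma gram: "lor (W i) (W (i + d)) = lor (W 0) (W d)"
proof (induction d rule: less_induct)
  case (less d)
  consider "d = 0" | "d = 1" | "d = 2" | "d \<ge> 3" by linarith
  then show ?case
  proof cases
    case 1 then show ?thesis using W_H2 by (simp add: H2_self)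
  next
    case 2 then show ?thesis using g1[of i] g1[of 0] by simp
  next
    case 3 then show ?thesis using g2[of i] g2[of 0] unfolding add_0 by simp
  next
    case 4
    then obtain e where e: "d = e + 3" by (metis add.commute le_Suc_ex)
    have "i + d = (i + e) + 3" by (simp add: e)
    then have "lor (W i) (W (i + d)) = lor (W i) (W (i + e)) + ((g2 - g1) / (1 + g1)) * (lor (W i) (W (i + (e + 2))) - lor (W i) (W (i + (e + 1))))"
      using recurrence[of "i + e"] by (simp add: add.assoc)
    also have "\<dots> = lor (W 0) (W e) + ((g2 - g1) / (1 + g1)) * (lor (W 0) (W (e + 2)) - lor (W 0) (W (e + 1)))"
      using less.IH[of e] less.IH[of "e + 2"] less.IH[of "e + 1"] e by simp
    also have "\<dots> = lor (W 0) (W d)" unfolding e recurrence[of e] by simp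
    finally show ?thesis .
  qed
qed

text \<open>The rows of a circulant Gram matrix have equal sums, so this vector has the same product
  with every point; scaled to the hyperboloid, it is the centre of a circle through all of
  them.\<close>

definition center :: "real^3" where "center = (\<Sum>j<n. W j)"

lemma W_center: "lor (W i) center = lor (W 0) center"
proof -
  have "lor (W i) center = (\<Sum>j<n. lor (W i) (W j))" by (simp add: center_def lor_sum_right)
  also have "\<dots> = (\<Sum>j<n. lor (W i) (W (j + i)))"
    using sum_periodic_shift[of "\<lambda>j. lor (W i) (W j)" n i] W_periodic by simp
  also have "\<dots> = (\<Sum>j<n. lor (W 0) (W j))" by (simp add: gram add.commute[of _ i])
  also have "\<dots> = lor (W 0) center" by (simp add: center_def lor_sum_right)
  finally show ?thesis .
qed

lemma center_future: "center \<in> future"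
proof -
  have "(\<Sum>j<k. W j) \<in> future" if "k \<ge> 1" for k
    using that by (induction k rule: dec_induct) (auto simp: W_H2 H2_future future_add)
  then show ?thesis unfolding center_def using n3 by simp
qed

text \<open>With the centre at the origin, consecutive points have constant inner products and
  constant orientation, so they differ by a fixed rotation, through an angle \<beta> of which
  \<open>n\<close> copies are a multiple of 2 \<pi>. This multiple is arbitrary, as the points may
  come in star order; therefore only the sets of points are compared, and counting gives
  equality.\<close>

theorem standard_position:
  "\<exists>f r. lorentz f \<and> 0 < r \<and> r < 1 \<and> (\<lambda>i. proj (f (W i))) ` {..<n} = std_vertex n r ` {..<n}"
proof -
  define q where "q = sqrt (- lor center center)"
  have q: "q > 0" "q * q = - lor center center" using center_future by (auto simp: q_def future_def)
  define e where "e = (1 / q) *\<^sub>R center"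
  have e: "e \<in> H2"
  proof -
    have "e \<in> future" unfolding e_def using q center_future by (intro future_scale) auto
    moreover have "lor e e = -1"
    proof -
      have "lor e e = lor center center / (q * q)" unfolding e_def by simp
      also have "\<dots> = - (q * q) / (q * q)" using q(2) by simp
      also have "\<dots> = -1" using q(1) by simp
      finally show ?thesis .
    qed
    ultimately show ?thesis unfolding H2_def future_def by blast
  qed
  define f where "f = boost e"
  have f: "lorentz f" "f e = e3" using lorentz_boost[OF e] boost_self[OF e] by (simp_all add: f_def)
  define x where "x i = proj (f (W i))" for i
  have fW: "f (W i) \<in> H2" for i using lorentz_H2[OF f(1) W_H2] .
  have xh: "x i \<in> hplane" for i unfolding x_def using proj_hplane H2_future fW by blast
  have lx: "lift (x i) = f (W i)" for i unfolding x_def using lift_proj fW by blast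
  have third: "(f (W i)) $ 3 = (f (W 0)) $ 3" for i
  proof -
    have "(f (W i)) $ 3 = - lor (f (W i)) e3" for i by (simp add: lor_def)
    also have "lor (f (W i)) e3 = lor (W i) e" for i using lorentzD(2)[OF f(1), of "W i" e] f(2) by simp
    finally have "(f (W i)) $ 3 = - lor (W i) e" for i .
    then show ?thesis using W_center[of i] by (simp add: e_def)
  qed
  define h where "h = (f (W 0)) $ 3"
  define r where "r = sqrt (1 - 1 / (h * h))"
  have h: "h > 0" using fW[of 0] by (simp add: h_def H2_def)
  have xx: "1 - x i \<bullet> x i = 1 / (h * h)" for i
  proof -
    have "lift (x i) $ 3 = h" using lx third by (simp add: h_def)
    then have "1 / sqrt (1 - x i \<bullet> x i) = h" by (simp add: lift_def)
    then have "sqrt (1 - x i \<bullet> x i) = 1 / h" using h by (auto simp: field_simps)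
    then have "(sqrt (1 - x i \<bullet> x i))\<^sup>2 = 1 / (h * h)" by (simp add: power2_eq_square)
    then show ?thesis using xh[of i] by (simp add: hplane_iff)
  qed
  have xx0: "0 \<le> x i \<bullet> x i" for i by simp
  have hh: "0 \<le> 1 - 1 / (h * h)" using xx[of 0] xx0[of 0] by linarith
  have r2: "x i \<bullet> x i = r\<^sup>2" for i
  proof -
    have "r\<^sup>2 = 1 - 1 / (h * h)" unfolding r_def using hh by simp
    then show ?thesis using xx[of i] by linarith
  qed
  have ginv: "x i \<bullet> x j = 1 + lor (W i) (W j) / (h * h)" for i j
  proof -
    have "lor (W i) (W j) = lor (lift (x i)) (lift (x j))" unfolding lx using lorentzD(2)[OF f(1)] by simp
    also have "\<dots> = (x i \<bullet> x j - 1) * (h * h)" unfolding lor_lift xx using h by (simp add: real_sqrt_divide)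
    finally show ?thesis using h by simp
  qed
  have r1: "r < 1"
  proof -
    have "1 - 1 / (h * h) < 1" using h by simp
    then have "sqrt (1 - 1 / (h * h)) < sqrt 1" by (rule real_sqrt_less_mono)
    then show ?thesis by (simp add: r_def)
  qed
  have inj_x: "inj_on x {..<n}"
  proof (rule inj_onI)
    fix i j assume ij: "i \<in> {..<n}" "j \<in> {..<n}" "x i = x j"
    then have "f (W i) = f (W j)" using lx by metis
    then have "W i = W j" using lorentz_bij[OF f(1)] by (simp add: bij_def inj_eq)
    then show "i = j" using inj ij by (simp add: inj_on_def)
  qed
  have r0: "r > 0"
  proof (rule ccontr)
    assume "\<not> r > 0"
    moreover have "r \<ge> 0" unfolding r_def using hh by simp
    ultimately have "x i = 0" for i using r2[of i] by simp
    then have "x 0 = x 1" by metis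
    then show False using inj_onD[OF inj_x, of 0 1] n3 by simp
  qed
  define c where "c = x 0 \<bullet> x 1"
  have c: "x i \<bullet> x (i + 1) = c" for i using g1[of i] g1[of 0] by (simp add: c_def ginv)
  let ?cr = "\<lambda>p q :: real^2. p$1 * q$2 - p$2 * q$1"
  have crsq: "(?cr (x i) (x (i + 1)))\<^sup>2 = r\<^sup>2 * r\<^sup>2 - c\<^sup>2" for i
  proof -
    have "(?cr (x i) (x (i + 1)))\<^sup>2 = (x i \<bullet> x i) * (x (i + 1) \<bullet> x (i + 1)) - (x i \<bullet> x (i + 1))\<^sup>2"
      by (simp add: inner2 power2_eq_square algebra_simps)
    then show ?thesis unfolding c r2 .
  qed
  have expand: "(p \<bullet> p) *\<^sub>R q = (p \<bullet> q) *\<^sub>R p + (?cr p q) *\<^sub>R vector [- p$2, p$1]" for p q :: "real^2"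
    by (simp add: vec_eq_iff forall_2 inner2 algebra_simps)
  define s where "s = ?cr (x 0) (x 1)"
  have crs: "?cr (x i) (x (i + 1)) = s" for i
  proof (induction i)
    case (Suc i)
    \<comment> \<open>A change of the sense of rotation would lead back to the previous point,
      against the orientation hypothesis.\<close>
    have "?cr (x (Suc i)) (x (Suc i + 1)) \<noteq> - s \<or> s = 0"
    proof (rule ccontr)
      assume "\<not> ?thesis"
      then have neg: "?cr (x (Suc i)) (x (Suc i + 1)) = - s" by simp
      have "?cr (x (Suc i)) (x i) = - s" using Suc by (simp add: algebra_simps)
      moreover have "x (Suc i) \<bullet> x i = x (Suc i) \<bullet> x (Suc i + 1)" using c[of i] c[of "Suc i"] by (simp add: inner_commute)
      ultimately have "(x (Suc i) \<bullet> x (Suc i)) *\<^sub>R x i = (x (Suc i) \<bullet> x (Suc i)) *\<^sub>R x (Suc i + 1)"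
        unfolding expand[of "x (Suc i)"] neg by simp
      then have "x i = x (i + 2)" using r2[of "Suc i"] r0 by simp
      then have "f (W i) = f (W (i + 2))" using lx by metis
      then have "W i = W (i + 2)" using lorentz_bij[OF f(1)] by (simp add: bij_def inj_eq)
      then show False using or[of i] by simp
    qed
    moreover have "(?cr (x (Suc i)) (x (Suc i + 1)))\<^sup>2 = s\<^sup>2" using crsq[of "Suc i"] crsq[of 0] by (simp add: s_def)
    ultimately show ?case by (auto simp: power2_eq_iff)
  qed (simp add: s_def)
  have "c\<^sup>2 + s\<^sup>2 = r\<^sup>2 * r\<^sup>2" using crsq[of 0] by (simp add: s_def)
  then have "(c / r\<^sup>2)\<^sup>2 + (s / r\<^sup>2)\<^sup>2 = 1" using r0 by (simp add: power_divide add_divide_distrib[symmetric] power2_eq_square[of "r\<^sup>2"])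
  then obtain \<beta> where \<beta>: "c / r\<^sup>2 = cos \<beta>" "s / r\<^sup>2 = sin \<beta>" using sincos_total_2pi by metis
  have "(x 0 $ 1 / r)\<^sup>2 + (x 0 $ 2 / r)\<^sup>2 = 1"
  proof -
    have "(x 0 $ 1 / r)\<^sup>2 + (x 0 $ 2 / r)\<^sup>2 = (x 0 \<bullet> x 0) / r\<^sup>2"
      by (simp add: power_divide add_divide_distrib inner2 power2_eq_square)
    then show ?thesis using r2[of 0] r0 by simp
  qed
  then obtain \<theta> where \<theta>: "x 0 $ 1 / r = cos \<theta>" "x 0 $ 2 / r = sin \<theta>" using sincos_total_2pi by metis
  have step: "x (i + 1) = vector [cos \<beta> * x i $ 1 - sin \<beta> * x i $ 2, cos \<beta> * x i $ 2 + sin \<beta> * x i $ 1]" for i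
  proof -
    have "r\<^sup>2 *\<^sub>R x (i + 1) = c *\<^sub>R x i + s *\<^sub>R vector [- x i $ 2, x i $ 1]"
      using expand[of "x i" "x (i + 1)"] unfolding r2 c crs .
    then have "(1 / r\<^sup>2) *\<^sub>R (r\<^sup>2 *\<^sub>R x (i + 1)) = (1 / r\<^sup>2) *\<^sub>R (c *\<^sub>R x i + s *\<^sub>R vector [- x i $ 2, x i $ 1])" by simp
    then have "x (i + 1) = (c / r\<^sup>2) *\<^sub>R x i + (s / r\<^sup>2) *\<^sub>R vector [- x i $ 2, x i $ 1]" using r0 by (simp add: scaleR_add_right)
    then show ?thesis unfolding \<beta> by (simp add: vec_eq_iff forall_2)
  qed
  have xi: "x i $ 1 = r * cos (\<theta> + real i * \<beta>) \<and> x i $ 2 = r * sin (\<theta> + real i * \<beta>)" for i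
  proof (induction i)
    case 0
    then show ?case using \<theta> r0 by (simp add: field_simps)
  next
    case (Suc i)
    have "\<theta> + real (Suc i) * \<beta> = (\<theta> + real i * \<beta>) + \<beta>" by (simp add: algebra_simps)
    then show ?case using Suc step[of i] by (simp only: cos_add sin_add) (simp add: algebra_simps)
  qed
  have "x n = x 0" using W_periodic[of 0] by (simp add: x_def)
  then have per: "cos (\<theta> + real n * \<beta>) = cos \<theta>" "sin (\<theta> + real n * \<beta>) = sin \<theta>" using xi[of n] xi[of 0] r0 by auto
  have "cos (real n * \<beta>) = cos (\<theta> + real n * \<beta>) * cos \<theta> + sin (\<theta> + real n * \<beta>) * sin \<theta>"
    using cos_diff[of "\<theta> + real n * \<beta>" \<theta>] by simp
  also have "\<dots> = 1" unfolding per using sin_cos_squared_add[of \<theta>] by (simp add: power2_eq_square)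
  finally obtain j :: int where j: "real n * \<beta> = real_of_int j * 2 * pi" using cos_one_2pi_int by auto
  define g where "g = hrot (cos \<theta>) (- sin \<theta>) \<circ> f"
  have g: "lorentz g" unfolding g_def by (intro lorentz_comp f lorentz_hrot) simp
  have pg: "proj (g (W i)) = vector [r * cos (real i * \<beta>), r * sin (real i * \<beta>)]" for i
  proof -
    have "proj (g (W i)) = vector [cos \<theta> * x i $ 1 + sin \<theta> * x i $ 2, - sin \<theta> * x i $ 1 + cos \<theta> * x i $ 2]"
      unfolding g_def x_def by (simp add: vec_eq_iff forall_2 add_divide_distrib diff_divide_distrib)
    also have "cos \<theta> * x i $ 1 + sin \<theta> * x i $ 2 = r * cos ((\<theta> + real i * \<beta>) - \<theta>)"
      using xi[of i] by (simp only: cos_diff) (simp add: algebra_simps)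
    also have "- sin \<theta> * x i $ 1 + cos \<theta> * x i $ 2 = r * sin ((\<theta> + real i * \<beta>) - \<theta>)"
      using xi[of i] by (simp only: sin_diff) (simp add: algebra_simps)
    finally show ?thesis by simp
  qed
  have sub: "(\<lambda>i. proj (g (W i))) ` {..<n} \<subseteq> std_vertex n r ` {..<n}"
  proof
    fix y assume "y \<in> (\<lambda>i. proj (g (W i))) ` {..<n}"
    then obtain i where y: "y = vector [r * cos (real i * \<beta>), r * sin (real i * \<beta>)]" using pg by auto
    have "real i * \<beta> = real i * (real n * \<beta>) / real n" using n3 by simp
    also have "\<dots> = 2 * pi * real_of_int (int i * j) / real n" unfolding j by simp
    finally have "\<exists>k<n. std_vertex n r k = y" unfolding y using std_vertex_int[of n r "int i * j"] n3 by simp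
    then show "y \<in> std_vertex n r ` {..<n}" by blast
  qed
  have gW: "g (W i) \<in> H2" for i using lorentz_H2[OF g W_H2] .
  have inj_g: "inj_on (\<lambda>i. proj (g (W i))) {..<n}"
  proof (rule inj_onI)
    fix i j assume ij: "i \<in> {..<n}" "j \<in> {..<n}" "proj (g (W i)) = proj (g (W j))"
    then have "g (W i) = g (W j)" using lift_proj gW by metis
    then have "W i = W j" using lorentz_bij[OF g] by (simp add: bij_def inj_eq)
    then show "i = j" using inj ij by (simp add: inj_on_def)
  qed
  have "(\<lambda>i. proj (g (W i))) ` {..<n} = std_vertex n r ` {..<n}"
  proof (rule card_seteq[OF _ sub])
    show "card (std_vertex n r ` {..<n}) \<le> card ((\<lambda>i. proj (g (W i))) ` {..<n})"
      unfolding card_image[OF inj_g] using card_image_le[of "{..<n}" "std_vertex n r"] by simp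
  qed simp
  then show ?thesis using g r0 r1 by blast
qed

end

subsection \<open>Thickness\<close>

lemma lor_hmap_sign:
  assumes f: "lorentz f" and x: "x \<in> hplane"
  shows "\<exists>k>0. lor N (hl x) = k * lor (f N) (hl (hmap f x))"
proof -
  have F: "f (hl x) \<in> future" using lorentzD(3)[OF f hl_in_future[OF x]] .
  have "lor N (hl x) = lor (f N) (f (hl x))" using lorentzD(2)[OF f] by simp
  also have "\<dots> = lor (f N) ((f (hl x))$3 *\<^sub>R hl (hmap f x))"
    unfolding hmap_def by (intro arg_cong2[where f = lor] refl hl_proj F)
  finally show ?thesis using F by (intro exI[of _ "(f (hl x))$3"]) (simp add: future_def)
qed

text \<open>A line is the trace of a plane through the origin with normal \<open>N\<close>, a form
  that Lorentz maps respect. That the line meets \<open>K\<close> rules out the only bad normals,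
  the multiples of \<open>e3\<close>.\<close>

lemma supporting_line_lor:
  assumes K: "K \<subseteq> hplane"
  shows "supporting_line K l \<longleftrightarrow> (\<exists>N. N \<noteq> 0 \<and> l = {x \<in> hplane. lor N (hl x) = 0} \<and> K \<inter> l \<noteq> {} \<and> (\<forall>x\<in>K. lor N (hl x) \<le> 0))"
    (is "_ \<longleftrightarrow> ?R")
proof
  assume "supporting_line K l"
  then obtain a b where ab: "a \<noteq> 0" "l = {x \<in> hplane. a \<bullet> x = b}" "K \<inter> l \<noteq> {}" "K \<subseteq> {x \<in> hplane. a \<bullet> x \<le> b}"
    unfolding supporting_line_def by blast
  define N :: "real^3" where "N = vector [a$1, a$2, b]"
  have N: "lor N (hl x) = a \<bullet> x - b" for x by (simp add: N_def lor_def inner2)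
  have "N \<noteq> 0" using ab(1) by (auto simp: N_def vec_eq_iff forall_2 forall_3)
  then show ?R using ab by (intro exI[of _ N]) (auto simp: N)
next
  assume ?R
  then obtain N where N: "N \<noteq> 0" "l = {x \<in> hplane. lor N (hl x) = 0}" "K \<inter> l \<noteq> {}" "\<And>x. x \<in> K \<Longrightarrow> lor N (hl x) \<le> 0" by blast
  define a :: "real^2" where "a = vector [N$1, N$2]"
  have e: "lor N (hl x) = a \<bullet> x - N$3" for x by (simp add: a_def lor_def inner2)
  have "a \<noteq> 0"
  proof
    assume a: "a = 0"
    obtain x where "x \<in> l" using N by blast
    then have "N$3 = 0" using N e a by simp
    moreover have "N$1 = 0" "N$2 = 0" using a by (simp_all add: a_def vec_eq_iff forall_2)
    ultimately show False using N(1) by (simp add: vec_eq_iff forall_3)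
  qed
  then show "supporting_line K l" unfolding supporting_line_def using N K
    by (intro exI[of _ a] exI[of _ "N$3"]) (auto simp: e)
qed

lemma supporting_line_hplane: "supporting_line K l \<Longrightarrow> l \<subseteq> hplane"
  by (auto simp: supporting_line_def)

lemma supporting_line_hmap:
  assumes f: "lorentz f" and K: "K \<subseteq> hplane" and l: "supporting_line K l"
  shows "supporting_line (hmap f ` K) (hmap f ` l)"
proof -
  obtain N where N: "N \<noteq> 0" "l = {x \<in> hplane. lor N (hl x) = 0}" "K \<inter> l \<noteq> {}" "\<And>x. x \<in> K \<Longrightarrow> lor N (hl x) \<le> 0"
    using l unfolding supporting_line_lor[OF K] by blast
  have K': "hmap f ` K \<subseteq> hplane" using hmap_hplane[OF f] K by blast
  have sgn: "lor N (hl x) = 0 \<longleftrightarrow> lor (f N) (hl (hmap f x)) = 0" "lor N (hl x) \<le> 0 \<longleftrightarrow> lor (f N) (hl (hmap f x)) \<le> 0"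
    if "x \<in> hplane" for x
    using lor_hmap_sign[OF f that, of N] by (auto simp: mult_le_0_iff)
  have "f N \<noteq> 0"
  proof
    assume "f N = 0"
    then have "f N = f 0" using lorentzD(1)[OF f] by (simp add: linear_0)
    then show False using lorentz_bij[OF f] N(1) by (simp add: bij_def inj_eq)
  qed
  moreover have "hmap f ` l = {x \<in> hplane. lor (f N) (hl x) = 0}"
  proof
    show "hmap f ` l \<subseteq> {x \<in> hplane. lor (f N) (hl x) = 0}" using N(2) sgn(1) hmap_hplane[OF f] by auto
    show "{x \<in> hplane. lor (f N) (hl x) = 0} \<subseteq> hmap f ` l"
    proof
      fix y assume y: "y \<in> {x \<in> hplane. lor (f N) (hl x) = 0}"
      define x where "x = hmap (inv f) y"
      have x: "x \<in> hplane" "hmap f x = y" using y hmap_hplane[OF lorentz_inv[OF f]] hmap_inv(2)[OF f] by (auto simp: x_def)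
      then have "x \<in> l" using N(2) sgn(1)[OF x(1)] y by simp
      then show "y \<in> hmap f ` l" using x(2) by blast
    qed
  qed
  moreover have "hmap f ` K \<inter> hmap f ` l \<noteq> {}" using N(3) by blast
  moreover have "lor (f N) (hl x) \<le> 0" if "x \<in> hmap f ` K" for x using that N(4) sgn(2) K by auto
  ultimately show ?thesis unfolding supporting_line_lor[OF K'] by blast
qed

lemma hmap_inv_image: assumes f: "lorentz f" and A: "A \<subseteq> hplane" shows "hmap f ` (hmap (inv f) ` A) = A" "hmap (inv f) ` (hmap f ` A) = A"
  using hmap_inv[OF f] A by (auto simp: image_image subset_iff)

lemma supporting_lines_hmap:
  assumes f: "lorentz f" and K: "K \<subseteq> hplane"
  shows "{l. supporting_line (hmap f ` K) l} = (`) (hmap f) ` {l. supporting_line K l}"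
proof
  show "(`) (hmap f) ` {l. supporting_line K l} \<subseteq> {l. supporting_line (hmap f ` K) l}"
    using supporting_line_hmap[OF f K] by blast
  show "{l. supporting_line (hmap f ` K) l} \<subseteq> (`) (hmap f) ` {l. supporting_line K l}"
  proof
    fix l assume l: "l \<in> {l. supporting_line (hmap f ` K) l}"
    have K': "hmap f ` K \<subseteq> hplane" using hmap_hplane[OF f] K by blast
    have "supporting_line (hmap (inv f) ` (hmap f ` K)) (hmap (inv f) ` l)"
      using supporting_line_hmap[OF lorentz_inv[OF f] K'] l by simp
    then have "supporting_line K (hmap (inv f) ` l)" using hmap_inv_image(2)[OF f K] by simp
    moreover have "l = hmap f ` (hmap (inv f) ` l)"
      using hmap_inv_image(1)[OF f, of l] supporting_line_hplane[of "hmap f ` K" l] l by simp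
    ultimately show "l \<in> (`) (hmap f) ` {l. supporting_line K l}" by blast
  qed
qed

lemma hsetdist_hmap:
  assumes f: "lorentz f" and "A \<subseteq> hplane" "B \<subseteq> hplane"
  shows "hsetdist (hmap f ` A) (hmap f ` B) = hsetdist A B"
proof -
  have "(\<lambda>(x, y). hdist x y) ` (hmap f ` A \<times> hmap f ` B) = (\<lambda>(x, y). hdist x y) ` (A \<times> B)"
  proof -
    have "(\<lambda>(x, y). hdist x y) ` (hmap f ` A \<times> hmap f ` B) = (\<lambda>(x, y). hdist (hmap f x) (hmap f y)) ` (A \<times> B)"
      by (force simp: image_iff)
    also have "\<dots> = (\<lambda>(x, y). hdist x y) ` (A \<times> B)"
      by (intro image_cong) (use assms hdist_hmap[OF f] in auto)
    finally show ?thesis .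
  qed
  then show ?thesis by (simp add: hsetdist_def)
qed

lemma thickness_hmap:
  assumes f: "lorentz f" and K: "K \<subseteq> hplane"
  shows "thickness (hmap f ` K) = thickness K"
proof -
  have w: "hwidth (hmap f ` K) (hmap f ` l) = hwidth K l" if l: "supporting_line K l" for l
  proof -
    have "(\<lambda>l'. hsetdist (hmap f ` l) l') ` ((`) (hmap f) ` {l. supporting_line K l}) = (\<lambda>l'. hsetdist l l') ` {l. supporting_line K l}"
      unfolding image_image by (intro image_cong) (use hsetdist_hmap[OF f] supporting_line_hplane l in auto)
    then show ?thesis unfolding hwidth_def supporting_lines_hmap[OF f K] by simp
  qed
  have "hwidth (hmap f ` K) ` ((`) (hmap f) ` {l. supporting_line K l}) = hwidth K ` {l. supporting_line K l}"
    unfolding image_image by (intro image_cong) (use w in auto)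
  then show ?thesis unfolding thickness_def supporting_lines_hmap[OF f K] by simp
qed

section \<open>Width and the distance to a line\<close>

lemma future_from_lor:
  assumes "X \<in> future" "lor Z Z < 0" "lor X Z < 0"
  shows "Z \<in> future"
proof (rule ccontr)
  assume "Z \<notin> future"
  then have "- Z \<in> future" using future_or_past assms(2) by blast
  then have "lor X (- Z) < 0" using assms(1) future_lor_neg by blast
  then show False using assms(3) by simp
qed

text \<open>\<open>lor M Y\<close> is sinh of the signed distance of \<open>Y\<close> from the line
  with normal \<open>M\<close>. Removing the \<open>M\<close>-component of \<open>Y\<close> and
  normalizing yields the foot of the perpendicular, to which \<open>reverse_cauchy\<close>
  applies.\<close>

lemma dist_to_line:
  assumes M: "lor M M = 1" and X: "X \<in> H2" "lor M X = 0" and Y: "Y \<in> H2"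
  shows "sqrt (1 + (lor M Y)\<^sup>2) \<le> - lor X Y"
proof -
  define d where "d = lor M Y"
  define q where "q = sqrt (1 + d\<^sup>2)"
  have q: "q > 0" "q * q = 1 + d\<^sup>2" by (auto simp: q_def add_pos_nonneg)
  define Z where "Z = Y - d *\<^sub>R M"
  have YM: "lor Y M = d" "lor X M = 0" using X by (simp_all add: d_def lor_commute)
  have ZZ: "lor Z Z = - (q * q)" unfolding q(2) Z_def using M Y
    by (simp add: H2_self YM d_def[symmetric] power2_eq_square)
  have XZ: "lor X Z = lor X Y" by (simp add: Z_def YM)
  have "lor X Y \<le> -1" using reverse_cauchy X Y by blast
  then have XZ0: "lor X Z < 0" using XZ by simp
  have "lor Z Z < 0" unfolding ZZ using q(1) by simp
  then have Zf: "Z \<in> future" using future_from_lor[OF H2_future[OF X(1)]] XZ0 by blast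
  have "(1 / q) *\<^sub>R Z \<in> H2"
    using future_scale[OF Zf, of "1 / q"] q(1) ZZ by (simp add: H2_def future_def)
  then have "lor X ((1 / q) *\<^sub>R Z) \<le> -1" using reverse_cauchy X by blast
  then have "lor X Y \<le> - q" using q(1) by (simp add: XZ field_simps)
  then show ?thesis by (simp add: q_def d_def)
qed

lemma foot_on_line:
  assumes M: "lor M M = 1" and Y: "Y \<in> H2"
  shows "\<exists>X\<in>H2. lor M X = 0 \<and> - lor X Y = sqrt (1 + (lor M Y)\<^sup>2)"
proof -
  define d where "d = lor M Y"
  define q where "q = sqrt (1 + d\<^sup>2)"
  have q: "q > 0" "q * q = 1 + d\<^sup>2" by (auto simp: q_def add_pos_nonneg)
  define Z where "Z = Y - d *\<^sub>R M"
  have YM: "lor Y M = d" by (simp add: d_def lor_commute)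
  have ZZ: "lor Z Z = - (q * q)" unfolding q(2) Z_def using M Y
    by (simp add: H2_self YM d_def[symmetric] power2_eq_square)
  have YZ: "lor Y Z = - (q * q)" unfolding q(2) Z_def using Y by (simp add: H2_self YM power2_eq_square)
  have "lor Z Z < 0" "lor Y Z < 0" unfolding ZZ YZ using q(1) by simp_all
  then have Zf: "Z \<in> future" using future_from_lor[OF H2_future[OF Y]] by blast
  have "(1 / q) *\<^sub>R Z \<in> H2"
    using future_scale[OF Zf, of "1 / q"] q(1) ZZ by (simp add: H2_def future_def)
  moreover have "lor M ((1 / q) *\<^sub>R Z) = 0" by (simp add: Z_def M d_def)
  moreover have "- lor ((1 / q) *\<^sub>R Z) Y = q" using YZ q(1) by (simp add: lor_commute[of Z Y])
  ultimately show ?thesis unfolding q_def d_def by blast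
qed

lemma supporting_line_normal:
  assumes K: "K \<subseteq> hplane" and l: "supporting_line K l"
  obtains M where "lor M M = 1" "l = {x \<in> hplane. lor M (lift x) = 0}" "\<And>x. x \<in> K \<Longrightarrow> 0 \<le> lor M (lift x)"
proof -
  obtain N where N: "N \<noteq> 0" "l = {x \<in> hplane. lor N (hl x) = 0}" "K \<inter> l \<noteq> {}" "\<And>x. x \<in> K \<Longrightarrow> lor N (hl x) \<le> 0"
    using l unfolding supporting_line_lor[OF K] by blast
  obtain x0 where x0: "x0 \<in> hplane" "lor N (hl x0) = 0" using N by blast
  then have "lor N N > 0" using orthogonal_timelike_spacelike[OF hl_in_future[OF x0(1)], of N] N(1) by (simp add: lor_commute)
  then have q: "sqrt (lor N N) > 0" "sqrt (lor N N) * sqrt (lor N N) = lor N N" by simp_all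
  \<comment> \<open>The sign turns the outward normal into an inward one.\<close>
  define M where "M = (- 1 / sqrt (lor N N)) *\<^sub>R N"
  have MM: "lor M M = 1" using q \<open>lor N N > 0\<close> by (simp add: M_def)
  have Ml: "lor M (lift x) = - (lor N (hl x)) / (sqrt (lor N N) * sqrt (1 - x \<bullet> x))" for x
    by (simp add: M_def lift_def)
  show ?thesis
  proof (rule that[OF MM])
    show "l = {x \<in> hplane. lor M (lift x) = 0}" unfolding N(2) Ml using q(1) by (auto simp: hplane_iff)
    show "0 \<le> lor M (lift x)" if "x \<in> K" for x
      unfolding Ml using N(4)[OF that] q(1) that K by (intro divide_nonneg_pos) (auto simp: hplane_iff)
  qed
qed

text \<open>The line \<open>l'\<close> is perpendicular to the common perpendicular of \<open>l\<close> and a point of \<open>K\<close> farthest from \<open>l\<close>.\<close>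

lemma farthest_supporting_line:
  assumes K: "K \<subseteq> hplane" "compact K" and M: "lor M M = 1" and x0: "x0 \<in> K" "0 \<le> lor M (lift x0)"
    and l: "l = {x \<in> hplane. lor M (lift x) = 0}"
  obtains l' where "supporting_line K l'"
    "\<And>x y. x \<in> l \<Longrightarrow> y \<in> l' \<Longrightarrow> sqrt (1 + (lor M (lift x0))\<^sup>2) \<le> cosh (hdist x y)"
proof -
  have cont: "continuous_on K (\<lambda>x. lor M (lift x))"
    unfolding lift_def lor_def using K(1)
    by (auto intro!: continuous_intros simp: hplane_iff hl_def)
  obtain q where q: "q \<in> K" "\<And>x. x \<in> K \<Longrightarrow> lor M (lift x) \<le> lor M (lift q)"
    using continuous_attains_sup[OF K(2) _ cont] x0 by auto
  define d where "d = lor M (lift q)"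
  have d: "lor M (lift x0) \<le> d" "0 \<le> d" using q(2)[OF x0(1)] x0 by (auto simp: d_def)
  have qh: "q \<in> hplane" using q K by auto
  \<comment> \<open>The component of \<open>M\<close> tangent at \<open>q\<close>: the line with
    this normal passes through \<open>q\<close> at a right angle to the perpendicular from
    \<open>q\<close> to \<open>l\<close>.\<close>
  define N where "N = M + d *\<^sub>R lift q"
  have Nq: "lor N (lift q) = 0" using qh by (simp add: N_def d_def H2_self)
  have "lor N N = 1 + d\<^sup>2" using qh M by (simp add: N_def d_def H2_self lor_commute[of "lift q" M] power2_eq_square)
  moreover have "0 < 1 + d\<^sup>2" by (simp add: add_pos_nonneg)
  ultimately have N0: "N \<noteq> 0" by (metis less_irrefl lor_simps(9))
  have scale: "lor N (hl x) = sqrt (1 - x \<bullet> x) * lor N (lift x)" if "x \<in> hplane" for x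
    by (simp add: hl_lift[OF that])
  let ?l = "{x \<in> hplane. lor N (hl x) = 0}"
  show ?thesis
  proof (rule that[of ?l])
    have "lor N (hl x) \<le> 0" if x: "x \<in> K" for x
    proof -
      have xh: "x \<in> hplane" using x K by auto
      have "d * lor (lift q) (lift x) \<le> d * (-1)" using reverse_cauchy[of "lift q" "lift x"] qh xh d by (intro mult_left_mono) auto
      then have "lor N (lift x) \<le> 0" using q(2)[OF x] by (simp add: N_def d_def)
      then show ?thesis unfolding scale[OF xh] using xh by (simp add: hplane_iff mult_nonneg_nonpos)
    qed
    moreover have "q \<in> ?l" using scale[OF qh] Nq qh by simp
    ultimately show "supporting_line K ?l" unfolding supporting_line_lor[OF K(1)] using N0 q(1) by blast
    fix x y assume x: "x \<in> l" and y: "y \<in> ?l"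
    have xy: "x \<in> hplane" "y \<in> hplane" "lor M (lift x) = 0" using x y l by auto
    have "lor N (lift y) = 0" using scale[OF xy(2)] y by (auto simp: hplane_iff)
    \<comment> \<open>On \<open>l'\<close>, sinh of the distance from \<open>l\<close> is
      \<open>d\<close> times cosh of the distance from \<open>q\<close>, so it is smallest at
      \<open>q\<close>.\<close>
    then have "lor M (lift y) = d * (- lor (lift q) (lift y))" by (simp add: N_def)
    moreover have "d * 1 \<le> d * (- lor (lift q) (lift y))" using reverse_cauchy[of "lift q" "lift y"] qh xy d by (intro mult_left_mono) auto
    ultimately have "lor M (lift x0) \<le> lor M (lift y)" using d by simp
    then have "sqrt (1 + (lor M (lift x0))\<^sup>2) \<le> sqrt (1 + (lor M (lift y))\<^sup>2)" using x0 by (simp add: power_mono)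
    also have "\<dots> \<le> - lor (lift x) (lift y)" by (rule dist_to_line[OF M]) (use xy in auto)
    also have "\<dots> = cosh (hdist x y)" using cosh_hdist xy by simp
    finally show "sqrt (1 + (lor M (lift x0))\<^sup>2) \<le> cosh (hdist x y)" .
  qed
qed

lemma hdist_arcosh_le_iff:
  assumes "p \<in> hplane" "q \<in> hplane" "C \<ge> 1"
  shows "hdist p q \<le> arcosh C \<longleftrightarrow> cosh (hdist p q) \<le> C" "arcosh C \<le> hdist p q \<longleftrightarrow> C \<le> cosh (hdist p q)"
  using cosh_real_nonneg_le_iff[of "hdist p q" "arcosh C"] cosh_real_nonneg_le_iff[of "arcosh C" "hdist p q"]
    hdist_nonneg[OF assms(1,2)] assms(3) by simp_all

lemma hsetdist_bounds:
  assumes "l \<subseteq> hplane" "l' \<subseteq> hplane" "x \<in> l" "y \<in> l'"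
  shows "0 \<le> hsetdist l l'" "hsetdist l l' \<le> hdist x y"
proof -
  show "0 \<le> hsetdist l l'" unfolding hsetdist_def
    by (rule cINF_greatest) (use assms hdist_nonneg in auto)
  have "bdd_below ((\<lambda>(x, y). hdist x y) ` (l \<times> l'))"
    by (rule bdd_belowI2[of _ 0]) (use assms hdist_nonneg in auto)
  then show "hsetdist l l' \<le> hdist x y" unfolding hsetdist_def
    using cINF_lower[of "\<lambda>(x, y). hdist x y" "l \<times> l'" "(x, y)"] assms by auto
qed

text \<open>By the previous lemma, the width with respect to \<open>l\<close> is the largest distance of a point of \<open>K\<close> from \<open>l\<close>.\<close>

lemma thickness_eqI:
  assumes K: "K \<subseteq> hplane" "compact K" and C: "C \<ge> 1"
    and l0: "supporting_line K l0" "l0 = {x \<in> hplane. lor M0 (lift x) = 0}" "lor M0 M0 = 1"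
      "\<And>x. x \<in> K \<Longrightarrow> sqrt (1 + (lor M0 (lift x))\<^sup>2) \<le> C"
    and far: "\<And>l M. l = {x \<in> hplane. lor M (lift x) = 0} \<Longrightarrow> supporting_line K l \<Longrightarrow> lor M M = 1 \<Longrightarrow> (\<And>x. x \<in> K \<Longrightarrow> 0 \<le> lor M (lift x))
      \<Longrightarrow> \<exists>x\<in>K. C \<le> sqrt (1 + (lor M (lift x))\<^sup>2)"
  shows "thickness K = arcosh C"
proof -
  let ?S = "{l. supporting_line K l}"
  have Sh: "l \<subseteq> hplane" "K \<inter> l \<noteq> {}" if "supporting_line K l" for l
    using that supporting_line_hplane by (auto simp: supporting_line_def)
  \<comment> \<open>A bound for the diameter of \<open>K\<close> bounds all distances between
    supporting lines, so that the supremum in \<open>hwidth\<close> is one of a bounded set.\<close>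
  obtain B where B: "\<And>x y. x \<in> K \<Longrightarrow> y \<in> K \<Longrightarrow> hdist x y \<le> B"
  proof -
    have c: "continuous_on K (\<lambda>x. lift x $ 1)" "continuous_on K (\<lambda>x. lift x $ 2)" "continuous_on K (\<lambda>x. lift x $ 3)"
      unfolding lift_def using K(1) by (auto intro!: continuous_intros simp: hplane_iff)
    have "continuous_on (K \<times> K) (\<lambda>z. - lor (lift (fst z)) (lift (snd z)))"
      unfolding lor_def
      by (intro continuous_intros continuous_on_compose2[OF c(1)] continuous_on_compose2[OF c(2)] continuous_on_compose2[OF c(3)]) auto
    then have "compact ((\<lambda>z. - lor (lift (fst z)) (lift (snd z))) ` (K \<times> K))"
      using K(2) by (intro compact_continuous_image compact_Times)
    then have "bdd_above ((\<lambda>z. - lor (lift (fst z)) (lift (snd z))) ` (K \<times> K))" by (intro bounded_imp_bdd_above compact_imp_bounded)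
    then obtain b where b: "\<And>x y. x \<in> K \<Longrightarrow> y \<in> K \<Longrightarrow> - lor (lift x) (lift y) \<le> b" by (auto simp: bdd_above_def)
    have "hdist x y \<le> arcosh b" if xy: "x \<in> K" "y \<in> K" for x y
    proof -
      have h: "x \<in> hplane" "y \<in> hplane" using xy K by auto
      have "1 \<le> - lor (lift x) (lift y)" using reverse_cauchy[of "lift x" "lift y"] h by simp
      then have b1: "1 \<le> b" using b[OF xy] by linarith
      then show ?thesis using b[OF xy] cosh_hdist[OF h] hdist_arcosh_le_iff(1)[OF h b1] by simp
    qed
    then show ?thesis using that by blast
  qed
  have ub: "bdd_above (hsetdist l ` ?S)" if l: "supporting_line K l" for l
  proof (rule bdd_aboveI2)
    fix l' assume l': "l' \<in> ?S"
    then have l': "supporting_line K l'" by simp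
    obtain x y where xy: "x \<in> K" "x \<in> l" "y \<in> K" "y \<in> l'" using Sh(2)[OF l] Sh(2)[OF l'] by auto
    have "hsetdist l l' \<le> hdist x y" by (rule hsetdist_bounds(2)[OF Sh(1)[OF l] Sh(1)[OF l'] xy(2,4)])
    also have "\<dots> \<le> B" by (rule B[OF xy(1,3)])
    finally show "hsetdist l l' \<le> B" .
  qed
  have lower: "arcosh C \<le> hwidth K l" if l: "supporting_line K l" for l
  proof -
    obtain M where M: "lor M M = 1" "l = {x \<in> hplane. lor M (lift x) = 0}" "\<And>x. x \<in> K \<Longrightarrow> 0 \<le> lor M (lift x)"
      by (rule supporting_line_normal[OF K(1) l]) (rule that)
    obtain x0 where x0: "x0 \<in> K" "C \<le> sqrt (1 + (lor M (lift x0))\<^sup>2)" using far[OF M(2) l M(1,3)] by blast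
    obtain l' where l': "supporting_line K l'"
      "\<And>x y. x \<in> l \<Longrightarrow> y \<in> l' \<Longrightarrow> sqrt (1 + (lor M (lift x0))\<^sup>2) \<le> cosh (hdist x y)"
      by (rule farthest_supporting_line[OF K M(1) x0(1) M(3)[OF x0(1)] M(2)]) (rule that)
    have "arcosh C \<le> hsetdist l l'" unfolding hsetdist_def
    proof (rule cINF_greatest)
      show "l \<times> l' \<noteq> {}" using Sh(2)[OF l] Sh(2)[OF l'(1)] by auto
      fix z assume "z \<in> l \<times> l'"
      then obtain x y where z: "z = (x, y)" "x \<in> l" "y \<in> l'" by auto
      then have h: "x \<in> hplane" "y \<in> hplane" using Sh(1)[OF l] Sh(1)[OF l'(1)] by auto
      have "C \<le> cosh (hdist x y)" using l'(2)[OF z(2,3)] x0(2) by linarith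
      then show "arcosh C \<le> (case z of (x, y) \<Rightarrow> hdist x y)"
        using hdist_arcosh_le_iff(2)[OF h C] z by simp
    qed
    also have "\<dots> \<le> hwidth K l" unfolding hwidth_def using l'(1) by (intro cSUP_upper ub[OF l]) auto
    finally show ?thesis .
  qed
  have upper: "hwidth K l0 \<le> arcosh C" unfolding hwidth_def
  proof (rule cSUP_least)
    show "?S \<noteq> {}" using l0(1) by auto
    fix l' assume l': "l' \<in> ?S"
    then have l': "supporting_line K l'" by simp
    obtain y where y: "y \<in> K" "y \<in> l'" using Sh(2)[OF l'] by auto
    have yh: "y \<in> hplane" using y K by auto
    obtain X where X: "X \<in> H2" "lor M0 X = 0" "- lor X (lift y) = sqrt (1 + (lor M0 (lift y))\<^sup>2)"
      using foot_on_line[OF l0(3), of "lift y"] yh by auto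
    define x where "x = proj X"
    have x: "x \<in> hplane" "lift x = X" using X proj_hplane H2_future lift_proj by (auto simp: x_def)
    have "x \<in> l0" using x X l0(2) by simp
    then have "hsetdist l0 l' \<le> hdist x y" by (rule hsetdist_bounds(2)[OF Sh(1)[OF l0(1)] Sh(1)[OF l'] _ y(2)])
    also have "\<dots> \<le> arcosh C"
    proof -
      have "cosh (hdist x y) \<le> C" using cosh_hdist[OF x(1) yh] x(2) X(3) l0(4)[OF y(1)] by simp
      then show ?thesis using hdist_arcosh_le_iff(1)[OF x(1) yh C] by simp
    qed
    finally show "hsetdist l0 l' \<le> arcosh C" .
  qed
  have "thickness K \<le> hwidth K l0" unfolding thickness_def
  proof (rule cINF_lower)
    show "bdd_below (hwidth K ` ?S)" by (rule bdd_belowI2[of _ "arcosh C"]) (use lower in auto)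
  qed (use l0 in auto)
  moreover have "arcosh C \<le> thickness K" unfolding thickness_def by (rule cINF_greatest) (use lower l0(1) in auto)
  ultimately show ?thesis using upper by linarith
qed

section \<open>The thickness of the regular polygon\<close>

lemma cos_sum_ge:
  assumes "0 \<le> \<delta>" "\<delta> \<le> e" "e \<le> pi"
  shows "1 + cos e \<le> cos \<delta> + cos (e - \<delta>)"
proof -
  have 1: "1 + cos e = 2 * cos (e / 2) * cos (e / 2)" using cos_plus_cos[of 0 e] by simp
  have 2: "cos \<delta> + cos (e - \<delta>) = 2 * cos (e / 2) * cos (\<delta> - e / 2)"
    using cos_plus_cos[of \<delta> "e - \<delta>"] by (simp add: diff_divide_distrib)
  have "\<bar>\<delta> - e / 2\<bar> \<le> e / 2" using assms by linarith
  then have "cos (e / 2) \<le> cos \<bar>\<delta> - e / 2\<bar>" using assms by (intro cos_monotone_0_pi_le) auto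
  then have "cos (e / 2) \<le> cos (\<delta> - e / 2)" by simp
  moreover have "0 \<le> cos (e / 2)" using assms by (intro cos_ge_zero) auto
  ultimately show ?thesis unfolding 1 2 by (intro mult_left_mono) auto
qed

lemma std_polygon_subset:
  assumes "n \<ge> 3" "0 < r" "r < 1"
  shows "std_polygon n r \<subseteq> hplane" "compact (std_polygon n r)" "x \<in> std_polygon n r \<Longrightarrow> x \<bullet> x \<le> r\<^sup>2"
proof -
  show "std_polygon n r \<subseteq> hplane" unfolding std_polygon_def using std_vertex_hplane assms by (intro convex_hull_hplane) auto
  show "compact (std_polygon n r)" unfolding std_polygon_def by (intro compact_convex_hull finite_imp_compact) auto
  have n2: "norm (std_vertex n r k) = r" for k using inner_std_vertex[of n r k k] assms by (simp add: norm_eq_sqrt_inner)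
  have "std_polygon n r \<subseteq> cball 0 r" unfolding std_polygon_def
    by (rule hull_minimal) (auto simp: n2)
  moreover assume "x \<in> std_polygon n r"
  ultimately have "norm x \<le> r" by auto
  then show "x \<bullet> x \<le> r\<^sup>2" using assms by (simp add: dot_square_norm power_mono)
qed

theorem thickness_std_polygon:
  assumes n: "n \<ge> 3" "odd n" and r: "0 < r" "r < 1"
  shows "std_cosh n r \<ge> 1" "thickness (std_polygon n r) = arcosh (std_cosh n r)"
proof -
  define k e where "k = cos (pi / real n)" and "e = pi / real n"
  have k: "0 < k" "k < 1" using cos_pi_n[OF n(1)] by (simp_all add: k_def)
  have ke: "k = cos e" by (simp add: k_def e_def)
  have e0: "0 < e" "e \<le> pi" using n by (auto simp: e_def field_simps)
  have k2: "k\<^sup>2 < 1" and r2: "r\<^sup>2 < 1" using k r by (simp_all add: power_less_one_iff)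
  have rk: "r\<^sup>2 * k\<^sup>2 < 1" using mult_strict_mono[OF r2 k2] by simp
  define A B where "A = 1 - r\<^sup>2 * k\<^sup>2" and "B = 1 - r\<^sup>2"
  have AB: "A > 0" "B > 0" using rk r2 by (simp_all add: A_def B_def)
  define C where "C = std_cosh n r"
  have C0: "C > 0" using AB k r by (simp add: C_def std_cosh_def k_def[symmetric] A_def[symmetric] B_def[symmetric] add_pos_nonneg)
  have C2: "C\<^sup>2 = 1 + (r * (1 + k))\<^sup>2 / (A * B)"
  proof -
    have "C\<^sup>2 = (1 + r\<^sup>2 * k)\<^sup>2 / (A * B)"
      using AB by (simp add: C_def std_cosh_def k_def[symmetric] A_def[symmetric] B_def[symmetric] power_divide power_mult_distrib)
    also have "(1 + r\<^sup>2 * k)\<^sup>2 = A * B + (r * (1 + k))\<^sup>2" by (simp add: A_def B_def power2_eq_square algebra_simps)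
    finally show ?thesis using AB by (simp add: add_divide_distrib)
  qed
  have "1\<^sup>2 \<le> C\<^sup>2" unfolding C2 using AB by simp
  then have C1: "1 \<le> C" using C0 by (intro power2_le_imp_le[of 1 C]) auto
  then show "std_cosh n r \<ge> 1" by (simp add: C_def)
  let ?K = "std_polygon n r"
  note K = std_polygon_subset[OF n(1) r]
  \<comment> \<open>The outer unit normal of the side between the vertices 0 and 1, whose line has
    Euclidean distance \<open>r * k\<close> from the centre. Its width will be the minimal
    one.\<close>
  define a :: "real^2" where "a = vector [cos e, sin e]"
  have aa: "a \<bullet> a = 1" by (simp add: a_def inner2 power2_eq_square[symmetric])
  have na: "norm a = 1" using aa by (simp add: norm_eq_sqrt_inner)
  have vert: "a \<bullet> std_vertex n r i \<le> r * k" if "i < n" for i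
  proof -
    have "a \<bullet> std_vertex n r i = r * cos (2 * pi * real i / real n - e)"
      by (simp add: a_def inner2 cos_diff algebra_simps)
    also have "\<dots> \<le> r * k"
    proof (intro mult_left_mono)
      have ang: "2 * pi * real i / real n - e = (2 * real i - 1) * e" by (simp add: e_def left_diff_distrib diff_divide_distrib)
      show "cos (2 * pi * real i / real n - e) \<le> k"
      proof (cases "i = 0")
        case True then show ?thesis by (simp add: ke)
      next
        case False
        define y where "y = (2 * real i - 1) * e"
        have "1 * e \<le> (2 * real i - 1) * e" using False e0 by (intro mult_right_mono) auto
        then have y1: "e \<le> y" by (simp add: y_def)
        have "real i \<le> real n - 1" using that by linarith
        then have "(2 * real i - 1) * e \<le> (2 * real n - 3) * e" using e0 by (intro mult_right_mono) auto
        also have "\<dots> = 2 * pi - 3 * e" using n by (simp add: e_def left_diff_distrib diff_divide_distrib)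
        finally have y2: "y \<le> 2 * pi - e" using e0 by (simp add: y_def)
        show ?thesis
        proof (cases "y \<le> pi")
          case True
          then show ?thesis unfolding ang y_def[symmetric] ke using y1 e0 by (intro cos_monotone_0_pi_le) auto
        next
          case False
          have "cos y = cos (2 * pi - y)" by simp
          also have "\<dots> \<le> cos e" using False y2 e0 by (intro cos_monotone_0_pi_le) auto
          finally show ?thesis unfolding ang y_def[symmetric] ke .
        qed
      qed
    qed (use r in simp)
    finally show ?thesis .
  qed
  have halfK: "?K \<subseteq> {x. a \<bullet> x \<le> r * k}" unfolding std_polygon_def
    by (rule hull_minimal) (use vert convex_halfspace_le in auto)
  have v0: "std_vertex n r 0 \<in> ?K" "a \<bullet> std_vertex n r 0 = r * k" unfolding std_polygon_def
    using n by (auto intro: hull_inc simp: a_def inner2 ke)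
  define M0 :: "real^3" where "M0 = (- 1 / sqrt A) *\<^sub>R vector [a$1, a$2, r * k]"
  have lorv: "lor (vector [a$1, a$2, r * k]) (hl x) = a \<bullet> x - r * k" for x
    by (simp add: lor_def inner2)
  have M0l: "lor M0 (lift x) = (r * k - a \<bullet> x) / (sqrt A * sqrt (1 - x \<bullet> x))" for x
    by (simp add: M0_def lift_def lorv minus_divide_left[symmetric]) (simp add: minus_divide_left)
  have vv: "lor (vector [a$1, a$2, r * k]) (vector [a$1, a$2, r * k]) = A"
    using aa by (simp add: lor_def inner2 A_def power2_eq_square algebra_simps)
  have M0u: "lor M0 M0 = 1" using AB by (simp add: M0_def vv)
  define l0 where "l0 = {x \<in> hplane. a \<bullet> x = r * k}"
  have l0': "l0 = {x \<in> hplane. lor M0 (lift x) = 0}" unfolding l0_def M0l using AB by (auto simp: hplane_iff)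
  have l0s: "supporting_line ?K l0" unfolding supporting_line_def l0_def
    using aa v0 halfK K(1) by (intro exI[of _ a] exI[of _ "r * k"]) auto
  show "thickness ?K = arcosh (std_cosh n r)" unfolding C_def[symmetric]
  proof (rule thickness_eqI[OF K(1,2) C1 l0s l0' M0u])
    fix x assume x: "x \<in> ?K"
    define q where "q = 1 - x \<bullet> x"
    have q: "q \<ge> B" "q > 0" using K(3)[OF x] AB by (simp_all add: q_def B_def)
    have nx: "norm x \<le> r" using K(3)[OF x] r by (metis dot_square_norm less_imp_le power2_le_imp_le)
    have "\<bar>a \<bullet> x\<bar> \<le> norm a * norm x" by (rule Cauchy_Schwarz_ineq2)
    then have "\<bar>a \<bullet> x\<bar> \<le> norm x" by (simp add: na)
    then have "- r \<le> a \<bullet> x" using nx by linarith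
    then have b: "0 \<le> r * k - a \<bullet> x" "r * k - a \<bullet> x \<le> r * (1 + k)" using halfK x by (auto simp: algebra_simps)
    have "(lor M0 (lift x))\<^sup>2 = (r * k - a \<bullet> x)\<^sup>2 / (A * q)"
      unfolding M0l q_def[symmetric] using AB q by (simp add: power_divide power_mult_distrib)
    also have "\<dots> \<le> (r * (1 + k))\<^sup>2 / (A * B)"
      using b AB q by (intro frac_le power_mono mult_left_mono) auto
    finally have "1 + (lor M0 (lift x))\<^sup>2 \<le> C\<^sup>2" unfolding C2 by simp
    then have "sqrt (1 + (lor M0 (lift x))\<^sup>2) \<le> sqrt (C\<^sup>2)" by (rule real_sqrt_le_mono)
    then show "sqrt (1 + (lor M0 (lift x))\<^sup>2) \<le> C" using C0 by simp
  next
    fix l M assume M: "lor M M = 1" and pos: "\<And>x. x \<in> ?K \<Longrightarrow> 0 \<le> lor M (lift x)"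
    \<comment> \<open>Polar form of an arbitrary supporting line: its outer normal has direction
      \<theta>, its Euclidean distance parameter is \<open>b\<close>, and \<rho> is the normalizing
      factor with \<open>\<rho>\<^sup>2 * (1 - b\<^sup>2) = 1\<close>.\<close>
    define \<rho> where "\<rho> = sqrt ((M$1)\<^sup>2 + (M$2)\<^sup>2)"
    have M2: "(M$1)\<^sup>2 + (M$2)\<^sup>2 = 1 + (M$3)\<^sup>2" using M by (simp add: lor_def power2_eq_square)
    have \<rho>2: "\<rho>\<^sup>2 = 1 + (M$3)\<^sup>2" unfolding \<rho>_def M2 by (simp add: add_nonneg_nonneg)
    have \<rho>: "\<rho> > 0" unfolding \<rho>_def M2 by (simp add: add_pos_nonneg)
    have "(- M$1 / \<rho>)\<^sup>2 + (- M$2 / \<rho>)\<^sup>2 = ((M$1)\<^sup>2 + (M$2)\<^sup>2) / \<rho>\<^sup>2" by (simp add: power_divide add_divide_distrib)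
    also have "\<dots> = 1" unfolding M2 \<rho>2[symmetric] using \<rho> by simp
    finally obtain \<theta> where \<theta>: "- M$1 / \<rho> = cos \<theta>" "- M$2 / \<rho> = sin \<theta>" using sincos_total_2pi by metis
    have M12: "M$1 = - \<rho> * cos \<theta>" "M$2 = - \<rho> * sin \<theta>" using \<theta> \<rho> by (auto simp: field_simps)
    define b where "b = - M$3 / \<rho>"
    have M3: "M$3 = - \<rho> * b" using \<rho> by (simp add: b_def)
    have b2: "\<rho>\<^sup>2 * (1 - b\<^sup>2) = 1" unfolding right_diff_distrib using \<rho>2 by (simp add: M3 power_mult_distrib)
    have b1: "1 - b\<^sup>2 > 0" using b2 \<rho> by (metis zero_less_mult_pos zero_less_one zero_less_power)
    have dist: "lor M (lift (vector [r * cos \<phi>, r * sin \<phi>])) = \<rho> * (b - r * cos (\<theta> - \<phi>)) / sqrt B" for \<phi>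
    proof -
      have "(vector [r * cos \<phi>, r * sin \<phi>] :: real^2) \<bullet> vector [r * cos \<phi>, r * sin \<phi>] = r\<^sup>2 * ((cos \<phi>)\<^sup>2 + (sin \<phi>)\<^sup>2)"
        by (simp only: inner2 vector_2 power2_eq_square distrib_left mult.assoc mult.commute mult.left_commute)
      then have "lift (vector [r * cos \<phi>, r * sin \<phi>]) = (1 / sqrt B) *\<^sub>R hl (vector [r * cos \<phi>, r * sin \<phi>])"
        unfolding lift_def by (simp add: B_def)
      moreover have "lor M (hl (vector [r * cos \<phi>, r * sin \<phi>])) = \<rho> * (b - r * cos (\<theta> - \<phi>))"
        by (simp add: lor_def M12 M3 cos_diff algebra_simps)
      ultimately show ?thesis by simp
    qed
    \<comment> \<open>The index of a vertex whose direction is closest to \<theta>; the deviation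
      \<delta> is at most half the central angle.\<close>
    define j :: int where "j = round (\<theta> * real n / (2 * pi))"
    define \<delta> where "\<delta> = \<theta> - 2 * pi * real_of_int j / real n"
    have "\<bar>real_of_int j - \<theta> * real n / (2 * pi)\<bar> \<le> 1 / 2" unfolding j_def by (rule of_int_round_abs_le)
    then have "\<bar>real_of_int j - \<theta> * real n / (2 * pi)\<bar> * (2 * e) \<le> 1 / 2 * (2 * e)" using e0 by (intro mult_right_mono) auto
    also have "\<bar>real_of_int j - \<theta> * real n / (2 * pi)\<bar> * (2 * e) = \<bar>(real_of_int j - \<theta> * real n / (2 * pi)) * (2 * e)\<bar>"
      using e0 by (simp add: abs_mult)
    also have "(real_of_int j - \<theta> * real n / (2 * pi)) * (2 * e) = - \<delta>"
      using n by (simp add: \<delta>_def e_def field_simps)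
    finally have \<delta>e: "\<bar>\<delta>\<bar> \<le> e" by simp
    have vK: "vector [r * cos (2 * pi * real_of_int i / real n), r * sin (2 * pi * real_of_int i / real n)] \<in> ?K" for i
    proof -
      obtain l where "l < n" "std_vertex n r l = vector [r * cos (2 * pi * real_of_int i / real n), r * sin (2 * pi * real_of_int i / real n)]"
        using std_vertex_int[of n r i] n by auto
      then show ?thesis unfolding std_polygon_def by (metis hull_inc imageI lessThan_iff)
    qed
    have "0 \<le> \<rho> * (b - r * cos \<delta>) / sqrt B" using pos[OF vK[of j]] unfolding dist \<delta>_def[symmetric] .
    then have bge: "r * cos \<delta> \<le> b" using \<rho> AB by (simp add: zero_le_divide_iff zero_le_mult_iff)
    have "cos e \<le> cos \<bar>\<delta>\<bar>" using \<delta>e e0 by (intro cos_monotone_0_pi_le) auto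
    then have "r * k \<le> r * cos \<delta>" using r by (simp add: ke)
    then have brk: "r * k \<le> b" using bge by simp
    define m where "m = (n - 1) div 2"
    have nm: "real n = 2 * real m + 1" using n by (auto simp: m_def elim!: oddE)
    \<comment> \<open>As \<open>n = 2 * m + 1\<close>, no vertex is opposite to the vertex
      \<open>j\<close>. Of the two vertices next to the opposite direction, the sign of \<delta>
      selects the one closer to the direction opposite to \<theta>.\<close>
    define i where "i = (if \<delta> \<ge> 0 then j + int m + 1 else j + int m)"
    have "cos (\<theta> - 2 * pi * real_of_int i / real n) = - cos (e - \<bar>\<delta>\<bar>)"
    proof (cases "\<delta> \<ge> 0")
      case True
      have "2 * pi * real_of_int i / real n = 2 * pi * real_of_int j / real n + (2 * real m + 2) * e"
        using True n by (simp add: i_def e_def field_simps)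
      also have "(2 * real m + 2) * e = pi + e" using n nm by (simp add: e_def field_simps)
      finally have "\<theta> - 2 * pi * real_of_int i / real n = - ((e - \<delta>) + pi)" by (simp add: \<delta>_def)
      then show ?thesis using True by (simp only: cos_minus cos_periodic_pi abs_of_nonneg)
    next
      case False
      have "2 * pi * real_of_int i / real n = 2 * pi * real_of_int j / real n + (2 * real m) * e"
        using False n by (simp add: i_def e_def field_simps)
      also have "(2 * real m) * e = pi - e" using n nm by (simp add: e_def field_simps)
      finally have "\<theta> - 2 * pi * real_of_int i / real n = (e + \<delta>) - pi" by (simp add: \<delta>_def)
      then show ?thesis using False by (simp only: cos_minus_pi) simp
    qed
    then have d: "lor M (lift (vector [r * cos (2 * pi * real_of_int i / real n), r * sin (2 * pi * real_of_int i / real n)])) = \<rho> * (b + r * cos (e - \<bar>\<delta>\<bar>)) / sqrt B"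
      unfolding dist by simp
    \<comment> \<open>Tilting the line by \<delta> reduces the bound for \<open>b\<close> but brings
      the far vertex closer to the opposite direction; by \<open>cos_sum_ge\<close> the gain
      outweighs the loss.\<close>
    have "r * (1 + k) \<le> r * (cos \<bar>\<delta>\<bar> + cos (e - \<bar>\<delta>\<bar>))"
      unfolding ke using cos_sum_ge[of "\<bar>\<delta>\<bar>" e] \<delta>e e0 r by (intro mult_left_mono) auto
    also have "\<dots> \<le> b + r * cos (e - \<bar>\<delta>\<bar>)" using bge by (simp add: distrib_left)
    finally have num: "r * (1 + k) \<le> b + r * cos (e - \<bar>\<delta>\<bar>)" .
    \<comment> \<open>The supporting line is at least as far from the centre as a side, so its
      normalizing factor is no smaller either.\<close>
    have den: "1 - b\<^sup>2 \<le> A" unfolding A_def power_mult_distrib[symmetric] using brk r k by (simp add: power_mono)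
    have "(r * (1 + k))\<^sup>2 / (A * B) \<le> (b + r * cos (e - \<bar>\<delta>\<bar>))\<^sup>2 / ((1 - b\<^sup>2) * B)"
      using num den AB b1 r k by (intro frac_le power_mono mult_right_mono) auto
    also have "\<dots> = (\<rho> * (b + r * cos (e - \<bar>\<delta>\<bar>)) / sqrt B)\<^sup>2"
    proof -
      have "\<rho>\<^sup>2 = 1 / (1 - b\<^sup>2)" using b2 b1 by (simp add: field_simps)
      then show ?thesis using AB by (simp add: power_divide power_mult_distrib)
    qed
    finally have "C\<^sup>2 \<le> 1 + (\<rho> * (b + r * cos (e - \<bar>\<delta>\<bar>)) / sqrt B)\<^sup>2" unfolding C2 by simp
    then have "C \<le> sqrt (1 + (\<rho> * (b + r * cos (e - \<bar>\<delta>\<bar>)) / sqrt B)\<^sup>2)" by (rule real_le_rsqrt)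
    then show "\<exists>x\<in>?K. C \<le> sqrt (1 + (lor M (lift x))\<^sup>2)" using vK[of i] d by metis
  qed
qed

section \<open>Isometries as Lorentz maps\<close>

lemma hdist_eq_imp_lor_eq:
  assumes "a \<in> hplane" "b \<in> hplane" "c \<in> hplane" "d \<in> hplane" "hdist a b = hdist c d"
  shows "lor (lift a) (lift b) = lor (lift c) (lift d)"
  using cosh_hdist[OF assms(1,2)] cosh_hdist[OF assms(3,4)] assms(5) by simp

text \<open>Once a boost makes the isometry fix the origin, distances from the origin preserve
  Euclidean norms and the other distances preserve inner products. The map is then the restriction
  of an orthogonal map of the plane, which acts on space by leaving the third coordinate
  alone.\<close>

theorem hisometry_lorentz:
  assumes f: "hisometry f"
  obtains F where "lorentz F" "\<And>x. x \<in> hplane \<Longrightarrow> f x = hmap F x"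
proof -
  have fh: "f x \<in> hplane" if "x \<in> hplane" for x
    using f that by (auto simp: hisometry_def bij_betw_def)
  have fd: "hdist (f x) (f y) = hdist x y" if "x \<in> hplane" "y \<in> hplane" for x y
    using f that by (auto simp: hisometry_def)
  have h0: "(0::real^2) \<in> hplane" by (simp add: hplane_iff)
  define B where "B = boost (lift (f 0))"
  have B: "lorentz B" "B (lift (f 0)) = e3"
    using lorentz_boost boost_self fh[OF h0] by (simp_all add: B_def)
  define g where "g x = hmap B (f x)" for x
  have gh: "g x \<in> hplane" if "x \<in> hplane" for x using hmap_hplane[OF B(1)] fh[OF that] by (simp add: g_def)
  have gl: "lor (lift (g x)) (lift (g y)) = lor (lift x) (lift y)" if "x \<in> hplane" "y \<in> hplane" for x y
    using that gh fh fd hdist_hmap[OF B(1)] by (intro hdist_eq_imp_lor_eq) (auto simp: g_def)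
  have g0: "g 0 = 0" using hmap_lift[OF B(1) fh[OF h0]] B(2) proj_e3 by (simp add: g_def)
  have gn: "g x \<bullet> g x = x \<bullet> x" if x: "x \<in> hplane" for x
  proof -
    have "- 1 / sqrt (1 - g x \<bullet> g x) = - 1 / sqrt (1 - x \<bullet> x)"
      using gl[OF x h0] unfolding g0 lor_lift by simp
    then show ?thesis using x gh[OF x] by (simp add: hplane_iff)
  qed
  have gi: "g x \<bullet> g y = x \<bullet> y" if xy: "x \<in> hplane" "y \<in> hplane" for x y
    using gl[OF xy] xy unfolding lor_lift gn[OF xy(1)] gn[OF xy(2)] by (auto simp: hplane_iff)
  \<comment> \<open>Extension of \<open>g\<close> from the disc to the plane by homogeneity, with
    values taken on the circle of radius 1/2; at \<open>x = 0\<close> the outer factor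
    vanishes.\<close>
  define h where "h x = (2 * norm x) *\<^sub>R g ((1 / (2 * norm x)) *\<^sub>R x)" for x
  have half: "(1 / (2 * norm x)) *\<^sub>R x \<in> hplane" for x :: "real^2"
  proof (cases "x = 0")
    case False
    then show ?thesis by (simp add: hplane_def)
  qed (simp add: h0)
  have hi: "h x \<bullet> h y = x \<bullet> y" for x y
    using gi[OF half[of x] half[of y]] by (cases "x = 0"; cases "y = 0") (auto simp: h_def field_simps)
  have hd: "dist (h x) (h y) = dist x y" for x y
    by (simp add: dist_norm norm_eq_sqrt_inner inner_diff_left inner_diff_right hi)
  have h00: "h 0 = 0" by (simp add: h_def)
  have hlin: "linear h" using isometry_linear[of h] h00 hd by blast
  have hg: "g x = h x" if x: "x \<in> hplane" for x
  proof -
    have gh': "g x \<bullet> h x = x \<bullet> x"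
      using gi[OF x half[of x]] by (cases "x = 0") (auto simp: h_def)
    have "(g x - h x) \<bullet> (g x - h x) = 0"
      using gn[OF x] hi[of x x] gh' by (simp add: inner_diff_left inner_diff_right inner_commute[of "h x" "g x"])
    then show ?thesis by simp
  qed
  define H :: "real^3 \<Rightarrow> real^3" where
    "H X = vector [h (vector [X$1, X$2]) $ 1, h (vector [X$1, X$2]) $ 2, X$3]" for X
  have Hn: "H X $ 1 = h (vector [X$1, X$2]) $ 1" "H X $ 2 = h (vector [X$1, X$2]) $ 2" "H X $ 3 = X$3" for X
    by (simp_all add: H_def)
  have "linear H"
  proof (rule linearI)
    fix X Y :: "real^3" and c :: real
    have "h (vector [X$1 + Y$1, X$2 + Y$2]) = h (vector [X$1, X$2] + vector [Y$1, Y$2])"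
      by (rule arg_cong[where f = h]) (simp add: vec_eq_iff forall_2)
    then show "H (X + Y) = H X + H Y" by (simp add: vec_eq_iff forall_3 Hn linear_add[OF hlin])
    have "h (vector [c * X$1, c * X$2]) = h (c *\<^sub>R vector [X$1, X$2])"
      by (rule arg_cong[where f = h]) (simp add: vec_eq_iff forall_2)
    then show "H (c *\<^sub>R X) = c *\<^sub>R H X" by (simp add: vec_eq_iff forall_3 Hn linear_cmul[OF hlin])
  qed
  moreover have Hl: "lor (H X) (H Y) = lor X Y" for X Y
    using hi[of "vector [X$1, X$2]" "vector [Y$1, Y$2]"] by (simp add: lor_def Hn inner2)
  moreover have "H X \<in> future" if "X \<in> future" for X
    using that Hl[of X X] by (simp add: future_def Hn)
  ultimately have H: "lorentz H" by (simp add: lorentz_def)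
  have Hm: "hmap H x = h x" for x
  proof -
    have v: "(vector [x$1, x$2] :: real^2) = x" by (simp add: vec_eq_iff forall_2)
    show ?thesis by (simp add: hmap_def vec_eq_iff forall_2 Hn) (simp add: v)
  qed
  show ?thesis
  proof (rule that[of "inv B \<circ> H"])
    show "lorentz (inv B \<circ> H)" using lorentz_comp lorentz_inv B H by blast
    show "f x = hmap (inv B \<circ> H) x" if x: "x \<in> hplane" for x
    proof -
      have "hmap (inv B \<circ> H) x = hmap (inv B) (hmap B (f x))"
        using hmap_comp[OF lorentz_inv[OF B(1)] H x] hg[OF x] by (simp add: Hm g_def)
      then show ?thesis using hmap_inv(1)[OF B(1) fh[OF x]] by simp
    qed
  qed
qed

lemma hcongruent_harea:
  assumes "hcongruent A B" "A \<subseteq> hplane" "compact A"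
  shows "harea A = harea B"
proof -
  obtain f where f: "hisometry f" "f ` A = B" using assms(1) by (auto simp: hcongruent_def)
  obtain F where F: "lorentz F" "\<And>x. x \<in> hplane \<Longrightarrow> f x = hmap F x" using hisometry_lorentz[OF f(1)] by blast
  have "hmap F ` A = B" unfolding f(2)[symmetric] by (intro image_cong) (use F assms in auto)
  then show ?thesis using harea_hmap[OF F(1) assms(2,3)] by simp
qed

section \<open>Standard position and the comparison\<close>

lemma (in convex_cycle) P_hplane: "P \<subseteq> hplane" "compact P"
proof -
  show "P \<subseteq> hplane" unfolding P using hu by (intro convex_hull_hplane) auto
  show "compact P" unfolding P by (intro compact_convex_hull finite_imp_compact) auto
qed

text \<open>\<open>W\<close> may run through the vertices in any order, in particular with step
  \<open>m\<close>, because a convex hull depends only on the set.\<close>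

lemma (in convex_cycle) circulant_standard:
  assumes "circulant n W g1 g2 \<tau>" and W: "W ` {..<n} = V ` {..<n}"
  shows "\<exists>f r. lorentz f \<and> 0 < r \<and> r < 1 \<and> hmap f ` P = std_polygon n r"
proof -
  obtain f r where f: "lorentz f" "0 < r" "r < 1" "(\<lambda>i. proj (f (W i))) ` {..<n} = std_vertex n r ` {..<n}"
    using circulant.standard_position[OF assms(1)] by blast
  have "hmap f ` (u ` {..<n}) = (\<lambda>X. proj (f X)) ` (V ` {..<n})"
    unfolding image_image by (intro image_cong refl hmap_lift f hu)
  also have "\<dots> = std_vertex n r ` {..<n}" unfolding W[symmetric] image_image f(4) ..
  finally have "hmap f ` P = std_polygon n r"
    unfolding P std_polygon_def using hmap_convex_hull[OF f(1), of "u ` {..<n}"] hu by auto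
  then show ?thesis using f by blast
qed

lemma (in convex_cycle) V_inj: "inj_on V {..<n}"
proof (rule inj_onI)
  fix i j assume ij: "i \<in> {..<n}" "j \<in> {..<n}" "V i = V j"
  then have "u i = u j" using proj_lift hu by metis
  then show "i = j" using u_inj ij by (simp add: inj_on_def)
qed

text \<open>The side length fixes the products of neighbouring vertices, and by the law of cosines
  the angle fixes those of vertices two apart; this is all that \<open>circulant\<close> asks
  for.\<close>

theorem regular_standard:
  assumes R: "regular_ngon n R" and n3: "n \<ge> 3"
  shows "\<exists>f r. lorentz f \<and> 0 < r \<and> r < 1 \<and> hmap f ` R = std_polygon n r"
proof -
  obtain v s \<alpha> where ng: "hngon n R" and cv: "cyclic_vertices n v R"
    and side: "\<And>i. i < n \<Longrightarrow> hdist (v i) (v ((i + 1) mod n)) = s"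
    and angle: "\<And>i. i < n \<Longrightarrow> hangle (v ((i + n - 1) mod n)) (v i) (v ((i + 1) mod n)) = \<alpha>"
    using R unfolding regular_ngon_def by blast
  obtain \<sigma> where cc: "convex_cycle n (\<lambda>i. v (i mod n)) \<sigma> R" using polygon_orientation[OF n3 ng cv] .
  define u where "u = (\<lambda>i. v (i mod n))"
  interpret convex_cycle n u \<sigma> R using cc unfolding u_def .
  have np: "0 < n" using n3 by simp
  have side': "lor (V i) (V (i + 1)) = - cosh s" for i
  proof -
    have "hdist (u i) (u (i + 1)) = s" using side[of "i mod n"] np by (simp add: u_def mod_Suc_eq)
    then show ?thesis using cosh_hdist[OF hu hu, of i "i + 1"] by simp
  qed
  have prev: "V (i + n - 1 + 1) = V i" for i using V_periodic[of i] np by simp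
  have nd: "ldet (V i) (V (i + 1)) (V (i + n - 1)) \<noteq> 0" for i
  proof -
    have "1 < n - 1" "n - 1 < n" "i + (n - 1) = i + n - 1" using n3 by auto
    then show ?thesis using orient[of 1 "n - 1" i] by auto
  qed
  define q where "q = (cosh s)\<^sup>2 - 1"
  have tq: "tform (V i) (V (i + 1)) (V (i + 1)) = q" for i
    using hu by (simp add: tform_def side'[simplified] H2_self q_def power2_eq_square)
  have side2: "lor (V i) (V (i + n - 1)) = - cosh s" for i
    using side'[of "i + n - 1"] unfolding prev by (simp add: lor_commute)
  have tq': "tform (V i) (V (i + n - 1)) (V (i + n - 1)) = q" for i
    unfolding tform_def side2 using hu by (simp add: H2_self q_def power2_eq_square)
  have q0: "q > 0" using tform_pos[OF V_H2 nd[of 0]] tq[of 0] by simp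
  have far: "lor (V (i + n - 1)) (V (i + 1)) = cos \<alpha> * q - (cosh s)\<^sup>2" for i
  proof -
    have "hangle (u (i + n - 1)) (u i) (u (i + 1)) = \<alpha>"
    proof -
      have "(i mod n + n - 1) mod n = (i + n - 1) mod n" "(i mod n + 1) mod n = (i + 1) mod n"
        using np by (metis Nat.add_diff_assoc mod_add_left_eq One_nat_def Suc_leI, simp add: mod_Suc_eq)
      then show ?thesis using angle[of "i mod n"] np by (simp add: u_def)
    qed
    then have "ang (V i) (V (i + n - 1)) (V (i + 1)) = \<alpha>" using hangle_ang hu by simp
    then have "cos \<alpha> = tform (V i) (V (i + n - 1)) (V (i + 1)) / sqrt (q * q)"
      using cos_arccos_abs[OF tform_cos_bound[OF V_H2, of i "V (i + n - 1)" "V (i + 1)"]] unfolding ang_def tq tq'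
      by metis
    then have "tform (V i) (V (i + n - 1)) (V (i + 1)) = cos \<alpha> * q" using q0 by (simp add: field_simps)
    then show ?thesis unfolding tform_def side2 side' by (simp add: power2_eq_square)
  qed
  have "circulant n V (- cosh s) (cos \<alpha> * q - (cosh s)\<^sup>2) \<sigma>"
  proof
    show "lor (V i) (V (i + 2)) = cos \<alpha> * q - (cosh s)\<^sup>2" for i
    proof -
      have "i + 1 + n - 1 = i + n" "i + 1 + 1 = i + 2" by simp_all
      then show ?thesis using far[of "i + 1"] V_periodic[of i] by metis
    qed
    show "0 < \<sigma> * ldet (V i) (V (i + 1)) (V (i + 2))" for i using orient[of 1 2 i] n3 by simp
  qed (use n3 V_periodic V_inj side' in auto)
  then show ?thesis by (rule circulant_standard) simp
qed

text \<open>Equal \<open>S\<close> give equal \<open>c\<close>, hence equal products at step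
  \<open>m\<close>. For two such steps, the points are the ends of one side; two congruent
  butterflies place both at the same distance from the foot on it, so the foot is the midpoint and
  all sides are equal.\<close>

lemma (in reduced_cycle) reduced_standard:
  assumes St: "\<And>i. S i = t"
  shows "\<exists>f r. lorentz f \<and> 0 < r \<and> r < 1 \<and> hmap f ` P = std_polygon n r"
proof -
  define k where "k = C * (C + t) / (1 + C * t)"
  have ck: "c i = k" for i using butterfly.c_eq[OF butterfly[of i]] by (simp add: St k_def)
  \<comment> \<open>cosh of half a side.\<close>
  define y where "y = k / C"
  have y: "y > 0" using butterfly.c_gt(2)[OF butterfly[of 0]] C by (simp add: y_def ck)
  let ?W = "\<lambda>j. V (j * m)"
  have g1: "lor (V i) (V (i + m)) = - k" for i using ck[of i] by (simp add: c_def)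
  have g2: "lor (V i) (V (i + m + m)) = 1 - 2 * y\<^sup>2" for i
  proof -
    obtain a b where ab: "a > 0" "b > 0" "T (i + m) = a *\<^sub>R V (i + m + m) + b *\<^sub>R V i"
      using T_comb[of "i + m"] V2m1[of i] by auto
    define g where "g = lor (V i) (V (i + m + m))"
    have g': "lor (V (i + m + m)) (V i) = g" by (simp add: g_def lor_commute)
    have 1: "lor (V i) (T (i + m)) = - y" using butterfly.T_inner(2)[OF butterfly[of i]] by (simp add: ck y_def)
    have 2: "lor (V (i + m + m)) (T (i + m)) = - y"
      using butterfly.T_inner(3)[OF butterfly[of "i + m"]] by (simp add: ck y_def)
    have 3: "lor (T (i + m)) (T (i + m)) = -1" using T_H2 H2_self by blast
    have e1: "a * g - b = - y" using 1 by (simp add: ab(3) g_def[symmetric] H2_self)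
    have e2: "b * g - a = - y" using 2 by (simp add: ab(3) g' H2_self)
    have "g \<noteq> -1"
    proof
      assume "g = -1"
      then have "V i = V (i + m + m)" using H2_eqI V_H2 by (simp add: g_def)
      moreover have "0 < \<sigma> * ldet (V i) (V (i + m)) (V (i + (m + m)))" using orient[of m "m + m" i] m1 nm by simp
      ultimately show False by (simp add: add.assoc)
    qed
    \<comment> \<open>Equal products of the two ends with the foot force equal coefficients, unless
      the ends coincide.\<close>
    moreover have "(a - b) * (g + 1) = 0" using e1 e2 by (simp add: algebra_simps)
    ultimately have ab': "a = b" by simp
    have "-1 = a * lor (V (i + m + m)) (T (i + m)) + b * lor (V i) (T (i + m))"
      using 3 by (subst (asm) (1) ab(3)) simp
    then have ay: "2 * (a * y) = 1" unfolding 1 2 ab' by simp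
    have "y * (a * g - a) = y * (- y)" using e1 ab' by simp
    then have "(a * y) * (g - 1) = - (y * y)" by (simp add: algebra_simps)
    moreover have "a * y = 1 / 2" using ay by simp
    ultimately have "1 / 2 * (g - 1) = - (y * y)" by simp
    then show ?thesis by (simp add: g_def power2_eq_square)
  qed
  have Wmod: "?W ` {..<n} = V ` {..<n}"
  proof -
    have np: "0 < n" using n3 by simp
    have "\<exists>j<n. V (j * m) = V i" for i
    proof -
      \<comment> \<open>\<open>(n - 1) * 2\<close> is inverse to \<open>m\<close> modulo
        \<open>n\<close>, as \<open>2 * m = n - 1\<close> and the square of \<open>n - 1\<close> is
        1 modulo \<open>n\<close>.\<close>
      define j where "j = (n - 1) * 2 * i mod n"
      have "V (j * m) = V ((n - 1) * 2 * i * m)" by (rule V_mod) (simp add: j_def mod_mult_left_eq)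
      also have "(n - 1) * 2 * i * m = i + (n - 2) * i * n"
      proof -
        have n1: "n - 1 = 2 * m" "n - 2 = 2 * m - 1" "n = 2 * m + 1" using nm by auto
        have "int ((n - 1) * 2 * i * m) = int (i + (n - 2) * i * n)"
          unfolding n1(1,2) using m1 by (simp add: of_nat_diff n1(3) algebra_simps)
        then show ?thesis by (simp only: of_nat_eq_iff)
      qed
      also have "V (i + (n - 2) * i * n) = V i" by (rule V_add_mult)
      finally show ?thesis using np by (intro exI[of _ j]) (simp add: j_def)
    qed
    moreover have "\<exists>j<n. V j = V i" for i using V_mod[of "i mod n" i] np by (intro exI[of _ "i mod n"]) simp
    ultimately show ?thesis by (auto simp: image_iff Bex_def) metis+
  qed
  have "circulant n ?W (- k) (1 - 2 * y\<^sup>2) \<sigma>"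
  proof
    have s1: "(i + 1) * m = i * m + m" and s2: "(i + 2) * m = i * m + m + m" for i by simp_all
    show "lor (V (i * m)) (V ((i + 1) * m)) = - k" for i unfolding s1 by (rule g1)
    show "lor (V (i * m)) (V ((i + 2) * m)) = 1 - 2 * y\<^sup>2" for i unfolding s2 by (rule g2)
    show "0 < \<sigma> * ldet (V (i * m)) (V ((i + 1) * m)) (V ((i + 2) * m))" for i
      unfolding s1 s2 using orient[of m "m + m" "i * m"] m1 nm by (simp add: add.assoc)
    show "V ((i + n) * m) = V (i * m)" for i
    proof -
      have "(i + n) * m = i * m + m * n" by (simp add: algebra_simps)
      then show ?thesis by (simp only: V_add_mult)
    qed
    show "inj_on ?W {..<n}"
      by (rule eq_card_imp_inj_on) (simp_all add: Wmod card_image[OF V_inj])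
  qed (use n3 in auto)
  then show ?thesis by (rule circulant_standard) (rule Wmod)
qed

lemma hcongruent_via_standard:
  assumes f: "lorentz f" "hmap f ` A = D" and g: "lorentz g" "hmap g ` B = D" and A: "A \<subseteq> hplane" and B: "B \<subseteq> hplane"
  shows "hcongruent A B"
proof -
  have l: "lorentz (inv g \<circ> f)" using lorentz_comp lorentz_inv f g by blast
  have "hmap (inv g \<circ> f) ` A = hmap (inv g) ` (hmap f ` A)"
    unfolding image_image by (intro image_cong refl) (use hmap_comp[OF lorentz_inv[OF g(1)] f(1)] A in auto)
  also have "\<dots> = hmap (inv g) ` (hmap g ` B)" by (simp add: f(2) g(2))
  also have "\<dots> = B" by (rule hmap_inv_image(2)[OF g(1) B])
  finally show ?thesis unfolding hcongruent_def using hisometry_hmap[OF l] by blast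
qed

theorem theorem4p2:
  fixes w :: real and n :: nat and R R' :: "(real^2) set"
  assumes "w > 0" and "n \<ge> 3" and "odd n"
    and "ordinary_reduced n w R"
    and "regular_ngon n R'" and "thickness R' = w"
  shows "harea R \<le> harea R' \<and> (harea R = harea R' \<longleftrightarrow> hcongruent R R')"
proof -
  note n3 = \<open>n \<ge> 3\<close>
  obtain f r where f: "lorentz f" and r: "0 < r" "r < 1" and fR: "hmap f ` R' = std_polygon n r"
    using regular_standard[OF assms(5) n3] by blast
  have R': "R' \<subseteq> hplane" "compact R'" using assms(5) by (auto simp: regular_ngon_def hngon_def hpolygon_def hconvex_body_def)
  have "w = arcosh (std_cosh n r)" and h1: "std_cosh n r \<ge> 1"
    using thickness_hmap[OF f R'(1)] thickness_std_polygon[OF n3 \<open>odd n\<close> r] assms(6) fR by simp_all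
  then have cw: "cosh w = std_cosh n r" by simp
  \<comment> \<open>The sine of half the angle of \<open>R'\<close>; since \<open>cosh w\<close> is
    the \<open>std_cosh\<close> of its radius, \<open>t\<close> is the value of \<open>S\<close> at
    which a butterfly of height \<open>w\<close> has the angle \<pi> / n.\<close>
  define t where "t = std_sin n r"
  note t = std_sin_bounds(1,2)[OF n3 r, folded t_def]
  have "butterfly_cos (cosh w) t = cos (pi / real n)" using std_sin_bounds(3)[OF n3 r] by (simp add: cw t_def)
  moreover have "0 \<le> pi / real n" "pi / real n \<le> pi" using n3 by (auto simp: divide_le_eq)
  ultimately have tb: "arccos (butterfly_cos (cosh w) t) = pi / real n" by (simp add: arccos_cos)
  have aR': "harea R' = (real n - 2) * pi - 2 * real n * arcsin t"
    using harea_hmap[OF f R'] harea_std_polygon[OF n3 r] by (simp add: fR t_def)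
  obtain u \<sigma> T where rc: "reduced_cycle n u \<sigma> R ((n - 1) div 2) (cosh w) (sinh w) T"
    using ordinary_reduced_cycle[OF assms(4,1) n3] .
  interpret reduced_cycle n u \<sigma> R "(n - 1) div 2" "cosh w" "sinh w" T by (rule rc)
  have le: "harea R \<le> harea R'" using harea_reduced_bound(1)[OF t tb] aR' by simp
  have "hcongruent R R'" if eq: "harea R = harea R'"
  proof -
    have "S i = t" for i using harea_reduced_bound(2)[OF t tb] eq aR' by simp
    then obtain g \<rho> where g: "lorentz g" "0 < \<rho>" "\<rho> < 1" "hmap g ` R = std_polygon n \<rho>"
      using reduced_standard by blast
    \<comment> \<open>The standard position of \<open>R\<close> comes with a radius of its own;
      equality of the areas identifies it with that of \<open>R'\<close>.\<close>
    have "harea (std_polygon n \<rho>) = harea R" using harea_hmap[OF g(1) P_hplane] by (simp add: g(4))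
    then have "real n * arcsin (std_sin n \<rho>) = real n * arcsin (std_sin n r)"
      using eq aR' harea_std_polygon[OF n3 g(2,3)] by (simp add: t_def)
    then have "arcsin (std_sin n \<rho>) = arcsin (std_sin n r)" using n3 by simp
    moreover have "-1 \<le> std_sin n \<rho>" "std_sin n \<rho> \<le> 1" "-1 \<le> std_sin n r" "std_sin n r \<le> 1"
      using std_sin_bounds(1,2)[OF n3 g(2,3)] std_sin_bounds(1,2)[OF n3 r] by auto
    ultimately have "std_sin n \<rho> = std_sin n r" by (metis sin_arcsin)
    then have "\<rho> = r" using std_sin_inj[OF n3 g(2,3) r] by simp
    then show ?thesis using hcongruent_via_standard[OF g(1,4) f _ P_hplane(1) R'(1)] fR by simp
  qed
  then show ?thesis using le hcongruent_harea[OF _ P_hplane] by blast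
qed

end
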